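(* There is an algorithm that, given a connected chordal bipartite graph $G$, a partial order $\pi$ on $V(G)$ and a vertex $r\in V(G)$, decides in time $O(|\pi|\cdot|V(G)|^2)$ whether there is an LBFS ordering of $G$ that starts in $r$ and is a linear extension of $\pi$ (and outputs such an ordering if one exists).
   Context: Graphs are finite, simple, undirected. A bipartite graph is chordal bipartite if every induced cycle has length four. LBFS orderings are defined via Label Search: every vertex starts with label $\emptyset$ (a set of positive integers); for $i=1,\dots,|V(G)|$, choose an unnumbered vertex $v$ whose label is maximal among unnumbered vertices with respect to the strict partial order $A\prec B$ iff $A\subsetneq B$ or $\min(A\setminus B)>\min(B\setminus A)$ (i.e. no unnumbered $y$ has $\mathrm{label}(v)\prec\mathrm{label}(y)$), set $\sigma(i)=v$, and add $i$ to the label of every unnumbered neighbor of $v$. Any ordering producible this way is an LBFS ordering. A linear extension of $\pi$ is a total order $\sigma$ with $x$ before $y$ whenever $(x,y)\in\pi$, $x\neq y$. $|\pi|$ is the number of pairs in $\pi$. *)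

theory Defs
  imports Complex_Main "Graph_Theory.Graph_Theory"
begin

section \<open>Graphs\<close>

text \<open>
  A finite simple undirected graph is a \<^locale>\<open>pair_graph\<close>: a finite, symmetric, loop-free set
  of pairs, so that an undirected edge $uv$ is represented by the two arcs $(u,v)$ and $(v,u)$.
\<close>

definition bipartite :: "'a pair_pre_digraph \<Rightarrow> bool" where
  "bipartite G \<longleftrightarrow> (\<exists>A B. pverts G = A \<union> B \<and> A \<inter> B = {} \<and> parcs G \<subseteq> A \<times> B \<union> B \<times> A)"

text \<open>
  An induced cycle is given by the list of its vertices in cyclic order. The library's notion of
  cycle is not used, because in a symmetric digraph it also covers the closed walks $u,v,u$ along
  a single edge.
\<close>

definition induced_cycle :: "'a pair_pre_digraph \<Rightarrow> 'a list \<Rightarrow> bool" where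
  "induced_cycle G c \<longleftrightarrow>
     3 \<le> length c \<and> distinct c \<and> set c \<subseteq> pverts G \<and>
     (\<forall>i < length c. \<forall>j < length c.
        (c ! i, c ! j) \<in> parcs G \<longleftrightarrow> j = Suc i mod length c \<or> i = Suc j mod length c)"

definition chordal_bipartite :: "'a pair_pre_digraph \<Rightarrow> bool" where
  "chordal_bipartite G \<longleftrightarrow> bipartite G \<and> (\<forall>c. induced_cycle G c \<longrightarrow> length c = 4)"


section \<open>Label Search and LBFS orderings\<close>

text \<open>
  \<open>label_search prec G xs lab\<close>: after \<open>length xs\<close> rounds, the vertices numbered so far are, in
  this order, those of \<open>xs\<close>, and the current labels are given by \<open>lab\<close>. Lists are
  indexed from 0, whereas the numbers put into the labels start with 1.
\<close>

inductive label_search ::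
  "(nat set \<Rightarrow> nat set \<Rightarrow> bool) \<Rightarrow> 'a pair_pre_digraph \<Rightarrow> 'a list \<Rightarrow> ('a \<Rightarrow> nat set) \<Rightarrow> bool"
  for prec :: "nat set \<Rightarrow> nat set \<Rightarrow> bool" and G :: "'a pair_pre_digraph"
where
  start: "label_search prec G [] (\<lambda>_. {})"
| step: "\<lbrakk> label_search prec G xs lab;
           v \<in> pverts G - set xs;
           \<not> (\<exists>y \<in> pverts G - set xs. prec (lab v) (lab y)) \<rbrakk> \<Longrightarrow>
         label_search prec G (xs @ [v])
           (\<lambda>u. if u \<in> pverts G - set (xs @ [v]) \<and> (v, u) \<in> parcs G
                then insert (Suc (length xs)) (lab u) else lab u)"

text \<open>
  The two differences have to be nonempty for their minima to make sense. If \<open>A - B\<close> is empty,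
  only the first alternative can apply; if \<open>B - A\<close> is empty, \<open>A\<close> is not below \<open>B\<close>.
\<close>

definition lbfs_prec :: "nat set \<Rightarrow> nat set \<Rightarrow> bool" where
  "lbfs_prec A B \<longleftrightarrow>
     A \<subset> B \<or> (A - B \<noteq> {} \<and> B - A \<noteq> {} \<and> Min (A - B) > Min (B - A))"

definition lbfs_ordering :: "'a pair_pre_digraph \<Rightarrow> 'a list \<Rightarrow> bool" where
  "lbfs_ordering G xs \<longleftrightarrow>
     length xs = card (pverts G) \<and> (\<exists>lab. label_search lbfs_prec G xs lab)"

definition linear_extension :: "'a set \<Rightarrow> 'a rel \<Rightarrow> 'a list \<Rightarrow> bool" where
  "linear_extension V P xs \<longleftrightarrow>
     distinct xs \<and> set xs = V \<and>
     (\<forall>(x, y) \<in> P. x \<noteq> y \<longrightarrow> (\<exists>i j. i < j \<and> j < length xs \<and> xs ! i = x \<and> xs ! j = y))"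

definition rooted_lbfs_extension :: "'a pair_pre_digraph \<Rightarrow> 'a rel \<Rightarrow> 'a \<Rightarrow> 'a list \<Rightarrow> bool" where
  "rooted_lbfs_extension G P r xs \<longleftrightarrow>
     lbfs_ordering G xs \<and> xs \<noteq> [] \<and> hd xs = r \<and> linear_extension (pverts G) P xs"


section \<open>Machine model\<close>

text \<open>
  Algorithms are programs for a word RAM with unit-cost arithmetic, written in a structured
  language. A program uses a fixed finite number of arrays of words; a scalar variable is an array
  of which only cell 0 is used. (Interleaving the arrays turns this into a RAM with a single
  memory, at the price of a constant factor depending on the program.)

  All semantic notions take the largest number \<open>W\<close> that fits into a word. An execution in which a
  larger number would be a literal, an address, an intermediate result or a memory content does
  not exist.
\<close>

type_synonym vname = string
type_synonym memory = "vname \<Rightarrow> nat \<Rightarrow> nat"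

datatype binop = Add | Sub | Mul | Less | Equal

datatype expr =
    Const nat
  | Cell vname expr
  | Bin binop expr expr

datatype com =
    Skip
  | Assign vname expr expr  \<comment> \<open>array, index, new value\<close>
  | Seq com com
  | Cond expr com com
  | While expr com

text \<open>\<open>Sub\<close> is truncated subtraction; comparisons return 1 for true and 0 for false.\<close>

fun apply_op :: "binop \<Rightarrow> nat \<Rightarrow> nat \<Rightarrow> nat" where
  "apply_op Add a b = a + b"
| "apply_op Sub a b = a - b"
| "apply_op Mul a b = a * b"
| "apply_op Less a b = of_bool (a < b)"
| "apply_op Equal a b = of_bool (a = b)"

fun val :: "memory \<Rightarrow> expr \<Rightarrow> nat" where
  "val s (Const k) = k"
| "val s (Cell x e) = s x (val s e)"
| "val s (Bin f e1 e2) = apply_op f (val s e1) (val s e2)"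

fun fits :: "nat \<Rightarrow> memory \<Rightarrow> expr \<Rightarrow> bool" where
  "fits W s (Const k) \<longleftrightarrow> k \<le> W"
| "fits W s (Cell x e) \<longleftrightarrow> fits W s e \<and> val s (Cell x e) \<le> W"
| "fits W s (Bin f e1 e2) \<longleftrightarrow> fits W s e1 \<and> fits W s e2 \<and> val s (Bin f e1 e2) \<le> W"

fun cost :: "expr \<Rightarrow> nat" where
  "cost (Const k) = 1"
| "cost (Cell x e) = 1 + cost e"
| "cost (Bin f e1 e2) = 1 + cost e1 + cost e2"

text \<open>
  \<open>exec W p s t s'\<close>: started in memory \<open>s\<close>, the program \<open>p\<close> halts after exactly \<open>t\<close> steps
  in memory \<open>s'\<close>.
\<close>

inductive exec :: "nat \<Rightarrow> com \<Rightarrow> memory \<Rightarrow> nat \<Rightarrow> memory \<Rightarrow> bool" for W :: nat where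
  Skip: "exec W Skip s 1 s"
| Assign: "\<lbrakk> fits W s i; fits W s e \<rbrakk> \<Longrightarrow>
    exec W (Assign x i e) s (1 + cost i + cost e) (s(x := (s x)(val s i := val s e)))"
| Seq: "\<lbrakk> exec W p s t s'; exec W q s' t' s'' \<rbrakk> \<Longrightarrow> exec W (Seq p q) s (t + t') s''"
| CondTrue: "\<lbrakk> fits W s b; val s b \<noteq> 0; exec W p s t s' \<rbrakk> \<Longrightarrow>
    exec W (Cond b p q) s (1 + cost b + t) s'"
| CondFalse: "\<lbrakk> fits W s b; val s b = 0; exec W q s t s' \<rbrakk> \<Longrightarrow>
    exec W (Cond b p q) s (1 + cost b + t) s'"
| WhileTrue: "\<lbrakk> fits W s b; val s b \<noteq> 0; exec W p s t s'; exec W (While b p) s' t' s'' \<rbrakk> \<Longrightarrow>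
    exec W (While b p) s (1 + cost b + t + t') s''"
| WhileFalse: "\<lbrakk> fits W s b; val s b = 0 \<rbrakk> \<Longrightarrow> exec W (While b p) s (1 + cost b) s"

inductive_cases SkipE: "exec W Skip s t s'"
inductive_cases AssignE: "exec W (Assign x i e) s t s'"
inductive_cases SeqE: "exec W (Seq p q) s t s'"
inductive_cases CondE: "exec W (Cond b p q) s t s'"
inductive_cases WhileE: "exec W (While b p) s t s'"

text \<open>
  Programs are deterministic. Hence the existence of an execution says that the computation
  halts, and its running time and final memory are uniquely determined.
\<close>

lemma exec_deterministic:
  "exec W p s t s' \<Longrightarrow> exec W p s u s'' \<Longrightarrow> u = t \<and> s'' = s'"
proof (induction arbitrary: u s'' rule: exec.induct)
  case (Skip s)
  then show ?case by (rule SkipE) simp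
next
  case (Assign s i e x)
  from Assign.prems show ?case by (rule AssignE) simp
next
  case (Seq p s t s1 q t' s2)
  from Seq.prems obtain v s3 v' where
    "u = v + v'" and p: "exec W p s v s3" and q: "exec W q s3 v' s''"
    by (rule SeqE)
  moreover from Seq.IH(1)[OF p] Seq.IH(2) q have "v = t" "v' = t'" "s'' = s2"
    by auto
  ultimately show ?case by simp
next
  case (CondTrue s b p t s' q)
  from CondTrue.prems CondTrue.hyps(2) obtain v where
    "u = Suc (cost b + v)" and p: "exec W p s v s''"
    by (elim CondE) simp_all
  with CondTrue.IH[OF p] show ?case by simp
next
  case (CondFalse s b q t s' p)
  from CondFalse.prems CondFalse.hyps(2) obtain v where
    "u = Suc (cost b + v)" and q: "exec W q s v s''"
    by (elim CondE) simp_all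
  with CondFalse.IH[OF q] show ?case by simp
next
  case (WhileTrue s b p t s1 t' s2)
  from WhileTrue.prems obtain v s3 v' where
    "u = Suc (cost b + v + v')" and p: "exec W p s v s3" and w: "exec W (While b p) s3 v' s''"
    by (rule WhileE) (use WhileTrue.hyps(2) in simp_all)
  moreover from WhileTrue.IH(1)[OF p] WhileTrue.IH(2) w have "v = t" "v' = t'" "s'' = s2"
    by auto
  ultimately show ?case by simp
next
  case (WhileFalse s b p)
  from WhileFalse.prems show ?case
    by (rule WhileE) (use WhileFalse.hyps(2) in simp_all)
qed

text \<open>
  The vertices of an input graph are the numbers below $n = |V(G)|$. The graph and the partial order
  are both given as 0/1 matrices, stored row by row. All other cells initially contain 0.
\<close>

definition input_memory :: "nat pair_pre_digraph \<Rightarrow> nat rel \<Rightarrow> nat \<Rightarrow> memory" where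
  "input_memory G P r =
    (let n = card (pverts G);
         matrix = (\<lambda>R i. of_bool (i < n * n \<and> (i div n, i mod n) \<in> R))
     in (\<lambda>_ _. 0)
          (''n'' := (\<lambda>_. 0)(0 := n),
           ''r'' := (\<lambda>_. 0)(0 := r),
           ''adj'' := matrix (parcs G),
           ''order'' := matrix P))"

end

theory Submission
  imports Defs
begin

text \<open>
  An LBFS ordering from \<open>r\<close> visits the layers of the bipartite graph one after the other. For two
  vertices \<open>x\<close>, \<open>y\<close> of the same layer, let \<open>A\<close> (\<open>B\<close>) be the set of neighbours in the preceding layer
  that only \<open>x\<close> (only \<open>y\<close>) has. If \<open>A\<close> and \<open>B\<close> are nonempty, then \<open>x\<close> precedes \<open>y\<close> iff the first
  vertex of \<open>A\<close> precedes the first vertex of \<open>B\<close>; if one of them is empty, then the order is forced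
  or, for twins, free. Chordality makes the neighbourhoods, in the layer above, of the vertices of \<open>A\<close>
  a chain, and the first vertex of \<open>A\<close> in any LBFS ordering has the largest one. Hence, up to twins,
  the first vertices \<open>a\<close> of \<open>A\<close> and \<open>b\<close> of \<open>B\<close> can be read off an arbitrary LBFS ordering, and a
  constraint on \<open>(x, y)\<close> can be replaced by one on \<open>(a, b)\<close>, layer by layer, until \<open>a\<close> and \<open>b\<close> are
  twins. The remaining constraint, that some vertex of \<open>A\<close> precedes all of \<open>B\<close>, only concerns the
  order inside one class of twins, where LBFS may break ties arbitrarily. Such constraints are
  monotone: numbering a vertex never blocks another one. So a greedy LBFS that avoids blocked vertices
  gets stuck only if there is no solution.

  There are at most \<open>|\<pi>|\<close> constraints with at most \<open>n\<close> replacements each, every replacement takes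
  time \<open>O(n)\<close>, and every one of the \<open>n\<close> rounds of the greedy search takes time \<open>O(|\<pi>| n)\<close>, because
  reflexivity gives \<open>n \<le> |\<pi>|\<close>.
\<close>


section \<open>Layers of a connected bipartite graph\<close>

text \<open>Which vertices of \<open>A\<close> and \<open>B\<close> come first depends on the order
  that is sought, so a replacement read off one search order \<open>ts\<close> has to be shown valid
  for all of them. Two facts achieve this. The first vertex of \<open>A\<close> always has the
  largest set among the nested ones, so its twin class is the same in every search; and for two
  vertices of one layer that are no twins, their order depends only on their twin classes. Twins
  need only share their neighbours in the preceding layer: later layers are still unnumbered when
  they compete.

  Once \<open>a\<close> and \<open>b\<close> are twins, this breaks down, since another order may
  begin \<open>A\<close> and \<open>B\<close> with other members of the class. Hence a chain does
  not end in a precedence between two fixed vertices, but in a disjunctive condition that is tested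
  when a vertex would decide it.

  That the greedy search meets no dead end is an exchange argument against a hypothetical solution:
  among the unnumbered twins of a vertex with maximal label, the one that the solution numbers first
  is never blocked.\<close>

locale rooted_bipartite =
  fixes V :: "'a set" and E :: "'a rel" and r :: 'a
  assumes E_V: "E \<subseteq> V \<times> V"
    and sym_E: "sym E"
    and root_V: "r \<in> V"
    and reach: "v \<in> V \<Longrightarrow> (r, v) \<in> E\<^sup>*"
    and two_colourable: "\<exists>S. \<forall>(u, v) \<in> E. u \<in> S \<longleftrightarrow> v \<notin> S"
begin

lemma E_sym: "(u, v) \<in> E \<Longrightarrow> (v, u) \<in> E"
  using sym_E by (auto dest: symD)

lemma E_in_V: "(u, v) \<in> E \<Longrightarrow> u \<in> V" "(u, v) \<in> E \<Longrightarrow> v \<in> V"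
  using E_V by auto

definition depth :: "'a \<Rightarrow> nat" where
  "depth v = (LEAST k. (r, v) \<in> E ^^ k)"

lemma depth_relpow: "v \<in> V \<Longrightarrow> (r, v) \<in> E ^^ depth v"
  unfolding depth_def using reach[of v] by (auto simp: rtrancl_power intro: LeastI_ex)

lemma depth_le: "(r, v) \<in> E ^^ k \<Longrightarrow> depth v \<le> k"
  unfolding depth_def by (rule Least_le)

lemma depth_root [simp]: "depth r = 0"
  using depth_le[of r 0] by simp

lemma depth_eq_0: "v \<in> V \<Longrightarrow> depth v = 0 \<longleftrightarrow> v = r"
  using depth_relpow[of v] by auto

lemma depth_edge_le: "(u, v) \<in> E \<Longrightarrow> depth v \<le> Suc (depth u)"
  using depth_relpow[of u] E_in_V by (intro depth_le) auto

lemma relpow_parity: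
  assumes "\<forall>(u, v) \<in> E. u \<in> S \<longleftrightarrow> v \<notin> S" "(r, v) \<in> E ^^ k"
  shows "(v \<in> S \<longleftrightarrow> r \<in> S) \<longleftrightarrow> even k"
  using assms(2)
proof (induction k arbitrary: v)
  case (Suc k)
  then obtain w where "(r, w) \<in> E ^^ k" "(w, v) \<in> E" by auto
  with Suc.IH[of w] assms(1) show ?case by auto
qed auto

text \<open>Walks of equal length from \<open>r\<close> to both ends would give the ends the same
  colour.\<close>

lemma depth_edge_neq:
  assumes "(u, v) \<in> E"
  shows "depth u \<noteq> depth v"
proof
  assume eq: "depth u = depth v"
  obtain S where S: "\<forall>(u, v) \<in> E. u \<in> S \<longleftrightarrow> v \<notin> S" using two_colourable by blast
  have "(u \<in> S \<longleftrightarrow> r \<in> S) \<longleftrightarrow> (v \<in> S \<longleftrightarrow> r \<in> S)"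
    using relpow_parity[OF S depth_relpow] E_in_V[OF assms] eq by metis
  with S assms show False by auto
qed

lemma depth_edge: "(u, v) \<in> E \<Longrightarrow> depth v = Suc (depth u) \<or> depth u = Suc (depth v)"
  using depth_edge_le[of u v] depth_edge_le[of v u] depth_edge_neq[of u v] E_sym[of u v] by force

text \<open>Equality of \<open>lower\<close> is the twin relation of the whole proof. Within a layer
  it says that two unnumbered vertices have equal labels in every search.\<close>

definition lower :: "'a \<Rightarrow> 'a set" where
  "lower v = {u. (u, v) \<in> E \<and> depth u < depth v}"

lemma lowerD: "u \<in> lower v \<Longrightarrow> (u, v) \<in> E \<and> depth v = Suc (depth u) \<and> u \<in> V \<and> v \<in> V"
  unfolding lower_def using depth_edge[of u v] E_in_V by auto

lemma lower_root [simp]: "lower r = {}"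
  by (auto simp: lower_def)

lemma lower_nonempty:
  assumes "v \<in> V" "v \<noteq> r"
  shows "lower v \<noteq> {}"
proof -
  obtain k where k: "depth v = Suc k" using assms depth_eq_0 by (cases "depth v") auto
  with depth_relpow[OF assms(1)] obtain u where "(r, u) \<in> E ^^ k" "(u, v) \<in> E" by auto
  with depth_le[of u k] k show ?thesis by (auto simp: lower_def)
qed

text \<open>A common lower neighbour fixes the layer; if there is none, both vertices are the
  root.\<close>

lemma lower_eq_depth:
  assumes "u \<in> V" "v \<in> V" "lower u = lower v"
  shows "depth u = depth v"
proof (cases "lower u = {}")
  case True
  with assms lower_nonempty show ?thesis by metis
next
  case False
  then obtain w where "w \<in> lower u" by blast
  with assms(3) lowerD[of w u] lowerD[of w v] show ?thesis by simp
qed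

end

section \<open>Lexicographic search\<close>

text \<open>
  Labels are not represented: after the vertices of \<open>xs\<close> have been numbered, the label of \<open>u\<close>
  consists of the positions \<open>j\<close> (shifted by one) for which \<open>xs ! j\<close> is a neighbour of \<open>u\<close>.
\<close>

definition lex_max :: "'a rel \<Rightarrow> 'a set \<Rightarrow> 'a \<Rightarrow> 'a list \<Rightarrow> 'a \<Rightarrow> bool" where
  "lex_max E V r xs v \<longleftrightarrow> v \<in> V - set xs \<and> (xs = [] \<longrightarrow> v = r) \<and>
     (\<forall>u \<in> V - set xs. \<forall>j < length xs. (xs ! j, u) \<in> E \<and> (xs ! j, v) \<notin> E \<longrightarrow>
        (\<exists>k<j. (xs ! k, v) \<in> E \<and> (xs ! k, u) \<notin> E))"

definition search_prefix :: "'a rel \<Rightarrow> 'a set \<Rightarrow> 'a \<Rightarrow> 'a list \<Rightarrow> bool" where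
  "search_prefix E V r xs \<longleftrightarrow> (\<forall>i < length xs. lex_max E V r (take i xs) (xs ! i))"

lemma search_prefix_Nil [simp]: "search_prefix E V r []"
  by (simp add: search_prefix_def)

lemma search_prefix_snoc:
  "search_prefix E V r (xs @ [v]) \<longleftrightarrow> search_prefix E V r xs \<and> lex_max E V r xs v"
  by (auto simp: search_prefix_def nth_append less_Suc_eq)

lemma search_prefix_distinct: "search_prefix E V r xs \<Longrightarrow> distinct xs \<and> set xs \<subseteq> V"
  by (induction xs rule: rev_induct) (auto simp: search_prefix_snoc lex_max_def)

lemma search_prefix_hd: "search_prefix E V r xs \<Longrightarrow> xs \<noteq> [] \<Longrightarrow> xs ! 0 = r"
  by (fastforce simp: search_prefix_def lex_max_def)

text \<open>This is the formula inside \<open>linear_extension\<close>, so that unfolding connects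
  the two. A vertex that is missing from the list is in no relation, which makes the notion usable
  for partial searches.\<close>

definition before :: "'a list \<Rightarrow> 'a \<Rightarrow> 'a \<Rightarrow> bool" where
  "before xs x y \<longleftrightarrow> (\<exists>i j. i < j \<and> j < length xs \<and> xs ! i = x \<and> xs ! j = y)"

lemma beforeD: "before xs x y \<Longrightarrow> x \<in> set xs \<and> y \<in> set xs"
  by (auto simp: before_def)

lemma before_snoc: "before (xs @ [v]) x y \<longleftrightarrow> before xs x y \<or> (x \<in> set xs \<and> y = v)"
proof
  assume "before (xs @ [v]) x y"
  then obtain i j where "i < j" "j < Suc (length xs)" "(xs @ [v]) ! i = x" "(xs @ [v]) ! j = y"
    by (auto simp: before_def)
  note ij = this
  show "before xs x y \<or> (x \<in> set xs \<and> y = v)"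
  proof (cases "j = length xs")
    case True
    with ij show ?thesis by (auto simp: nth_append)
  next
    case False
    with ij have "i < j \<and> j < length xs \<and> xs ! i = x \<and> xs ! j = y" by (simp add: nth_append)
    then show ?thesis unfolding before_def by blast
  qed
next
  assume "before xs x y \<or> (x \<in> set xs \<and> y = v)"
  then obtain i j where "i < j" "j < Suc (length xs)" "(xs @ [v]) ! i = x" "(xs @ [v]) ! j = y"
  proof
    assume "before xs x y"
    then obtain i j where "i < j" "j < length xs" "xs ! i = x" "xs ! j = y"
      unfolding before_def by blast
    then show ?thesis by (intro that[of i j]) (simp_all add: nth_append)
  next
    assume "x \<in> set xs \<and> y = v"
    then obtain i where "i < length xs" "xs ! i = x" "y = v" by (auto simp: in_set_conv_nth)
    then show ?thesis by (intro that[of i "length xs"]) (simp_all add: nth_append)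
  qed
  then show "before (xs @ [v]) x y" unfolding before_def by (intro exI[of _ i] exI[of _ j]) simp
qed

lemma before_total: "x \<in> set xs \<Longrightarrow> y \<in> set xs \<Longrightarrow> x \<noteq> y \<Longrightarrow> before xs x y \<or> before xs y x"
  by (auto simp: before_def in_set_conv_nth) (metis linorder_neqE_nat)

lemma before_asym: "distinct xs \<Longrightarrow> before xs x y \<Longrightarrow> \<not> before xs y x"
  by (auto simp: before_def nth_eq_iff_index_eq)

lemma before_take: "distinct xs \<Longrightarrow> i < length xs \<Longrightarrow> x \<in> set (take i xs) \<longleftrightarrow> before xs x (xs ! i)"
  by (auto simp: before_def in_set_conv_nth nth_eq_iff_index_eq) (metis less_trans)+

text \<open>The escape clause is there because \<open>before\<close> looks at all occurrences: a
  repeated entry may have a later copy behind another element of \<open>A\<close>.\<close>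

lemma ex_first:
  assumes "A \<inter> set xs \<noteq> {}"
  obtains a where "a \<in> A" "a \<in> set xs" "\<And>b. b \<in> A \<Longrightarrow> \<not> before xs b a \<or> \<not> distinct xs"
proof -
  define i where "i = (LEAST i. i < length xs \<and> xs ! i \<in> A)"
  have "\<exists>i. i < length xs \<and> xs ! i \<in> A" using assms by (auto simp: in_set_conv_nth)
  then have i: "i < length xs \<and> xs ! i \<in> A" unfolding i_def by (rule LeastI_ex)
  show ?thesis
  proof (rule that[of "xs ! i"])
    fix b assume b: "b \<in> A"
    show "\<not> before xs b (xs ! i) \<or> \<not> distinct xs"
    proof (rule disjCI, rule notI, simp)
      assume "distinct xs" "before xs b (xs ! i)"
      then obtain k where "k < i" "xs ! k = b" using i by (auto simp: before_def nth_eq_iff_index_eq)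
      with not_less_Least[of k "\<lambda>i. i < length xs \<and> xs ! i \<in> A"] b i show False
        unfolding i_def by auto
    qed
  qed (use i in auto)
qed

section \<open>Layers in the search order, and comparison inside a layer\<close>

context rooted_bipartite
begin

abbreviation "prefix \<equiv> search_prefix E V r"

text \<open>Suppose that \<open>v\<close> is chosen although an unnumbered \<open>w\<close> of
  minimal depth lies nearer to the root. A lower neighbour \<open>p\<close> of \<open>w\<close> is
  already numbered and belongs to the label of \<open>w\<close> only. Maximality of the label of
  \<open>v\<close> yields a neighbour of \<open>v\<close> numbered before \<open>p\<close>; by
  induction it is not deeper than \<open>p\<close>, which makes \<open>v\<close> no deeper than
  \<open>w\<close>.\<close>

lemma prefix_depth_nth:
  assumes xs: "prefix xs"
  shows "i < length xs \<Longrightarrow> u \<in> V - set (take i xs) \<Longrightarrow> depth (xs ! i) \<le> depth u"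
proof (induction i arbitrary: u rule: less_induct)
  case (less i)
  show ?case
  proof (rule ccontr)
    assume neg: "\<not> ?thesis"
    define v where "v = xs ! i"
    have vV: "lex_max E V r (take i xs) v" using xs less.prems by (simp add: search_prefix_def v_def)
    let ?U = "V - set (take i xs)"
    obtain w where w: "w \<in> ?U" and wmin: "\<And>u. u \<in> ?U \<Longrightarrow> depth w \<le> depth u"
      using less.prems(2) ex_has_least_nat[of "\<lambda>u. u \<in> ?U" u depth] by blast
    have dw: "depth w < depth v" using neg wmin[OF less.prems(2)] by (simp add: v_def)
    have hd: "xs ! 0 = r" using xs less.prems by (intro search_prefix_hd) auto
    have "i \<noteq> 0" using dw hd by (cases i) (auto simp: v_def)
    then have "w \<noteq> r" using w hd less.prems by (auto simp: in_set_conv_nth)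
    then obtain p where p: "p \<in> lower w" using lower_nonempty w by blast
    then have pd: "(p, w) \<in> E" "depth w = Suc (depth p)" "p \<in> V" using lowerD by auto
    have "p \<in> set (take i xs)" using wmin[of p] pd by force
    then obtain j where j: "j < i" "xs ! j = p" using less.prems(1) by (auto simp: in_set_conv_nth)
    have "(p, v) \<notin> E" using depth_edge_le[of p v] pd dw by auto
    then have "\<exists>k<j. (take i xs ! k, v) \<in> E"
      using vV w pd j less.prems(1) unfolding lex_max_def by (auto simp: min_def)
    then obtain k where k: "k < j" "(xs ! k, v) \<in> E" using j by auto
    have "p \<notin> set (take k xs)"
      using search_prefix_distinct[OF xs] j k less.prems(1)
      by (auto simp: in_set_conv_nth nth_eq_iff_index_eq)
    then have "depth (xs ! k) \<le> depth p" using less.IH[of k p] k j pd less.prems(1) by auto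
    with depth_edge_le[OF k(2)] dw pd show False by simp
  qed
qed

lemma prefix_depth:
  assumes "prefix xs" "v \<in> set xs" "u \<in> V" "depth u < depth v"
  shows "before xs u v"
proof -
  obtain i where i: "i < length xs" "xs ! i = v" using assms by (auto simp: in_set_conv_nth)
  then have "u \<in> set (take i xs)" using prefix_depth_nth[OF assms(1) i(1), of u] assms by auto
  then show ?thesis using before_take[OF _ i(1)] search_prefix_distinct[OF assms(1)] i by auto
qed

lemma before_depth: "prefix xs \<Longrightarrow> before xs x y \<Longrightarrow> depth x \<le> depth y"
  using prefix_depth[of xs x y] search_prefix_distinct[of E V r xs] beforeD[of xs x y] before_asym[of xs x y]
  by (metis linorder_not_le subsetD)

text \<open>When \<open>y\<close> is numbered, \<open>x\<close> is not, and the label of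
  \<open>x\<close> contains \<open>a\<close>, which that of \<open>y\<close> lacks. Maximality of
  the label of \<open>y\<close> requires an earlier compensating entry; being numbered before
  \<open>a\<close>, it lies in the layer preceding that of \<open>y\<close>.\<close>

lemma prefix_order:
  assumes xs: "prefix xs" and y: "y \<in> set xs" and x: "x \<in> V" and nb: "\<not> before xs x y"
    and ne: "x \<noteq> y" and d: "depth x = depth y" and a: "a \<in> lower x - lower y"
  obtains b where "b \<in> lower y - lower x" "before xs b a"
proof -
  obtain i where i: "i < length xs" "xs ! i = y" using y by (auto simp: in_set_conv_nth)
  have ds: "distinct xs" "set xs \<subseteq> V" using search_prefix_distinct[OF xs] by auto
  have lm: "lex_max E V r (take i xs) y" using xs i by (auto simp: search_prefix_def)
  have aE: "(a, x) \<in> E" "depth x = Suc (depth a)" "a \<in> V" using a lowerD by auto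
  have "before xs a y" using prefix_depth[OF xs y aE(3)] aE d by simp
  then have "a \<in> set (take i xs)" using before_take[OF ds(1) i(1)] i by simp
  then obtain j where j: "j < i" "xs ! j = a" using i by (auto simp: in_set_conv_nth)
  have "x \<notin> set (take i xs)" using nb before_take[OF ds(1) i(1)] i by simp
  moreover have "(a, y) \<notin> E" using a aE d by (auto simp: lower_def)
  ultimately have "\<exists>k<j. (take i xs ! k, y) \<in> E \<and> (take i xs ! k, x) \<notin> E"
    using lm x aE j i unfolding lex_max_def by (auto simp: min_def)
  then obtain k where k: "k < j" "(xs ! k, y) \<in> E" "(xs ! k, x) \<notin> E" using j by auto
  have bk: "before xs (xs ! k) a" using k j i unfolding before_def by (intro exI[of _ k] exI[of _ j]) auto
  have "depth (xs ! k) \<le> depth a" using before_depth[OF xs bk] .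
  then have "xs ! k \<in> lower y - lower x" using k aE d by (auto simp: lower_def)
  with bk that show thesis by blast
qed

end


section \<open>Induced paths and the chain property of lower neighbourhoods\<close>

context rooted_bipartite
begin

text \<open>A shortest walk inside \<open>S\<close> is induced: a repetition or a chord between two
  of its positions would shorten it.\<close>

lemma ex_induced_path:
  assumes "(u, w) \<in> (E \<inter> S \<times> S)\<^sup>*" "u \<in> S"
  obtains n f where "f 0 = u" "f n = w" "\<And>i. i \<le> n \<Longrightarrow> f i \<in> S"
    "\<And>i j. i < j \<Longrightarrow> j \<le> n \<Longrightarrow> f i \<noteq> f j \<and> ((f i, f j) \<in> E \<longleftrightarrow> j = Suc i)"
proof -
  let ?R = "E \<inter> S \<times> S"
  define n where "n = (LEAST n. (u, w) \<in> ?R ^^ n)"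
  have "(u, w) \<in> ?R ^^ n"
    unfolding n_def using assms by (auto simp: rtrancl_power intro: LeastI_ex)
  then obtain f where f: "f 0 = u" "f n = w" "\<forall>i<n. (f i, f (Suc i)) \<in> ?R"
    by (auto simp: relpow_fun_conv)
  have least: "(u, w) \<in> ?R ^^ k \<Longrightarrow> n \<le> k" for k unfolding n_def by (rule Least_le)
  have S: "f i \<in> S" if "i \<le> n" for i
    using f assms(2) that by (cases i) auto
  have pre: "(u, f i) \<in> ?R ^^ i" if "i \<le> n" for i
    using f that by (auto simp: relpow_fun_conv)
  have post: "(f j, w) \<in> ?R ^^ (n - j)" if "j \<le> n" for j
    using f that unfolding relpow_fun_conv by (intro exI[of _ "\<lambda>i. f (j + i)"]) auto
  show thesis
  proof (rule that[OF f(1,2)])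
    fix i j assume ij: "i < j" "j \<le> n"
    have "f i \<noteq> f j"
    proof
      assume "f i = f j"
      with pre[of i] post[of j] ij have "(u, w) \<in> ?R ^^ (i + (n - j))"
        unfolding relpow_add by auto
      with least ij show False by fastforce
    qed
    moreover have "j = Suc i" if "(f i, f j) \<in> E"
    proof -
      have "(u, f j) \<in> ?R ^^ Suc i" using pre[of i] that S[of i] S[of j] ij by auto
      with post[of j] ij have "(u, w) \<in> ?R ^^ (Suc i + (n - j))"
        unfolding relpow_add by blast
      with least[of "Suc i + (n - j)"] ij show ?thesis by simp
    qed
    ultimately show "f i \<noteq> f j \<and> ((f i, f j) \<in> E \<longleftrightarrow> j = Suc i)" using f(3) ij by auto
  qed (rule S)
qed

text \<open>Stepping to a lower neighbour each time, the walk leaves the layer of \<open>v\<close>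
  at once and never returns.\<close>

lemma reach_root_below: "v \<in> V \<Longrightarrow> (v, r) \<in> (E \<inter> insert v {u. depth u < depth v} \<times> insert v {u. depth u < depth v})\<^sup>*"
proof (induction "depth v" arbitrary: v rule: less_induct)
  case less
  show ?case
  proof (cases "v = r")
    case False
    then obtain p where "p \<in> lower v" using lower_nonempty less.prems by blast
    then have p: "(v, p) \<in> E" "depth p < depth v" "p \<in> V" using lowerD E_sym by auto
    then have "(p, r) \<in> (E \<inter> insert v {u. depth u < depth v} \<times> insert v {u. depth u < depth v})\<^sup>*"
      using less.hyps[OF p(2,3)] by (rule_tac set_mp[OF rtrancl_mono]) auto
    then show ?thesis using p by (intro converse_rtrancl_into_rtrancl[of v p]) auto
  qed auto
qed

end

text \<open>
  Otherwise a shortest path through higher layers between private neighbours of \<open>u\<close> and \<open>w\<close> would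
  close an induced cycle of length at least six with \<open>u\<close>, \<open>x\<close> and \<open>w\<close>.
\<close>

lemma chordal_bipartite_lower_chain:
  assumes rb: "rooted_bipartite (pverts G) (parcs G) r" and cb: "chordal_bipartite G"
    and u: "u \<in> rooted_bipartite.lower (parcs G) r x"
    and w: "w \<in> rooted_bipartite.lower (parcs G) r x"
  shows "rooted_bipartite.lower (parcs G) r u \<subseteq> rooted_bipartite.lower (parcs G) r w \<or>
    rooted_bipartite.lower (parcs G) r w \<subseteq> rooted_bipartite.lower (parcs G) r u"
proof -
  interpret rooted_bipartite "pverts G" "parcs G" r by (rule rb)
  define E where "E = parcs G"
  have "lower u \<subseteq> lower w \<or> lower w \<subseteq> lower u"
  proof (rule ccontr)
    assume "\<not> ?thesis"
    then obtain u' w' where u': "u' \<in> lower u" "u' \<notin> lower w" and w': "w' \<in> lower w" "w' \<notin> lower u"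
      by blast
    note facts = lowerD[OF u] lowerD[OF w] lowerD[OF u'(1)] lowerD[OF w'(1)]
    have d: "depth u = depth w" "depth u' = depth w'" using facts by auto
    have no: "(u', w) \<notin> parcs G" "(w', u) \<notin> parcs G" using u' w' facts by (auto simp: lower_def)
    \<comment> \<open>Admitting only \<open>u'\<close>, \<open>w'\<close> and vertices strictly
      nearer to the root keeps the inner vertices of the path at least two layers away from
      \<open>u\<close> and \<open>w\<close>, so they cannot be adjacent to them.\<close>
    define S where "S = {u', w'} \<union> {v. depth v < depth u'}"
    have "(u', r) \<in> (parcs G \<inter> S \<times> S)\<^sup>*"
      by (rule set_mp[OF rtrancl_mono reach_root_below]) (use facts in \<open>auto simp: S_def\<close>)
    moreover have "(w', r) \<in> (parcs G \<inter> S \<times> S)\<^sup>*"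
      by (rule set_mp[OF rtrancl_mono reach_root_below]) (use facts d in \<open>auto simp: S_def\<close>)
    moreover have "sym ((parcs G \<inter> S \<times> S)\<^sup>*)"
      using sym_E by (intro sym_rtrancl) (auto simp: sym_def)
    ultimately have "(u', w') \<in> (parcs G \<inter> S \<times> S)\<^sup>*" by (meson rtrancl_trans symD)
    then obtain n f where f: "f 0 = u'" "f n = w'" "\<And>i. i \<le> n \<Longrightarrow> f i \<in> S"
      "\<And>i j. i < j \<Longrightarrow> j \<le> n \<Longrightarrow> f i \<noteq> f j \<and> ((f i, f j) \<in> parcs G \<longleftrightarrow> j = Suc i)"
      by (rule ex_induced_path) (auto simp: S_def)
    have "n \<noteq> 0" using f(1,2) u' w' by (intro notI) auto
    \<comment> \<open>The ends of the path lie in one layer and so are not adjacent.\<close>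
    have "n \<noteq> 1" using f(1,2) f(4)[of 0 1] depth_edge_neq[of u' w'] d by auto
    with \<open>n \<noteq> 0\<close> have n: "2 \<le> n" by simp
    have deep: "depth (f i) < depth u" "depth (f i) < depth w" "depth (f i) < depth x"
      "Suc (depth (f i)) < depth x" if "i \<le> n" for i
      using f(3)[OF that] facts d by (auto simp: S_def)
    have inner: "Suc (depth (f i)) < depth u" "Suc (depth (f i)) < depth w" if "0 < i" "i < n" for i
    proof -
      have "f i \<noteq> u'" "f i \<noteq> w'" using f(1,2) f(4)[of 0 i] f(4)[of i n] that by auto
      with f(3)[of i] that show "Suc (depth (f i)) < depth u" "Suc (depth (f i)) < depth w"
        using facts d by (auto simp: S_def)
    qed
    have far: "(p, q) \<notin> parcs G" if "Suc (depth p) < depth q" for p q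
      using depth_edge_le[of p q] that by auto
    have loop: "(p, p) \<notin> parcs G" for p using depth_edge_neq[of p p] by auto
    \<comment> \<open>The cycle runs through the path from \<open>u'\<close> to \<open>w'\<close>
      and returns via \<open>w\<close>, \<open>x\<close> and \<open>u\<close>. It has
      \<open>n + 4\<close> vertices, at least six.\<close>
    define g where "g i = (if i \<le> n then f i else if i = n + 1 then w else if i = n + 2 then x else u)" for i
    have fu: "(f i, u) \<in> parcs G \<longleftrightarrow> i = 0" if "i \<le> n" for i
    proof -
      consider "i = 0" | "i = n" | "0 < i" "i < n" using \<open>i \<le> n\<close> by linarith
      then show ?thesis using f(1,2) no facts far inner[of i] n by cases auto
    qed
    have fw: "(f i, w) \<in> parcs G \<longleftrightarrow> i = n" if "i \<le> n" for i
    proof -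
      consider "i = 0" | "i = n" | "0 < i" "i < n" using \<open>i \<le> n\<close> by linarith
      then show ?thesis using f(1,2) no facts far inner[of i] n by cases auto
    qed
    have fx: "(f i, x) \<notin> parcs G" if "i \<le> n" for i using far deep that by blast
    have uw: "(w, u) \<notin> parcs G" using depth_edge_neq[of w u] d by auto
    have neq: "u \<noteq> w" "x \<noteq> u" "x \<noteq> w" "\<And>i. i \<le> n \<Longrightarrow> f i \<noteq> u \<and> f i \<noteq> w \<and> f i \<noteq> x"
      using u' facts deep by fastforce+
    have adj: "g i \<noteq> g j \<and> ((g i, g j) \<in> parcs G \<longleftrightarrow> j = Suc i \<or> (i = 0 \<and> j = n + 3))"
      \<comment> \<open>Position pairs with \<open>i < j\<close> suffice by symmetry; the pair
        \<open>0\<close>, \<open>n + 3\<close> is the closing edge between \<open>u'\<close> and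
        \<open>u\<close>.\<close>
      if "i < j" "j < n + 4" for i j
    proof -
      have "j \<le> n \<or> (i \<le> n \<and> j = n + 1) \<or> (i \<le> n \<and> j = n + 2) \<or> (i \<le> n \<and> j = n + 3) \<or>
        (i = n + 1 \<and> j = n + 2) \<or> (i = n + 1 \<and> j = n + 3) \<or> (i = n + 2 \<and> j = n + 3)"
        using that by presburger
      then consider "j \<le> n" | "i \<le> n" "j = n + 1" | "i \<le> n" "j = n + 2" | "i \<le> n" "j = n + 3"
        | "i = n + 1" "j = n + 2" | "i = n + 1" "j = n + 3" | "i = n + 2" "j = n + 3"
        by blast
      then show ?thesis
      proof cases
        case 1
        then show ?thesis using f(4)[of i j] that n by (simp add: g_def)
      next
        case 2
        then show ?thesis using fw[of i] neq(4)[of i] n by (auto simp: g_def)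
      next
        case 3
        then show ?thesis using fx[of i] neq(4)[of i] n by (auto simp: g_def)
      next
        case 4
        then show ?thesis using fu[of i] neq(4)[of i] n by (auto simp: g_def)
      next
        case 5
        then show ?thesis using facts E_sym neq n by (simp add: g_def)
      next
        case 6
        then show ?thesis using uw neq n by (simp add: g_def)
      next
        case 7
        then show ?thesis using facts E_sym neq n by (simp add: g_def)
      qed
    qed
    have Suc_mod: "Suc i mod (n + 4) = (if i = n + 3 then 0 else Suc i)" if "i < n + 4" for i
    proof (cases "i = n + 3")
      case True
      then have "Suc i = n + 4" by simp
      then show ?thesis using True by (metis mod_self)
    qed (use that in simp)
    have "induced_cycle G (map g [0..<n+4])"
      unfolding induced_cycle_def
    proof (intro conjI allI impI)
      show "distinct (map g [0..<n+4])"
        using adj by (auto simp: distinct_map inj_on_def) (metis linorder_neqE_nat)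
      show "set (map g [0..<n+4]) \<subseteq> pverts G"
      proof -
        have "f i \<in> pverts G" if "i \<le> n" for i
        proof (cases "i < n")
          case True
          with f(4)[of i "Suc i"] E_in_V show ?thesis by auto
        next
          case False
          with that facts f(2) show ?thesis by simp
        qed
        then show ?thesis using facts by (auto simp: g_def)
      qed
      fix i j assume ij: "i < length (map g [0..<n + 4])" "j < length (map g [0..<n + 4])"
      show "(map g [0..<n + 4] ! i, map g [0..<n + 4] ! j) \<in> parcs G \<longleftrightarrow>
          j = Suc i mod length (map g [0..<n + 4]) \<or> i = Suc j mod length (map g [0..<n + 4])"
      proof (cases i j rule: linorder_cases)
        case less
        then show ?thesis using ij adj[of i j] by (auto simp: Suc_mod simp del: upt_Suc)
      next
        case equal
        then show ?thesis using ij loop by (auto simp: Suc_mod simp del: upt_Suc)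
      next
        case greater
        have "(g i, g j) \<in> parcs G \<longleftrightarrow> (g j, g i) \<in> parcs G" using E_sym by blast
        with greater show ?thesis using ij adj[of j i] by (auto simp: Suc_mod simp del: upt_Suc)
      qed
    qed simp
    with cb have "length (map g [0..<n+4]) = 4" unfolding chordal_bipartite_def by blast
    with n show False by simp
  qed
  then show ?thesis .
qed


section \<open>Propagating precedence constraints towards the root\<close>

definition is_first :: "'a list \<Rightarrow> 'a set \<Rightarrow> 'a \<Rightarrow> bool" where
  "is_first xs A a \<longleftrightarrow> a \<in> A \<and> a \<in> set xs \<and> (\<forall>b \<in> A. \<not> before xs b a)"

lemma ex_is_first:
  assumes "A \<inter> set xs \<noteq> {}" "distinct xs"
  obtains a where "is_first xs A a"
  using ex_first[OF assms(1)] assms(2) unfolding is_first_def by metis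

lemma is_first_mono: "is_first xs A a \<Longrightarrow> B \<subseteq> A \<Longrightarrow> a \<in> B \<Longrightarrow> is_first xs B a"
  by (auto simp: is_first_def)

locale rooted_chordal = rooted_bipartite +
  assumes lower_chain: "u \<in> lower x \<Longrightarrow> w \<in> lower x \<Longrightarrow> lower u \<subseteq> lower w \<or> lower w \<subseteq> lower u"
begin

text \<open>The set of vertices that separate \<open>x\<close> from \<open>y\<close> is numbered
  completely before \<open>y\<close>. Its first element cannot belong to \<open>x\<close>, for
  \<open>prefix_order\<close> would produce an earlier one on the side of \<open>y\<close>. So
  whichever of the two comes first owns the first separating vertex; this is the form in which LBFS
  is used from here on.\<close>

lemma prefix_first:
  assumes xs: "prefix xs" and y: "y \<in> set xs" and x: "x \<in> V" and nb: "\<not> before xs x y"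
    and d: "depth x = depth y" and ne: "lower x \<noteq> lower y"
  obtains b where "b \<in> lower y - lower x" "is_first xs ((lower y - lower x) \<union> (lower x - lower y)) b"
proof -
  let ?D = "(lower y - lower x) \<union> (lower x - lower y)"
  have ds: "distinct xs" "set xs \<subseteq> V" using search_prefix_distinct[OF xs] by auto
  have "?D \<subseteq> set xs"
  proof
    fix p assume "p \<in> ?D"
    then have "before xs p y" using lowerD[of p x] lowerD[of p y] d by (intro prefix_depth[OF xs y]) auto
    then show "p \<in> set xs" using beforeD by fast
  qed
  with ne ds obtain b where b: "is_first xs ?D b" by (metis ex_is_first Un_empty Diff_eq_empty_iff inf.absorb1 subset_antisym)
  have "b \<notin> lower x - lower y"
  proof
    assume "b \<in> lower x - lower y"
    from prefix_order[OF xs y x nb _ d this] ne obtain c where "c \<in> lower y - lower x" "before xs c b" by blast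
    with b show False by (auto simp: is_first_def)
  qed
  with b that show thesis by (auto simp: is_first_def)
qed

text \<open>The order of two vertices that are no twins is decided by the first vertex separating
  their \<open>lower\<close> sets, and twins have the same separating vertices.\<close>

lemma order_class:
  assumes xs: "prefix xs" and bef: "before xs x' y'" and x: "x \<in> V" and y: "y \<in> set xs"
    and x': "lower x = lower x'" and y': "lower y = lower y'" and ne: "lower x \<noteq> lower y"
    and d: "depth x = depth y"
  shows "before xs x y"
proof (rule ccontr)
  assume nb: "\<not> before xs x y"
  have ds: "distinct xs" "set xs \<subseteq> V" using search_prefix_distinct[OF xs] by auto
  have in': "x' \<in> set xs" "y' \<in> set xs" using beforeD[OF bef] by auto
  have V: "x' \<in> V" "y' \<in> V" "y \<in> V" using in' ds y by auto
  have d': "depth y' = depth x'"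
    using lower_eq_depth[OF x V(1) x'] lower_eq_depth[OF V(3,2) y'] d by simp
  obtain b where b: "b \<in> lower y - lower x" "is_first xs ((lower y - lower x) \<union> (lower x - lower y)) b"
    by (rule prefix_first[OF xs y x nb d ne])
  have "\<not> before xs y' x'" using before_asym[OF ds(1) bef] .
  then obtain a where a: "a \<in> lower x' - lower y'"
    "is_first xs ((lower x' - lower y') \<union> (lower y' - lower x')) a"
    using prefix_first[OF xs in'(1) _ _ d'] in' ds ne x' y' by blast
  \<comment> \<open>Both are first in the same set of separating vertices, but lie on different
    sides.\<close>
  have "a \<noteq> b" using a b x' y' by auto
  then show False using before_total[of a xs b] a b x' y' by (auto simp: is_first_def)
qed

text \<open>Within the neighbours of \<open>x\<close> the sets \<open>lower\<close> are nested. Were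
  that of \<open>c\<close> strictly larger, \<open>c\<close> would have been preferred to
  \<open>a\<close>. The largest set does not mention the order, so the twin class of the first
  vertex of \<open>A\<close> is common to all search orders.\<close>

lemma max_rep:
  assumes xs: "prefix xs" and a: "is_first xs A a" and A: "A \<subseteq> lower x" and c: "c \<in> A"
  shows "lower c \<subseteq> lower a"
proof (rule ccontr)
  assume neg: "\<not> ?thesis"
  have ac: "a \<in> lower x" "c \<in> lower x" using a A c by (auto simp: is_first_def)
  then have sub: "lower a \<subseteq> lower c" using lower_chain neg by blast
  obtain p where p: "p \<in> lower c - lower a" using neg by blast
  have "\<not> before xs c a" "a \<in> set xs" using a c by (auto simp: is_first_def)
  with prefix_order[OF xs _ _ _ _ _ p] ac lowerD[OF ac(1)] lowerD[OF ac(2)] neg sub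
  show False by (metis DiffD1 DiffD2 nat.inject subsetD subset_refl)
qed

text \<open>
  \<open>chain ts x y c d\<close>: in the search orders the pair \<open>(x, y)\<close> can be replaced by \<open>(c, d)\<close>. If \<open>c\<close> and \<open>d\<close>
  differ, then their order is decided within a class of vertices that have the same neighbours
  in the preceding layer; otherwise nothing more has to be checked.
\<close>

inductive chain :: "'a list \<Rightarrow> 'a \<Rightarrow> 'a \<Rightarrow> 'a \<Rightarrow> 'a \<Rightarrow> bool" for ts where
  stop: "lower x \<subseteq> lower y \<or> lower y \<subseteq> lower x \<Longrightarrow> chain ts x y z z"
| terminal: "is_first ts (lower x - lower y) a \<Longrightarrow> is_first ts (lower y - lower x) b \<Longrightarrow>
    lower a = lower b \<Longrightarrow> chain ts x y x y"
| down: "is_first ts (lower x - lower y) a \<Longrightarrow> is_first ts (lower y - lower x) b \<Longrightarrow>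
    lower a \<noteq> lower b \<Longrightarrow> chain ts a b c d \<Longrightarrow> chain ts x y c d"

text \<open>Makes reflexive pairs harmless: their differences are empty, so only \<open>stop\<close>
  applies and no condition arises.\<close>

lemma chain_refl:
  assumes "chain ts x x c d" shows "c = d"
  using assms by cases (auto simp: is_first_def)

section \<open>Transfer of precedence along a chain, for arbitrary search orders\<close>

context
  fixes ts assumes ts: "prefix ts"
begin

text \<open>The vertex \<open>a\<close> is first in \<open>ts\<close>, not in \<open>xs\<close>. The
  first separating vertex \<open>a'\<close> of \<open>xs\<close> belongs to \<open>x\<close> and
  precedes \<open>b\<close>; \<open>max_rep\<close>, applied in both orders, makes \<open>a'\<close>
  a twin of \<open>a\<close>, and \<open>order_class\<close> passes from \<open>a'\<close> to
  \<open>a\<close>.\<close>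

lemma step_down:
  assumes xs: "prefix xs" and bef: "before xs x y" and d: "depth x = depth y"
    and a: "is_first ts (lower x - lower y) a" and b: "is_first ts (lower y - lower x) b"
    and ne: "lower a \<noteq> lower b"
  shows "before xs a b"
proof -
  have ds: "distinct xs" "set xs \<subseteq> V" using search_prefix_distinct[OF xs] by auto
  have ab: "a \<in> lower x - lower y" "b \<in> lower y - lower x" using a b by (auto simp: is_first_def)
  have xy: "x \<in> set xs" "y \<in> set xs" using beforeD[OF bef] by auto
  have "\<not> before xs y x" by (rule before_asym[OF ds(1) bef])
  with xy ds d ab obtain a' where
    a': "a' \<in> lower x - lower y" "is_first xs ((lower x - lower y) \<union> (lower y - lower x)) a'"
    using prefix_first[OF xs xy(1)] by (metis DiffD1 DiffD2 subsetD)
  have "is_first xs (lower x - lower y) a'" by (rule is_first_mono[OF a'(2) Un_upper1 a'(1)])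
  from max_rep[OF xs this _ ab(1)] max_rep[OF ts a _ a'(1)] have eq: "lower a = lower a'" by blast
  have bs: "b \<in> set xs"
    using prefix_depth[OF xs xy(2), of b] ab lowerD[of b y] beforeD by fastforce
  have "a' \<noteq> b" "\<not> before xs b a'" using a' ab by (auto simp: is_first_def)
  moreover have "a' \<in> set xs" using a' by (simp add: is_first_def)
  ultimately have "before xs a' b" using before_total bs by metis
  then show ?thesis
    using lowerD[of a x] lowerD[of b y] ab d
    by (intro order_class[OF xs _ _ bs eq refl ne]) auto
qed

text \<open>Otherwise the first separating vertex \<open>b'\<close> belongs to \<open>y\<close> and
  is a twin of \<open>b\<close>, so \<open>a\<close> precedes it, although \<open>a\<close>
  separates too. Only \<open>y\<close> has to be numbered, because the lemma is applied to
  unfinished searches.\<close>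

lemma step_up:
  assumes xs: "prefix xs" and bef: "before xs a b" and d: "depth x = depth y"
    and x: "x \<in> V" and y: "y \<in> set xs"
    and a: "is_first ts (lower x - lower y) a" and b: "is_first ts (lower y - lower x) b"
    and ne: "lower a \<noteq> lower b"
  shows "before xs x y"
proof (rule ccontr)
  assume nb: "\<not> before xs x y"
  have ab: "a \<in> lower x - lower y" "b \<in> lower y - lower x" using a b by (auto simp: is_first_def)
  obtain b' where b': "b' \<in> lower y - lower x"
    "is_first xs ((lower y - lower x) \<union> (lower x - lower y)) b'"
    using prefix_first[OF xs y x nb d] ab by blast
  have "is_first xs (lower y - lower x) b'" by (rule is_first_mono[OF b'(2) Un_upper1 b'(1)])
  from max_rep[OF xs this _ ab(2)] max_rep[OF ts b _ b'(1)] have eq: "lower b = lower b'" by blast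
  have "b' \<in> set xs" using b' by (simp add: is_first_def)
  then have "before xs a b'"
    using lowerD[of a x] lowerD[of b' y] ab b'(1) d ne eq
    by (intro order_class[OF xs bef _ _ refl eq[symmetric]]) auto
  with b' ab show False by (auto simp: is_first_def)
qed

text \<open>A precedence that holds in the solution descends to the end of the chain. Pairs from
  different layers keep their difference in depth on the way down, whereas \<open>terminal\<close>
  forces equal depths; so such pairs can end only in \<open>stop\<close>.\<close>

lemma chain_end:
  assumes "chain ts x y c d" "prefix xs" "set xs = V" "before xs x y" "c \<noteq> d"
  shows "before xs c d \<and> depth c = depth d \<and> depth d \<le> depth y \<and>
    (\<exists>a b. is_first ts (lower c - lower d) a \<and> is_first ts (lower d - lower c) b \<and> lower a = lower b)"
  using assms
proof (induction rule: chain.induct)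
  case (terminal x y a b)
  have "a \<in> lower x" "b \<in> lower y" using terminal.hyps by (auto simp: is_first_def)
  with lowerD[of a x] lowerD[of b y] lower_eq_depth[of a b] terminal.hyps(3)
  have "depth x = depth y" by simp
  with terminal show ?case by auto
next
  case (down x y a b c d)
  have ab: "a \<in> lower x" "b \<in> lower y" using down.hyps by (auto simp: is_first_def)
  have "before xs a b"
  proof (cases "depth x = depth y")
    case True
    show ?thesis by (rule step_down[OF down.prems(1,3) True down.hyps(1-3)])
  next
    case False
    with before_depth[OF down.prems(1,3)] lowerD[OF ab(1)] lowerD[OF ab(2)] down.prems
    show ?thesis by (intro prefix_depth) auto
  qed
  with down lowerD[OF ab(2)] show ?case by auto
qed simp

text \<open>Here \<open>xs\<close> is a full solution and \<open>ys\<close> an unfinished search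
  that satisfies the condition at the end of the chain. Precedence descends along the chain in
  \<open>xs\<close> by \<open>step_down\<close> and climbs back in \<open>ys\<close> by
  \<open>step_up\<close>. So \<open>ys\<close> can contradict \<open>xs\<close> on
  \<open>(x, y)\<close> only if \<open>x\<close> and \<open>y\<close> are twins, where
  neighbourhoods decide nothing.\<close>

lemma chain_decided:
  assumes "chain ts x y c d" "prefix xs" "set xs = V" "before xs x y"
    and "prefix ys" "y \<in> set ys" "\<not> before ys x y"
    and "\<And>v. v \<in> set ys \<Longrightarrow> v \<in> lower d - lower c \<Longrightarrow> \<exists>u \<in> lower c - lower d. before ys u v"
  shows "lower x = lower y"
  using assms
proof (induction rule: chain.induct)
  case (stop x y z)
  have ds: "distinct xs" using search_prefix_distinct[OF stop.prems(1)] by simp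
  have xy: "x \<in> V" "y \<in> V" using stop.prems beforeD by fast+
  have d: "depth x = depth y"
    using before_depth[OF stop.prems(1,3)] prefix_depth[OF stop.prems(4,5) xy(1)] stop.prems(6) by force
  show ?case
  proof (rule ccontr)
    assume ne: "lower x \<noteq> lower y"
    have "\<not> before xs y x" by (rule before_asym[OF ds stop.prems(3)])
    then obtain p where p: "p \<in> lower x - lower y"
      using prefix_first[OF stop.prems(1), of x y] xy stop.prems(2) d ne by metis
    obtain q where q: "q \<in> lower y - lower x"
      using prefix_first[OF stop.prems(4,5) xy(1) stop.prems(6) d ne] by metis
    \<comment> \<open>The two orders decide differently, so each of \<open>x\<close> and
      \<open>y\<close> has a private lower neighbour, contrary to nestedness.\<close>
    from p q stop.hyps show False by blast
  qed
next
  case (terminal x y a b)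
  have xy: "x \<in> V" "y \<in> V" using terminal.prems beforeD by fast+
  have d: "depth x = depth y"
    using before_depth[OF terminal.prems(1,3)] prefix_depth[OF terminal.prems(4,5) xy(1)]
      terminal.prems(6) by force
  show ?case
  proof (rule ccontr)
    assume ne: "lower x \<noteq> lower y"
    obtain q where q: "q \<in> lower y - lower x"
      "is_first ys ((lower y - lower x) \<union> (lower x - lower y)) q"
      using prefix_first[OF terminal.prems(4,5) xy(1) terminal.prems(6) d ne] by metis
    with terminal.prems(7)[of q] show False by (auto simp: is_first_def)
  qed
next
  case (down x y a b c d)
  have xy: "x \<in> V" "y \<in> V" using down.prems beforeD by fast+
  have d: "depth x = depth y"
    using before_depth[OF down.prems(1,3)] prefix_depth[OF down.prems(4,5) xy(1)]
      down.prems(6) by force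
  have ab: "a \<in> lower x" "b \<in> lower y" using down.hyps by (auto simp: is_first_def)
  have "before xs a b" by (rule step_down[OF down.prems(1,3) d down.hyps(1-3)])
  moreover have "b \<in> set ys"
    using prefix_depth[OF down.prems(4,5), of b] lowerD[OF ab(2)] beforeD by fastforce
  ultimately have "before ys a b" using down by metis
  then have "before ys x y"
    by (rule step_up[OF down.prems(4) _ d xy(1) down.prems(5) down.hyps(1-3)])
  with down.prems show ?case by simp
qed

end

end


section \<open>The constrained search\<close>

text \<open>
  A vertex \<open>v\<close> is blocked if numbering it next would violate a pair of \<open>P\<close> directly, or would
  decide the replacement \<open>(C x y, D x y)\<close> of such a pair in the wrong way.
\<close>

definition blocked :: "'a rel \<Rightarrow> 'a rel \<Rightarrow> ('a \<Rightarrow> 'a \<Rightarrow> 'a) \<Rightarrow> ('a \<Rightarrow> 'a \<Rightarrow> 'a) \<Rightarrow> 'a list \<Rightarrow> 'a \<Rightarrow> bool" where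
  "blocked E P C D xs v \<longleftrightarrow> (\<exists>(x, y) \<in> P.
     (y = v \<and> x \<noteq> v \<and> x \<notin> set xs) \<or>
     ((D x y, v) \<in> E \<and> (C x y, v) \<notin> E \<and> \<not> (\<exists>u \<in> set xs. (C x y, u) \<in> E \<and> (D x y, u) \<notin> E)))"

definition constrained_prefix ::
  "'a rel \<Rightarrow> 'a set \<Rightarrow> 'a \<Rightarrow> 'a rel \<Rightarrow> ('a \<Rightarrow> 'a \<Rightarrow> 'a) \<Rightarrow> ('a \<Rightarrow> 'a \<Rightarrow> 'a) \<Rightarrow> 'a list \<Rightarrow> bool" where
  "constrained_prefix E V r P C D xs \<longleftrightarrow>
     search_prefix E V r xs \<and> (\<forall>i < length xs. \<not> blocked E P C D (take i xs) (xs ! i))"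

lemma constrained_prefix_Nil [simp]: "constrained_prefix E V r P C D []"
  by (simp add: constrained_prefix_def)

lemma constrained_prefix_snoc:
  "constrained_prefix E V r P C D (xs @ [v]) \<longleftrightarrow>
     constrained_prefix E V r P C D xs \<and> lex_max E V r xs v \<and> \<not> blocked E P C D xs v"
  by (auto simp: constrained_prefix_def search_prefix_snoc nth_append less_Suc_eq)

lemma constrained_prefix_before:
  assumes "constrained_prefix E V r P C D xs" "(x, y) \<in> P" "x \<noteq> y" "y \<in> set xs"
  shows "before xs x y"
proof -
  obtain i where i: "i < length xs" "xs ! i = y" using assms by (auto simp: in_set_conv_nth)
  then have "x \<in> set (take i xs)"
    using assms unfolding constrained_prefix_def blocked_def by fastforce
  with i before_take[OF _ i(1)] assms(1) search_prefix_distinct show ?thesis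
    unfolding constrained_prefix_def by metis
qed

section \<open>The greedy search gets stuck only if there is no solution\<close>

context rooted_chordal
begin

text \<open>All numbered vertices are at most as deep as \<open>z\<close>, so only lower neighbours
  enter the labels of \<open>z\<close> and its twins: these labels are equal.\<close>

lemma lex_max_class:
  assumes xs: "prefix xs" and z: "lex_max E V r xs z" and v: "v \<in> V - set xs" and eq: "lower v = lower z"
  shows "lex_max E V r xs v"
proof -
  have zV: "z \<in> V - set xs" using z by (simp add: lex_max_def)
  have d: "depth v = depth z" using lower_eq_depth eq v zV by blast
  have px: "prefix (xs @ [z])" using xs z by (simp add: search_prefix_snoc)
  have "depth (xs ! j) \<le> depth z" if "j < length xs" for j
    using prefix_depth_nth[OF xs that, of z] zV in_set_takeD by fast
  then have "(xs ! j, w) \<in> E \<longleftrightarrow> xs ! j \<in> lower w" if "j < length xs" "depth w = depth z" for j w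
    using that depth_edge_neq[of "xs ! j" w] unfolding lower_def by fastforce
  then have "(xs ! j, v) \<in> E \<longleftrightarrow> (xs ! j, z) \<in> E" if "j < length xs" for j
    using that d eq by simp
  moreover have "v = r" if "xs = []"
  proof -
    have "z = r" using z that by (simp add: lex_max_def)
    with eq lower_nonempty[of v] v show ?thesis by auto
  qed
  moreover have "\<exists>k<j. (xs ! k, v) \<in> E \<and> (xs ! k, u) \<notin> E"
    if "u \<in> V - set xs" "j < length xs" "(xs ! j, u) \<in> E" "(xs ! j, v) \<notin> E" for u j
  proof -
    have "(xs ! j, z) \<notin> E" using calculation(1)[OF that(2)] that(4) by simp
    with z that obtain k where "k < j" "(xs ! k, z) \<in> E" "(xs ! k, u) \<notin> E"
      unfolding lex_max_def by blast
    with calculation(1)[of k] that(2) show ?thesis by auto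
  qed
  ultimately show ?thesis using v unfolding lex_max_def by blast
qed

text \<open>The witness is the unnumbered twin \<open>v\<close> of \<open>z\<close> that comes first
  in the solution \<open>ss\<close>. Its label is maximal as well, and every twin that precedes it
  in \<open>ss\<close> is already numbered. Each way of being blocked exhibits an unnumbered twin
  before \<open>v\<close> in \<open>ss\<close>.\<close>

theorem constrained_prefix_extend:
  assumes ts: "prefix ts"
    and xs: "constrained_prefix E V r P C D xs" and z: "lex_max E V r xs z"
    and ch: "\<And>x y. (x, y) \<in> P \<Longrightarrow> chain ts x y (C x y) (D x y)"
    and ss: "prefix ss" "set ss = V" and ext: "\<And>x y. (x, y) \<in> P \<Longrightarrow> x \<noteq> y \<Longrightarrow> before ss x y"
  shows "\<exists>v. lex_max E V r xs v \<and> \<not> blocked E P C D xs v"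
proof -
  have px: "prefix xs" using xs by (simp add: constrained_prefix_def)
  have dss: "distinct ss" using search_prefix_distinct[OF ss(1)] by simp
  have zV: "z \<in> V - set xs" using z by (simp add: lex_max_def)
  define T where "T = {u \<in> V. lower u = lower z}"
  obtain v where v: "is_first ss (T - set xs) v"
    using ex_is_first[of "T - set xs" ss] zV ss dss unfolding T_def by blast
  then have vT: "v \<in> V - set xs" "lower v = lower z" by (auto simp: is_first_def T_def)
  have first: "u \<in> set xs" if "before ss u v" "lower u = lower v" for u
    using v that vT beforeD[OF that(1)] ss(2) by (auto simp: is_first_def T_def)
  have lm: "lex_max E V r xs v" using lex_max_class[OF px z] vT by blast
  then have pv: "prefix (xs @ [v])" using px by (simp add: search_prefix_snoc)
  have dv: "distinct (xs @ [v])" using search_prefix_distinct[OF pv] by simp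
  have below: "u \<in> set xs" if "u \<in> V" "depth u < depth v" for u
  proof -
    have "before (xs @ [v]) u v" using prefix_depth[OF pv _ that] by simp
    then show ?thesis using beforeD[of xs u v] vT by (auto simp: before_snoc)
  qed
  have "\<not> blocked E P C D xs v"
  proof
    assume "blocked E P C D xs v"
    then obtain x y where xy: "(x, y) \<in> P" and
      bl: "(y = v \<and> x \<noteq> v \<and> x \<notin> set xs) \<or>
        ((D x y, v) \<in> E \<and> (C x y, v) \<notin> E \<and> \<not> (\<exists>u \<in> set xs. (C x y, u) \<in> E \<and> (D x y, u) \<notin> E))"
      unfolding blocked_def by blast
    define c d where "c = C x y" and "d = D x y"
    have chn: "chain ts x y c d" using ch[OF xy] by (simp add: c_def d_def)
    have ends: "c \<noteq> d \<Longrightarrow> before ss c d \<and> depth c = depth d \<and> depth d \<le> depth y \<and>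
      (\<exists>a b. is_first ts (lower c - lower d) a \<and> is_first ts (lower d - lower c) b \<and> lower a = lower b)"
      using chain_end[OF ts chn ss] chain_refl ext[OF xy] chn by metis
    from bl show False
    proof
      \<comment> \<open>Direct violation: \<open>chain_decided\<close> on the search extended by
        \<open>v\<close> shows that \<open>x\<close> is a twin of \<open>v\<close>. It precedes
        \<open>v\<close> in \<open>ss\<close>, so it should have been numbered.\<close>
      assume A: "y = v \<and> x \<noteq> v \<and> x \<notin> set xs"
      then have bef: "before ss x v" using ext xy by auto
      have "lower x = lower y"
      proof (rule chain_decided[OF ts chn ss _ pv])
        show "before ss x y" using bef A by simp
        show "y \<in> set (xs @ [v])" using A by simp
        show "\<not> before (xs @ [v]) x y" using A beforeD[of xs x y] by (auto simp: before_snoc)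
        fix w assume w: "w \<in> set (xs @ [v])" "w \<in> lower d - lower c"
        then have "c \<noteq> d" by auto
        then have e: "depth c = depth d" "depth d \<le> depth v" using ends A by auto
        have wd: "(w, d) \<in> E" "depth d = Suc (depth w)" using lowerD w by auto
        \<comment> \<open>Since \<open>w\<close> is less deep than \<open>d\<close>, and
          \<open>d\<close> at most as deep as \<open>y = v\<close>, \<open>w\<close> was numbered in
          an earlier round. It was not blocked then, which supplies the required private neighbour
          of \<open>c\<close>.\<close>
        with e have "w \<noteq> v" by auto
        then obtain i where i: "i < length xs" "xs ! i = w" using w by (auto simp: in_set_conv_nth)
        have "(c, w) \<notin> E" using w wd e E_sym by (auto simp: lower_def)
        moreover have "(d, w) \<in> E" using wd E_sym by blast
        moreover have "\<not> blocked E P C D (take i xs) w" using xs i unfolding constrained_prefix_def by blast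
        ultimately obtain u where u: "u \<in> set (take i xs)" "(c, u) \<in> E" "(d, u) \<notin> E"
          using xy unfolding blocked_def c_def d_def by blast
        have buw: "before xs u w" using u(1) before_take[OF _ i(1)] i dv by auto
        have "u \<in> lower c - lower d"
          using u before_depth[OF px buw] wd e E_sym by (auto simp: lower_def)
        then show "\<exists>u \<in> lower c - lower d. before (xs @ [v]) u w" using buw by (auto simp: before_snoc)
      qed
      with first[OF bef] A show False by simp
    next
      assume "(D x y, v) \<in> E \<and> (C x y, v) \<notin> E \<and> \<not> (\<exists>u \<in> set xs. (C x y, u) \<in> E \<and> (D x y, u) \<notin> E)"
      then have B: "(d, v) \<in> E" "(c, v) \<notin> E" "\<And>u. u \<in> set xs \<Longrightarrow> (c, u) \<in> E \<Longrightarrow> (d, u) \<in> E"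
        by (auto simp: c_def d_def)
      then have "c \<noteq> d" by auto
      then obtain a b where e: "before ss c d" "depth c = depth d"
        and a: "is_first ts (lower c - lower d) a" and b: "is_first ts (lower d - lower c) b"
        and eq: "lower a = lower b" using ends by blast
      have notin: "u \<notin> set xs" if "u \<in> lower c - lower d" for u
      proof
        assume "u \<in> set xs"
        moreover have "(c, u) \<in> E" using that lowerD E_sym by blast
        ultimately have "(d, u) \<in> E" using B by blast
        moreover have "depth u < depth d" using that lowerD e by auto
        ultimately show False using that E_sym by (auto simp: lower_def)
      qed
      have aC: "a \<in> lower c - lower d" using a by (simp add: is_first_def)
      then have ad: "a \<in> V" "depth d = Suc (depth a)" using lowerD[of a c] e by auto
      have "\<not> depth a < depth v" using below ad notin aC by blast
      \<comment> \<open>If \<open>v\<close> were deeper than \<open>d\<close>, it would be deeper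
        than \<open>a\<close>, and the private neighbour \<open>a\<close> of \<open>c\<close> would
        have been numbered already.\<close>
      with ad depth_edge[OF B(1)] have dav: "depth d = Suc (depth v)" by auto
      then have vD: "v \<in> lower d - lower c" using B E_sym by (auto simp: lower_def)
      \<comment> \<open>The set of \<open>b\<close> is the largest among the private lower
        neighbours of \<open>d\<close>, and \<open>chain\<close> ends where \<open>a\<close> and
        \<open>b\<close> are twins. Since \<open>v\<close> is a possible choice while
        \<open>a\<close> is unnumbered, the inclusion becomes an equality.\<close>
      have sub: "lower v \<subseteq> lower a" using max_rep[OF ts b _ vD] eq by blast
      have "\<not> before (xs @ [v]) a v" using notin aC beforeD[of xs a v] by (auto simp: before_snoc)
      moreover have "depth a = depth v" using ad dav by simp
      moreover have "v \<in> set (xs @ [v])" by simp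
      ultimately have va: "lower v = lower a"
        using prefix_first[OF pv, of v a] ad(1) sub by blast
      have cd: "c \<in> set ss" "d \<in> V" using beforeD[OF e(1)] ss(2) by auto
      have "\<not> before ss d c" by (rule before_asym[OF dss e(1)])
      \<comment> \<open>In the solution, \<open>c\<close> precedes \<open>d\<close>, so a private
        neighbour \<open>a'\<close> of \<open>c\<close> precedes \<open>v\<close>. By maximality of
        \<open>a\<close> and by its place before \<open>v\<close>, \<open>a'\<close> is a twin of
        \<open>v\<close>.\<close>
      then obtain a' where a': "a' \<in> lower c - lower d"
        "is_first ss ((lower c - lower d) \<union> (lower d - lower c)) a'"
        using prefix_first[OF ss(1) cd] e(2) vD by (metis DiffD1 DiffD2)
      have "a' \<noteq> v" using a' vD by blast
      then have bef: "before ss a' v"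
        using before_total[of a' ss v] a' vD vT ss(2) by (auto simp: is_first_def)
      have sub': "lower a' \<subseteq> lower v" using max_rep[OF ts a _ a'(1)] va by blast
      have a'd: "depth v = depth a'" using lowerD[of a' c] a' dav e by auto
      have "a' \<in> set ss" "\<not> before ss v a'" using beforeD[OF bef] before_asym[OF dss bef] by auto
      then have "lower a' = lower v"
        using prefix_first[OF ss(1), of a' v] vT(1) a'd sub' by blast
      then have "a' \<in> set xs" using first bef by blast
      then show False using notin a' by blast
    qed
  qed
  with lm show ?thesis by blast
qed

end


section \<open>Maximal labels by successive refinement\<close>

text \<open>Computes the maximal labels without storing any: going through the numbered vertices,
  the candidates adjacent to the current one are kept whenever there are any.\<close>

fun refined :: "'a rel \<Rightarrow> 'a set \<Rightarrow> 'a list \<Rightarrow> nat \<Rightarrow> 'a set" where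
  "refined E U xs 0 = U"
| "refined E U xs (Suc j) =
    (if \<exists>v \<in> refined E U xs j. (xs ! j, v) \<in> E then {v \<in> refined E U xs j. (xs ! j, v) \<in> E}
     else refined E U xs j)"

lemma refined_nonempty: "U \<noteq> {} \<Longrightarrow> refined E U xs j \<noteq> {}"
  by (induction j) auto

lemma refined_subset: "refined E U xs j \<subseteq> U"
  by (induction j) auto

lemma refined_agree:
  "v \<in> refined E U xs j \<Longrightarrow> w \<in> refined E U xs j \<Longrightarrow> i < j \<Longrightarrow> (xs ! i, v) \<in> E \<longleftrightarrow> (xs ! i, w) \<in> E"
  by (induction j) (auto split: if_splits simp: less_Suc_eq)

text \<open>The clause on smaller indices makes \<open>i\<close> the first difference of the two
  labels; \<open>refined_eq\<close> relies on this.\<close>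

lemma refined_beats:
  "v \<in> refined E U xs j \<Longrightarrow> u \<in> U - refined E U xs j \<Longrightarrow>
     \<exists>i<j. (xs ! i, v) \<in> E \<and> (xs ! i, u) \<notin> E \<and> (\<forall>k<i. (xs ! k, v) \<in> E \<longleftrightarrow> (xs ! k, u) \<in> E)"
proof (induction j)
  case (Suc j)
  have v: "v \<in> refined E U xs j" using Suc.prems by (auto split: if_splits)
  show ?case
  proof (cases "u \<in> refined E U xs j")
    case True
    with Suc.prems have "(xs ! j, v) \<in> E" "(xs ! j, u) \<notin> E" by (auto split: if_splits)
    with refined_agree[OF v True] show ?thesis by blast
  next
    case False
    with Suc v show ?thesis by (metis DiffD1 DiffI less_SucI)
  qed
qed simp

text \<open>For the second inclusion, a dropped vertex is compared with a survivor at their first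
  difference, where nothing earlier can compensate.\<close>

lemma refined_eq:
  "refined E U xs j = {v \<in> U. \<forall>u \<in> U. \<forall>i < j. (xs ! i, u) \<in> E \<and> (xs ! i, v) \<notin> E \<longrightarrow>
     (\<exists>k<i. (xs ! k, v) \<in> E \<and> (xs ! k, u) \<notin> E)}" (is "_ = ?R")
proof (intro subset_antisym subsetI)
  fix v assume v: "v \<in> refined E U xs j"
  show "v \<in> ?R"
  proof (intro CollectI conjI ballI allI impI)
    show "v \<in> U" by (rule subsetD[OF refined_subset v])
    fix u i assume u: "u \<in> U" and i: "i < j" and e: "(xs ! i, u) \<in> E \<and> (xs ! i, v) \<notin> E"
    then have "u \<notin> refined E U xs j" using refined_agree[OF v _ i] by blast
    then obtain k where k: "(xs ! k, v) \<in> E" "(xs ! k, u) \<notin> E"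
      "\<forall>l<k. (xs ! l, v) \<in> E \<longleftrightarrow> (xs ! l, u) \<in> E"
      using refined_beats[OF v] u by blast
    with e have "k < i" by (metis linorder_neqE_nat)
    with k show "\<exists>k<i. (xs ! k, v) \<in> E \<and> (xs ! k, u) \<notin> E" by blast
  qed
next
  fix v assume v: "v \<in> ?R"
  show "v \<in> refined E U xs j"
  proof (rule ccontr)
    assume neg: "v \<notin> refined E U xs j"
    have "U \<noteq> {}" using v by blast
    then have "refined E U xs j \<noteq> {}" by (rule refined_nonempty)
    then obtain w where w: "w \<in> refined E U xs j" by blast
    have wU: "w \<in> U" by (rule subsetD[OF refined_subset w])
    obtain i where i: "i < j" "(xs ! i, w) \<in> E" "(xs ! i, v) \<notin> E"
      "\<forall>k<i. (xs ! k, w) \<in> E \<longleftrightarrow> (xs ! k, v) \<in> E"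
      using refined_beats[OF w] v neg by blast
    with v wU show False by blast
  qed
qed

lemma lex_max_refined:
  assumes "r \<in> V"
  shows "lex_max E V r xs v \<longleftrightarrow>
    v \<in> refined E (if xs = [] then {r} else V - set xs) xs (length xs)"
  using assms unfolding refined_eq by (auto simp: lex_max_def)

lemma ex_lex_max:
  assumes "r \<in> V" "V - set xs \<noteq> {}"
  shows "\<exists>v. lex_max E V r xs v"
  unfolding lex_max_refined[OF assms(1)] using refined_nonempty assms(2)
  by (metis ex_in_conv insert_not_empty)


section \<open>Label Search\<close>

text \<open>Replaces the minima by quantifiers, in the shape used by \<open>lex_max\<close>.
  Inclusions are covered: an empty \<open>B - A\<close> satisfies the condition vacuously, while a
  proper \<open>A \<subset> B\<close> violates it.\<close>

lemma not_lbfs_prec_iff: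
  assumes "finite A" "finite B"
  shows "\<not> lbfs_prec A B \<longleftrightarrow> (\<forall>j \<in> B - A. \<exists>k \<in> A - B. k < j)"
proof (cases "B - A = {} \<or> A - B = {}")
  case True
  then show ?thesis by (auto simp: lbfs_prec_def)
next
  case False
  let ?a = "Min (A - B)" and ?b = "Min (B - A)"
  have fin: "finite (A - B)" "finite (B - A)" using assms by auto
  then have mem: "?a \<in> A - B" "?b \<in> B - A" using False Min_in by blast+
  have "\<not> lbfs_prec A B \<longleftrightarrow> ?a \<le> ?b" using False by (auto simp: lbfs_prec_def)
  \<comment> \<open>The minima belong to disjoint sets and so differ.\<close>
  also have "\<dots> \<longleftrightarrow> ?a < ?b" using mem by (metis DiffD1 DiffD2 le_neq_implies_less less_imp_le)
  also have "\<dots> \<longleftrightarrow> (\<forall>j \<in> B - A. \<exists>k \<in> A - B. k < j)"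
  proof
    assume "?a < ?b"
    then show "\<forall>j \<in> B - A. \<exists>k \<in> A - B. k < j"
      using Min_le[OF fin(2)] mem(1) by (metis less_le_trans)
  next
    assume "\<forall>j \<in> B - A. \<exists>k \<in> A - B. k < j"
    then obtain k where "k \<in> A - B" "k < ?b" using mem(2) by blast
    then show "?a < ?b" using Min_le[OF fin(1)] by (metis le_less_trans)
  qed
  finally show ?thesis .
qed

text \<open>Restricted to unnumbered vertices because a label is frozen once its vertex is
  numbered.\<close>

lemma label_search_labels:
  assumes "label_search prec G xs lab" "u \<in> pverts G - set xs"
  shows "lab u = Suc ` {j. j < length xs \<and> (xs ! j, u) \<in> parcs G}"
  using assms
proof (induction arbitrary: u rule: label_search.induct)
  case (step xs lab v)
  then have u: "u \<in> pverts G - set xs" "u \<in> pverts G - set (xs @ [v])" by auto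
  have "{j. j < length (xs @ [v]) \<and> ((xs @ [v]) ! j, u) \<in> parcs G} =
    {j. j < length xs \<and> (xs ! j, u) \<in> parcs G} \<union> (if (v, u) \<in> parcs G then {length xs} else {})"
    by (auto simp: nth_append less_Suc_eq split: if_splits)
  with step.IH[OF u(1)] u(2) show ?case by auto
qed simp

lemma label_search_choice:
  assumes ls: "label_search prec G xs lab" and v: "v \<in> pverts G - set xs"
  shows "(\<exists>y \<in> pverts G - set xs. lbfs_prec (lab v) (lab y)) \<longleftrightarrow>
    \<not> (\<forall>u \<in> pverts G - set xs. \<forall>j < length xs. (xs ! j, u) \<in> parcs G \<and> (xs ! j, v) \<notin> parcs G \<longrightarrow>
        (\<exists>k<j. (xs ! k, v) \<in> parcs G \<and> (xs ! k, u) \<notin> parcs G))"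
proof -
  have fin: "finite (Suc ` {j. j < length xs \<and> (xs ! j, u) \<in> parcs G})" for u
    by simp
  have "\<not> lbfs_prec (lab v) (lab u) \<longleftrightarrow> (\<forall>j < length xs. (xs ! j, u) \<in> parcs G \<and> (xs ! j, v) \<notin> parcs G \<longrightarrow>
        (\<exists>k<j. (xs ! k, v) \<in> parcs G \<and> (xs ! k, u) \<notin> parcs G))" if u: "u \<in> pverts G - set xs" for u
    unfolding label_search_labels[OF ls v] label_search_labels[OF ls u] not_lbfs_prec_iff[OF fin fin]
      image_set_diff[OF inj_Suc, symmetric]
    by (auto dest: less_trans)
  then show ?thesis by blast
qed

lemma label_search_imp_search_prefix:
  "label_search lbfs_prec G xs lab \<Longrightarrow> xs \<noteq> [] \<longrightarrow> hd xs = r \<Longrightarrow> search_prefix (parcs G) (pverts G) r xs"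
proof (induction rule: label_search.induct)
  case (step xs lab v)
  then have "search_prefix (parcs G) (pverts G) r xs" by (cases xs) auto
  moreover have "xs = [] \<longrightarrow> v = r" using step.prems by auto
  ultimately show ?case
    using step.hyps(2,3) label_search_choice[OF step.hyps(1,2)]
    unfolding search_prefix_snoc lex_max_def by blast
qed simp

lemma search_prefix_imp_label_search:
  "search_prefix (parcs G) (pverts G) r xs \<Longrightarrow> \<exists>lab. label_search lbfs_prec G xs lab"
proof (induction xs rule: rev_induct)
  case Nil
  then show ?case using label_search.start by blast
next
  case (snoc v xs)
  then obtain lab where ls: "label_search lbfs_prec G xs lab" and v: "lex_max (parcs G) (pverts G) r xs v"
    by (auto simp: search_prefix_snoc)
  then have vV: "v \<in> pverts G - set xs" by (simp add: lex_max_def)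
  have "\<not> (\<exists>y \<in> pverts G - set xs. lbfs_prec (lab v) (lab y))"
    unfolding label_search_choice[OF ls vV] using v by (simp add: lex_max_def)
  from label_search.step[OF ls vV this] show ?case by blast
qed

lemma rooted_lbfs_extension_iff:
  assumes "finite (pverts G)" "pverts G \<noteq> {}" "P \<subseteq> pverts G \<times> pverts G"
  shows "rooted_lbfs_extension G P r xs \<longleftrightarrow>
    search_prefix (parcs G) (pverts G) r xs \<and> set xs = pverts G \<and>
    (\<forall>(x, y) \<in> P. x \<noteq> y \<longrightarrow> before xs x y)" (is "?L \<longleftrightarrow> ?R")
proof
  assume L: ?L
  then obtain lab where "label_search lbfs_prec G xs lab" "hd xs = r"
    by (auto simp: rooted_lbfs_extension_def lbfs_ordering_def)
  then have "search_prefix (parcs G) (pverts G) r xs"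
    by (intro label_search_imp_search_prefix) auto
  with L show ?R
    by (simp add: rooted_lbfs_extension_def linear_extension_def before_def)
next
  assume R: ?R
  then have sp: "search_prefix (parcs G) (pverts G) r xs" by simp
  then have ds: "distinct xs" using search_prefix_distinct by fastforce
  have ne: "xs \<noteq> []" using R assms(2) by auto
  have "length xs = card (pverts G)" using distinct_card[OF ds] R by simp
  moreover have "hd xs = r" using search_prefix_hd[OF sp ne] ne by (simp add: hd_conv_nth)
  ultimately show ?L
    using R ne ds search_prefix_imp_label_search[OF sp]
    by (simp add: rooted_lbfs_extension_def lbfs_ordering_def linear_extension_def before_def)
qed


section \<open>Reasoning about programs\<close>

fun writes :: "com \<Rightarrow> vname set" where
  "writes Skip = {}"
| "writes (Assign x i e) = {x}"
| "writes (Seq p q) = writes p \<union> writes q"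
| "writes (Cond b p q) = writes p \<union> writes q"
| "writes (While b p) = writes p"

text \<open>A frame condition. Since \<open>writes\<close> is syntactic, \<open>exec_agree\<close>
  gives it for every program, and postconditions need to state only what changes.\<close>

definition agree :: "vname set \<Rightarrow> memory \<Rightarrow> memory \<Rightarrow> bool" where
  "agree X s s' \<longleftrightarrow> (\<forall>x. x \<notin> X \<longrightarrow> s' x = s x)"

lemma agreeD: "agree X s s' \<Longrightarrow> x \<notin> X \<Longrightarrow> s' x = s x"
  by (simp add: agree_def)

lemma agree_mono: "agree X s s' \<Longrightarrow> X \<subseteq> Y \<Longrightarrow> agree Y s s'"
  by (auto simp: agree_def)

lemma exec_agree: "exec W p s t s' \<Longrightarrow> agree (writes p) s s'"
  by (induction rule: exec.induct) (auto simp: agree_def)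

text \<open>Timed total correctness; the existence of an execution also includes that all numbers
  fit into a word.\<close>

definition run :: "nat \<Rightarrow> com \<Rightarrow> memory \<Rightarrow> nat \<Rightarrow> (memory \<Rightarrow> bool) \<Rightarrow> bool" where
  "run W p s T Q \<longleftrightarrow> (\<exists>t s'. exec W p s t s' \<and> t \<le> T \<and> Q s')"

lemma run_weaken:
  assumes "run W p s T Q" "T \<le> T'" "\<And>s'. Q s' \<Longrightarrow> agree (writes p) s s' \<Longrightarrow> Q' s'"
  shows "run W p s T' Q'"
  using assms exec_agree unfolding run_def by (meson le_trans)

lemma run_Skip: "Q s \<Longrightarrow> 1 \<le> T \<Longrightarrow> run W Skip s T Q"
  unfolding run_def using exec.Skip by blast

lemma run_Assign:
  assumes "fits W s i" "fits W s e" "1 + cost i + cost e \<le> T"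
    and "Q (s(x := (s x)(val s i := val s e)))"
  shows "run W (Assign x i e) s T Q"
  using exec.Assign[OF assms(1,2)] assms(3,4) unfolding run_def by blast

lemma run_Seq:
  assumes "run W p s T1 R" "\<And>s'. R s' \<Longrightarrow> agree (writes p) s s' \<Longrightarrow> run W q s' T2 Q"
  shows "run W (Seq p q) s (T1 + T2) Q"
proof -
  obtain t s' where p: "exec W p s t s'" "t \<le> T1" "R s'" using assms(1) unfolding run_def by blast
  then obtain t' s'' where "exec W q s' t' s''" "t' \<le> T2" "Q s''"
    using assms(2) exec_agree unfolding run_def by blast
  with p show ?thesis unfolding run_def by (meson add_mono exec.Seq)
qed

lemma run_Cond:
  assumes "fits W s b" "val s b \<noteq> 0 \<Longrightarrow> run W p s T Q" "val s b = 0 \<Longrightarrow> run W q s T Q"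
  shows "run W (Cond b p q) s (1 + cost b + T) Q"
proof (cases "val s b = 0")
  case True
  with assms(3) obtain t s' where "exec W q s t s'" "t \<le> T" "Q s'" unfolding run_def by blast
  with exec.CondFalse[OF assms(1) True] show ?thesis unfolding run_def by (meson add_left_mono)
next
  case False
  with assms(2) obtain t s' where "exec W p s t s'" "t \<le> T" "Q s'" unfolding run_def by blast
  with exec.CondTrue[OF assms(1) False] show ?thesis unfolding run_def by (meson add_left_mono)
qed

lemma fits_le: "fits W s e \<Longrightarrow> val s e \<le> W"
  by (cases e) auto

abbreviation Var :: "vname \<Rightarrow> expr" where
  "Var x \<equiv> Cell x (Const 0)"

abbreviation Neg :: "expr \<Rightarrow> expr" where
  "Neg e \<equiv> Bin Equal e (Const 0)"

section \<open>Counting loops, linear search, array filling, loops over pairs\<close>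

definition For :: "vname \<Rightarrow> vname \<Rightarrow> com \<Rightarrow> com" where
  "For x y p = Seq (Assign x (Const 0) (Const 0))
     (While (Bin Less (Var x) (Var y)) (Seq p (Assign x (Const 0) (Bin Add (Var x) (Const 1)))))"

lemma writes_For [simp]: "writes (For x y p) = insert x (writes p)"
  by (auto simp: For_def)

text \<open>Initialisation costs 3, every evaluation of the guard 6 and every increment 6; this
  explains 9 outside the sum and 12 inside. By \<open>indep\<close>, the invariant survives changes
  of the counter.\<close>

lemma run_For:
  assumes N: "s y 0 = N" "N \<le> W" "1 \<le> W"
    and names: "x \<noteq> y" "x \<notin> writes p" "y \<notin> writes p"
    and start: "I 0 s"
    and indep: "\<And>j s' v. I j s' \<Longrightarrow> I j (s'(x := v))"
    and body: "\<And>j s'. j < N \<Longrightarrow> I j s' \<Longrightarrow> s' x 0 = j \<Longrightarrow> agree (insert x (writes p)) s s' \<Longrightarrow>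
      run W p s' (T j) (I (Suc j))"
  shows "run W (For x y p) s (9 + (\<Sum>j<N. T j + 12)) (I N)"
proof -
  let ?A = "agree (insert x (writes p)) s"
  let ?loop = "While (Bin Less (Var x) (Var y)) (Seq p (Assign x (Const 0) (Bin Add (Var x) (Const 1))))"
  have loop: "run W ?loop s' (6 + (\<Sum>i=j..<N. T i + 12)) (I N)"
    if "j \<le> N" "I j s'" "s' x 0 = j" "?A s'" for j s'
    using that
  proof (induction "N - j" arbitrary: j s')
    case 0
    then have "s' y 0 = N" "j = N" using names N agreeD[of _ s s' y] by auto
    then have "exec W ?loop s' (1 + cost (Bin Less (Var x) (Var y))) s'"
      using 0 N by (intro exec.WhileFalse) auto
    with 0 \<open>j = N\<close> show ?case unfolding run_def by fastforce
  next
    case (Suc k)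
    then have j: "j < N" by simp
    have y: "s' y 0 = N" using names N agreeD[OF Suc.prems(4), of y] by auto
    obtain t s1 where s1: "exec W p s' t s1" "t \<le> T j" "I (Suc j) s1"
      using body[OF j Suc.prems(2-4)] unfolding run_def by blast
    note a1 = exec_agree[OF s1(1)]
    have x1: "s1 x 0 = j" using agreeD[OF a1, of x] names Suc.prems(3) by simp
    let ?inc = "Assign x (Const 0) (Bin Add (Var x) (Const 1))"
    define s2 where "s2 = s1(x := (s1 x)(0 := Suc j))"
    have "exec W ?inc s1 (1 + cost (Const 0) + cost (Bin Add (Var x) (Const 1)))
      (s1(x := (s1 x)(val s1 (Const 0) := val s1 (Bin Add (Var x) (Const 1)))))"
      using x1 j N by (intro exec.Assign) auto
    then have inc: "exec W ?inc s1 6 s2" using x1 by (simp add: s2_def numeral_eq_Suc)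
    have "run W ?loop s2 (6 + (\<Sum>i=Suc j..<N. T i + 12)) (I N)"
    proof (rule Suc.hyps(1))
      show "k = N - Suc j" "Suc j \<le> N" "I (Suc j) s2" "s2 x 0 = Suc j"
        using Suc.hyps(2) j s1(3) indep by (auto simp: s2_def)
      show "?A s2"
        using Suc.prems(4) a1 by (auto simp: s2_def agree_def)
    qed
    then obtain t' s3 where s3: "exec W ?loop s2 t' s3" "t' \<le> 6 + (\<Sum>i=Suc j..<N. T i + 12)" "I N s3"
      unfolding run_def by blast
    have "exec W ?loop s' (1 + cost (Bin Less (Var x) (Var y)) + (t + 6) + t') s3"
      by (rule exec.WhileTrue[OF _ _ exec.Seq[OF s1(1) inc] s3(1)]) (use y Suc.prems(3) j N in auto)
    moreover have "(\<Sum>i=j..<N. T i + 12) = T j + 12 + (\<Sum>i=Suc j..<N. T i + 12)"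
      using j by (simp add: sum.atLeast_Suc_lessThan)
    ultimately show ?case using s1(2) s3 unfolding run_def by (intro exI[of _ s3] exI) auto
  qed
  have "run W (For x y p) s (3 + (6 + (\<Sum>i=0..<N. T i + 12))) (I N)"
    unfolding For_def
  proof (rule run_Seq[where R = "\<lambda>s'. s' = s(x := (s x)(0 := 0))"])
    fix s' assume s': "s' = s(x := (s x)(0 := 0))"
    show "run W ?loop s' (6 + (\<Sum>i=0..<N. T i + 12)) (I N)"
      by (rule loop) (auto simp: s' start indep agree_def)
  qed (rule run_Assign, auto)
  then show ?thesis by (simp add: atLeast0LessThan)
qed

text \<open>The value \<open>N\<close> signals that there is no hit.\<close>

definition first :: "nat \<Rightarrow> (nat \<Rightarrow> bool) \<Rightarrow> nat" where
  "first N Q = (LEAST j. j = N \<or> Q j)"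

lemma first_le: "first N Q \<le> N"
  unfolding first_def by (rule Least_le) simp

lemma first_holds: "first N Q < N \<Longrightarrow> Q (first N Q)"
  using LeastI[of "\<lambda>j. j = N \<or> Q j" N] unfolding first_def by auto

lemma first_least: "j < first N Q \<Longrightarrow> \<not> Q j"
  unfolding first_def using not_less_Least by blast

lemma first_less_iff: "first N Q < N \<longleftrightarrow> (\<exists>j<N. Q j)"
  using first_holds first_least first_le by (metis le_neq_implies_less)

text \<open>There is no early exit: the factor \<open>f = n\<close> lets only the first hit be
  recorded. Products act as conjunctions without short-circuiting, so \<open>b\<close> has to be
  evaluable at every index.\<close>

definition Find :: "vname \<Rightarrow> vname \<Rightarrow> expr \<Rightarrow> com" where
  "Find f x b = Seq (Assign f (Const 0) (Var ''n''))
     (For x ''n'' (Cond (Bin Mul (Bin Equal (Var f) (Var ''n'')) b) (Assign f (Const 0) (Var x)) Skip))"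

lemma writes_Find [simp]: "writes (Find f x b) = {f, x}"
  by (auto simp: Find_def)

lemma run_Find:
  assumes N: "s ''n'' 0 = N" "N \<le> W" "1 \<le> W"
    and names: "f \<noteq> x" "f \<noteq> ''n''" "x \<noteq> ''n''"
    and b: "\<And>j s'. j < N \<Longrightarrow> s' x 0 = j \<Longrightarrow> agree {f, x} s s' \<Longrightarrow>
      fits W s' b \<and> (val s' b \<noteq> 0 \<longleftrightarrow> Q j)"
  shows "run W (Find f x b) s ((cost b + 30) * (N + 1)) (\<lambda>s'. s' f 0 = first N Q)"
proof -
  let ?p = "Cond (Bin Mul (Bin Equal (Var f) (Var ''n'')) b) (Assign f (Const 0) (Var x)) Skip"
  let ?I = "\<lambda>j s'. (s' f 0 = N \<and> (\<forall>k<j. \<not> Q k)) \<or> (s' f 0 < N \<and> s' f 0 = first N Q)"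
  have "run W (Find f x b) s (4 + (9 + (\<Sum>j<N. (cost b + 12) + 12))) (?I N)"
    unfolding Find_def
  proof (rule run_Seq[where R = "\<lambda>s'. s' f 0 = N"])
    show "run W (Assign f (Const 0) (Var ''n'')) s 4 (\<lambda>s'. s' f 0 = N)"
      by (rule run_Assign) (use N in auto)
    fix s1 assume f1: "s1 f 0 = N" and a1: "agree (writes (Assign f (Const 0) (Var ''n''))) s s1"
    have n1: "s1 ''n'' 0 = N" using agreeD[OF a1, of "''n''"] names N by simp
    show "run W (For x ''n'' ?p) s1 (9 + (\<Sum>j<N. (cost b + 12) + 12)) (?I N)"
    proof (rule run_For[where I = ?I and N = N])
      fix j s' assume j: "j < N" and I: "?I j s'" and x: "s' x 0 = j"
        and a2: "agree (insert x (writes ?p)) s1 s'"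
      have n2: "s' ''n'' 0 = N" using agreeD[OF a2, of "''n''"] names n1 by simp
      have "agree {f, x} s s'" using a1 a2 by (auto simp: agree_def)
      from b[OF j x this] have fb: "fits W s' b" and vb: "val s' b \<noteq> 0 \<longleftrightarrow> Q j" by auto
      have ft: "fits W s' (Bin Mul (Bin Equal (Var f) (Var ''n'')) b)"
        using fb fits_le[OF fb] I n2 N first_le[of N Q] by auto
      have "run W ?p s' (1 + cost (Bin Mul (Bin Equal (Var f) (Var ''n'')) b) + 4) (?I (Suc j))"
      proof (rule run_Cond[OF ft])
        assume "val s' (Bin Mul (Bin Equal (Var f) (Var ''n'')) b) \<noteq> 0"
        then have fN: "s' f 0 = N" and Q: "Q j" using vb n2 by (auto split: if_splits)
        have "\<forall>k<j. \<not> Q k" using I fN by auto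
        moreover have "first N Q \<le> j" unfolding first_def by (rule Least_le) (use Q in simp)
        moreover have "Q (first N Q)" using calculation(2) j by (intro first_holds[of N Q]) simp
        ultimately have "first N Q = j" by (metis le_neq_implies_less)
        then show "run W (Assign f (Const 0) (Var x)) s' 4 (?I (Suc j))"
          by (intro run_Assign) (use x j N in auto)
      next
        assume "val s' (Bin Mul (Bin Equal (Var f) (Var ''n'')) b) = 0"
        then have "\<not> (s' f 0 = N \<and> Q j)" using vb n2 by auto
        with I show "run W Skip s' 4 (?I (Suc j))" by (intro run_Skip) (auto simp: less_Suc_eq)
      qed
      then show "run W ?p s' (cost b + 12) (?I (Suc j))" by (rule run_weaken) auto
    qed (use n1 N names f1 in auto)
  qed
  then show ?thesis
  proof (rule run_weaken)
    fix s' assume "?I N s'"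
    moreover have "s' f 0 = first N Q" if "\<forall>k<N. \<not> Q k" "s' f 0 = N"
      using that first_less_iff[of N Q] first_le[of N Q] by auto
    ultimately show "s' f 0 = first N Q" by blast
  qed (simp add: algebra_simps)
qed

definition Fill :: "vname \<Rightarrow> vname \<Rightarrow> expr \<Rightarrow> com" where
  "Fill a x e = For x ''n'' (Assign a (Var x) e)"

lemma writes_Fill [simp]: "writes (Fill a x e) = {a, x}"
  by (auto simp: Fill_def)

text \<open>The premise \<open>s' a j = s a j\<close> says that the cell about to be overwritten
  still has its old value. Thus \<open>e\<close> may read it, as the filters on \<open>cand\<close>
  do.\<close>

lemma run_Fill:
  assumes N: "s ''n'' 0 = N" "N \<le> W" "1 \<le> W"
    and names: "a \<noteq> x" "a \<noteq> ''n''" "x \<noteq> ''n''"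
    and e: "\<And>j s'. j < N \<Longrightarrow> s' x 0 = j \<Longrightarrow> agree {a, x} s s' \<Longrightarrow> s' a j = s a j \<Longrightarrow>
      fits W s' e \<and> val s' e = F j"
  shows "run W (Fill a x e) s ((cost e + 30) * (N + 1)) (\<lambda>s'. \<forall>j<N. s' a j = F j)"
proof -
  let ?I = "\<lambda>j s'. (\<forall>k<j. s' a k = F k) \<and> (\<forall>k\<ge>j. s' a k = s a k)"
  have "run W (Fill a x e) s (9 + (\<Sum>j<N. (cost e + 3) + 12)) (?I N)"
    unfolding Fill_def
  proof (rule run_For[where I = ?I and N = N])
    fix j s' assume j: "j < N" and I: "?I j s'" and x: "s' x 0 = j"
      and ag: "agree (insert x (writes (Assign a (Var x) e))) s s'"
    have "agree {a, x} s s'" using ag by (auto simp: agree_def)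
    from e[OF j x this] I have "fits W s' e" "val s' e = F j" by auto
    with I x j N show "run W (Assign a (Var x) e) s' (cost e + 3) (?I (Suc j))"
      by (intro run_Assign) (auto simp: less_Suc_eq)
  qed (use N names in auto)
  then show ?thesis by (rule run_weaken) (auto simp: algebra_simps)
qed

definition Pairs :: "vname \<Rightarrow> vname \<Rightarrow> com \<Rightarrow> com" where
  "Pairs x y p = For x ''n'' (For y ''n'' p)"

lemma writes_Pairs [simp]: "writes (Pairs x y p) = {x, y} \<union> writes p"
  by (auto simp: Pairs_def)

lemma sum_pairs_if:
  fixes N t :: nat
  assumes "S \<subseteq> {..<N} \<times> {..<N}"
  shows "(\<Sum>a<N. \<Sum>b<N. if (a, b) \<in> S then t else 0) = card S * t"
proof -
  have "(\<Sum>a<N. \<Sum>b<N. if (a, b) \<in> S then t else 0) =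
      (\<Sum>z \<in> {..<N} \<times> {..<N}. if z \<in> S then t else 0)"
    by (simp add: sum.cartesian_product)
  also have "\<dots> = (\<Sum>z \<in> ({..<N} \<times> {..<N}) \<inter> S. t)"
    by (rule sum.inter_restrict[symmetric]) simp
  also have "({..<N} \<times> {..<N}) \<inter> S = S" using assms by blast
  finally show ?thesis by simp
qed

text \<open>Separates the cost \<open>t0\<close> of visiting any pair from the cost
  \<open>t1\<close> of treating a pair of \<open>S\<close>. The expensive part is thereby charged to
  \<open>card S\<close> and not to all pairs.\<close>

lemma run_Pairs:
  assumes N: "s ''n'' 0 = N" "N \<le> W" "1 \<le> W"
    and names: "x \<noteq> y" "x \<noteq> ''n''" "y \<noteq> ''n''" "''n'' \<notin> writes p" "x \<notin> writes p" "y \<notin> writes p"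
    and S: "S \<subseteq> {..<N} \<times> {..<N}"
    and start: "I {} s"
    and indep: "\<And>D s' z v. z \<in> {x, y} \<Longrightarrow> I D s' \<Longrightarrow> I D (s'(z := v))"
    and body: "\<And>D a b s'. a < N \<Longrightarrow> b < N \<Longrightarrow> (a, b) \<notin> D \<Longrightarrow> I D s' \<Longrightarrow> s' x 0 = a \<Longrightarrow> s' y 0 = b \<Longrightarrow>
      agree ({x, y} \<union> writes p) s s' \<Longrightarrow>
      run W p s' (t0 + (if (a, b) \<in> S then t1 else 0)) (I (insert (a, b) D))"
  shows "run W (Pairs x y p) s ((t0 + 30) * (N + 1)\<^sup>2 + card S * t1) (I ({..<N} \<times> {..<N}))"
proof -
  let ?T = "\<lambda>a b. t0 + (if (a, b) \<in> S then t1 else 0)"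
  let ?D = "\<lambda>a b. {..<a} \<times> {..<N} \<union> {a} \<times> {..<b}"
  have "run W (Pairs x y p) s (9 + (\<Sum>a<N. (9 + (\<Sum>b<N. ?T a b + 12)) + 12)) (I ({..<N} \<times> {..<N}))"
    unfolding Pairs_def
  proof (rule run_For[where I = "\<lambda>a. I ({..<a} \<times> {..<N})" and N = N])
    fix a s1 assume a: "a < N" and I1: "I ({..<a} \<times> {..<N}) s1" and x1: "s1 x 0 = a"
      and ag1: "agree (insert x (writes (For y ''n'' p))) s s1"
    have n1: "s1 ''n'' 0 = N" using agreeD[OF ag1, of "''n''"] N names by simp
    have "run W (For y ''n'' p) s1 (9 + (\<Sum>b<N. ?T a b + 12)) (I (?D a N))"
    proof (rule run_For[where I = "\<lambda>b. I (?D a b)" and N = N])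
      fix b s2 assume b: "b < N" and I2: "I (?D a b) s2" and y2: "s2 y 0 = b"
        and ag2: "agree (insert y (writes p)) s1 s2"
      have "s2 x 0 = a" using agreeD[OF ag2, of x] x1 names by simp
      moreover have "agree ({x, y} \<union> writes p) s s2" using ag1 ag2 by (auto simp: agree_def)
      ultimately have "run W p s2 (?T a b) (I (insert (a, b) (?D a b)))"
        using a b I2 y2 by (intro body) auto
      moreover have "insert (a, b) (?D a b) = ?D a (Suc b)" by (auto simp: less_Suc_eq)
      ultimately show "run W p s2 (?T a b) (I (?D a (Suc b)))" by simp
    qed (use n1 N names I1 indep in auto)
    moreover have "?D a N = {..<Suc a} \<times> {..<N}" by (auto simp: less_Suc_eq)
    ultimately show "run W (For y ''n'' p) s1 (9 + (\<Sum>b<N. ?T a b + 12)) (I ({..<Suc a} \<times> {..<N}))"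
      by simp
  qed (use N names start indep in auto)
  moreover have "(\<Sum>a<N. (9 + (\<Sum>b<N. ?T a b + 12)) + 12) =
      N * 21 + N * (N * (t0 + 12)) + (\<Sum>a<N. \<Sum>b<N. if (a, b) \<in> S then t1 else 0)"
    by (simp add: sum.distrib algebra_simps)
  moreover have "9 + (N * 21 + N * (N * (t0 + 12))) \<le> (t0 + 30) * (N + 1)\<^sup>2"
    by (simp add: power2_eq_square algebra_simps)
  ultimately show ?thesis
    using sum_pairs_if[OF S, of t1] by (elim run_weaken) auto
qed

definition At :: "vname \<Rightarrow> expr \<Rightarrow> expr \<Rightarrow> expr" where
  "At m a b = Cell m (Bin Add (Bin Mul a (Var ''n'')) b)"

lemma val_At [simp]: "val s (At m a b) = s m (val s a * s ''n'' 0 + val s b)"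
  by (simp add: At_def)

lemma cost_At [simp]: "cost (At m a b) = 5 + cost a + cost b"
  by (simp add: At_def)

lemma pair_index_less: "a < N \<Longrightarrow> b < N \<Longrightarrow> a * N + b < N * (N :: nat)"
proof -
  assume "a < N" "b < N"
  then have "a * N + b < Suc a * N" by simp
  also have "\<dots> \<le> N * N" using \<open>a < N\<close> by (intro mult_le_mono) auto
  finally show ?thesis .
qed

lemma pair_index_inject:
  "a < N \<Longrightarrow> b < N \<Longrightarrow> c < N \<Longrightarrow> d < N \<Longrightarrow> a * N + b = c * N + d \<longleftrightarrow> a = c \<and> b = (d :: nat)"
proof -
  assume *: "a < N" "b < N" "c < N" "d < N"
  have "(a * N + b) div N = a" "(a * N + b) mod N = b" "(c * N + d) div N = c" "(c * N + d) mod N = d"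
    using * by auto
  then show ?thesis by metis
qed

lemma fits_At:
  assumes "fits W s a" "fits W s b" "val s a < N" "val s b < N" "s ''n'' 0 = N" "N * N \<le> W"
    and "s m (val s a * N + val s b) \<le> W"
  shows "fits W s (At m a b)"
  using assms pair_index_less[of "val s a" N "val s b"]
  by (auto simp: At_def) (metis le_trans le_square)


section \<open>The search program\<close>

text \<open>With truth values restricted to 0 and 1, \<open>Mul\<close> is conjunction and
  comparison with 0 is negation, and no intermediate result exceeds 1.\<close>

definition holds :: "nat \<Rightarrow> memory \<Rightarrow> expr \<Rightarrow> bool \<Rightarrow> bool" where
  "holds W s e Q \<longleftrightarrow> fits W s e \<and> val s e = of_bool Q"

lemma holds_Mul: "holds W s e Q \<Longrightarrow> holds W s e' Q' \<Longrightarrow> holds W s (Bin Mul e e') (Q \<and> Q')"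
  using fits_le[of W s e] by (auto simp: holds_def)

lemma holds_Neg: "holds W s e Q \<Longrightarrow> 1 \<le> W \<Longrightarrow> holds W s (Neg e) (\<not> Q)"
  by (auto simp: holds_def)

lemma holds_Less: "fits W s a \<Longrightarrow> fits W s b \<Longrightarrow> 1 \<le> W \<Longrightarrow> holds W s (Bin Less a b) (val s a < val s b)"
  by (auto simp: holds_def)

lemma holds_Equal: "fits W s a \<Longrightarrow> fits W s b \<Longrightarrow> 1 \<le> W \<Longrightarrow> holds W s (Bin Equal a b) (val s a = val s b)"
  by (auto simp: holds_def)

lemma holds_Cell: "fits W s e \<Longrightarrow> s x (val s e) = of_bool Q \<Longrightarrow> 1 \<le> W \<Longrightarrow> holds W s (Cell x e) Q"
  by (auto simp: holds_def)

definition graph_in :: "nat \<Rightarrow> nat rel \<Rightarrow> nat \<Rightarrow> memory \<Rightarrow> bool" where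
  "graph_in N E r s \<longleftrightarrow> s ''n'' 0 = N \<and> s ''r'' 0 = r \<and>
     (\<forall>u<N. \<forall>v<N. s ''adj'' (u * N + v) = of_bool ((u, v) \<in> E))"

lemma graph_in_agree:
  "graph_in N E r s \<Longrightarrow> agree X s s' \<Longrightarrow> {''n'', ''r'', ''adj''} \<inter> X = {} \<Longrightarrow> graph_in N E r s'"
  by (auto simp: graph_in_def agree_def)

lemma holds_adj:
  assumes "graph_in N E r s" "fits W s a" "fits W s b" "val s a < N" "val s b < N"
    and "N * N \<le> W" "1 \<le> W"
  shows "holds W s (At ''adj'' a b) ((val s a, val s b) \<in> E)"
  using assms fits_At[of W s a b N "''adj''"] by (auto simp: holds_def graph_in_def)

text \<open>The pairs are read from \<open>on\<close> instead of \<open>order\<close>: as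
  \<open>on\<close> is initially zero, the same program first serves as an unconstrained
  search.\<close>

definition constraints_in :: "nat \<Rightarrow> nat rel \<Rightarrow> (nat \<Rightarrow> nat \<Rightarrow> nat) \<Rightarrow> (nat \<Rightarrow> nat \<Rightarrow> nat) \<Rightarrow> memory \<Rightarrow> bool" where
  "constraints_in N P C D s \<longleftrightarrow> (\<forall>x<N. \<forall>y<N. s ''on'' (x * N + y) = of_bool ((x, y) \<in> P) \<and>
     s ''cx'' (x * N + y) = C x y \<and> s ''cy'' (x * N + y) = D x y \<and> C x y < N \<and> D x y < N)"

lemma constraints_in_agree:
  "constraints_in N P C D s \<Longrightarrow> agree X s s' \<Longrightarrow> {''on'', ''cx'', ''cy''} \<inter> X = {} \<Longrightarrow> constraints_in N P C D s'"
  by (auto simp: constraints_in_def agree_def)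

text \<open>Implements \<open>refined\<close>. The sum of \<open>i\<close> and the test
  \<open>v = r\<close> vanishes exactly for the vertices other than \<open>r\<close> in round
  0.\<close>

definition Candidates :: com where
  "Candidates = Seq
     (Fill ''cand'' ''v'' (Bin Mul (Neg (Cell ''vis'' (Var ''v'')))
        (Bin Less (Const 0) (Bin Add (Var ''i'') (Bin Equal (Var ''v'') (Var ''r''))))))
     (For ''j'' ''i'' (Seq
        (Find ''f'' ''v'' (Bin Mul (Cell ''cand'' (Var ''v'')) (At ''adj'' (Cell ''result'' (Var ''j'')) (Var ''v''))))
        (Cond (Bin Less (Var ''f'') (Var ''n''))
          (Fill ''cand'' ''v'' (Bin Mul (Cell ''cand'' (Var ''v'')) (At ''adj'' (Cell ''result'' (Var ''j'')) (Var ''v''))))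
          Skip)))"

lemma writes_Candidates [simp]: "writes Candidates = {''cand'', ''v'', ''j'', ''f''}"
  by (auto simp: Candidates_def)

text \<open>Whether a private neighbour of \<open>cx\<close> is already numbered does not depend on
  the candidate. Finding this out once per pair, before the candidates are filtered, keeps the time
  per pair linear.\<close>

definition Blocking :: com where
  "Blocking = Pairs ''x'' ''y'' (Cond (At ''on'' (Var ''x'') (Var ''y'')) (Seq
     (Find ''f'' ''v'' (Bin Mul (Cell ''vis'' (Var ''v''))
        (Bin Mul (At ''adj'' (At ''cx'' (Var ''x'') (Var ''y'')) (Var ''v''))
          (Neg (At ''adj'' (At ''cy'' (Var ''x'') (Var ''y'')) (Var ''v''))))))
     (Fill ''cand'' ''v'' (Bin Mul (Cell ''cand'' (Var ''v'')) (Bin Mul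
        (Neg (Bin Mul (Bin Equal (Var ''y'') (Var ''v'')) (Bin Mul (Neg (Bin Equal (Var ''x'') (Var ''v'')))
          (Neg (Cell ''vis'' (Var ''x''))))))
        (Neg (Bin Mul (Bin Mul (At ''adj'' (At ''cy'' (Var ''x'') (Var ''y'')) (Var ''v''))
          (Neg (At ''adj'' (At ''cx'' (Var ''x'') (Var ''y'')) (Var ''v''))))
          (Neg (Bin Less (Var ''f'') (Var ''n''))))))))) Skip)"

lemma writes_Blocking [simp]: "writes Blocking = {''x'', ''y'', ''f'', ''v'', ''cand''}"
  by (auto simp: Blocking_def)

definition Select :: com where
  "Select = Seq (Find ''f'' ''v'' (Cell ''cand'' (Var ''v'')))
     (Cond (Bin Less (Var ''f'') (Var ''n''))
       (Seq (Assign ''result'' (Var ''i'') (Var ''f'')) (Assign ''vis'' (Var ''f'') (Const 1)))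
       (Assign ''fail'' (Const 0) (Const 1)))"

lemma writes_Select [simp]: "writes Select = {''f'', ''v'', ''result'', ''vis'', ''fail''}"
  by (auto simp: Select_def)

definition Search :: com where
  "Search = Seq (Assign ''fail'' (Const 0) (Const 0)) (Seq (Fill ''vis'' ''v'' (Const 0))
     (For ''i'' ''n'' (Cond (Var ''fail'') Skip (Seq Candidates (Seq Blocking Select)))))"

lemma writes_Search [simp]: "writes Search =
    {''fail'', ''vis'', ''v'', ''i'', ''cand'', ''j'', ''f'', ''x'', ''y'', ''result''}"
  by (auto simp: Search_def)

text \<open>Failure is recorded by a stuck prefix as logical witness; this is what
  \<open>constrained_prefix_extend\<close> refutes in the presence of a solution.\<close>

definition search_result ::
  "nat \<Rightarrow> nat rel \<Rightarrow> nat \<Rightarrow> nat rel \<Rightarrow> (nat \<Rightarrow> nat \<Rightarrow> nat) \<Rightarrow> (nat \<Rightarrow> nat \<Rightarrow> nat) \<Rightarrow> memory \<Rightarrow> bool" where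
  "search_result N E r P C D s \<longleftrightarrow>
     (s ''fail'' 0 = 0 \<and> constrained_prefix E {..<N} r P C D (map (s ''result'') [0..<N])) \<or>
     (s ''fail'' 0 = 1 \<and> (\<exists>xs. constrained_prefix E {..<N} r P C D xs \<and> length xs < N \<and>
        (\<forall>v. lex_max E {..<N} r xs v \<longrightarrow> blocked E P C D xs v)))"

lemma word_bounds:
  fixes N W :: nat
  assumes "N * N + N + 2 \<le> W"
  shows "N * N \<le> W" "N \<le> W" "1 \<le> W" "\<And>a. a < N \<Longrightarrow> a \<le> W" "\<And>a. a < N \<Longrightarrow> Suc a \<le> W"
  using assms by auto

section \<open>Correctness and running time of one search\<close>

context
  fixes N W :: nat and E :: "nat rel" and r :: nat
  assumes W: "N * N + N + 2 \<le> W" and r: "r < N"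
begin

lemma run_Candidates:
  assumes g: "graph_in N E r s" and i: "s ''i'' 0 = length xs" "length xs < N"
    and res: "\<And>j. j < length xs \<Longrightarrow> s ''result'' j = xs ! j" and xs: "set xs \<subseteq> {..<N}"
    and vis: "\<And>v. v < N \<Longrightarrow> s ''vis'' v = of_bool (v \<in> set xs)"
  shows "run W Candidates s (300 * (N + 1)\<^sup>2)
    (\<lambda>s'. \<forall>v<N. s' ''cand'' v = of_bool (lex_max E {..<N} r xs v))"
proof -
  define U where "U = (if xs = [] then {r} else {..<N} - set xs)"
  have U: "U \<subseteq> {..<N}" using r by (auto simp: U_def)
  let ?R = "\<lambda>j s'. \<forall>v<N. s' ''cand'' v = of_bool (v \<in> refined E U xs j)"
  have n: "s ''n'' 0 = N" using g by (simp add: graph_in_def)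
  let ?e0 = "Bin Mul (Neg (Cell ''vis'' (Var ''v'')))
    (Bin Less (Const 0) (Bin Add (Var ''i'') (Bin Equal (Var ''v'') (Var ''r''))))"
  have init: "run W (Fill ''cand'' ''v'' ?e0) s (60 * (N + 1)) (?R 0)"
  proof (rule run_weaken[OF run_Fill[where F = "\<lambda>v. of_bool (v \<in> U)" and s = s and N = N, OF n word_bounds(2,3)[OF W]]])
    fix v s' assume v: "v < N" "s' ''v'' 0 = v" and ag: "agree {''cand'', ''v''} s s'"
    have *: "s' ''vis'' v = of_bool (v \<in> set xs)" "s' ''i'' 0 = length xs" "s' ''r'' 0 = r"
      using agreeD[OF ag] vis[OF v(1)] i g by (auto simp: graph_in_def)
    then show "fits W s' ?e0 \<and> val s' ?e0 = of_bool (v \<in> U)"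
      using v i(2) r W by (auto simp: U_def)
  qed auto
  let ?e = "Bin Mul (Cell ''cand'' (Var ''v'')) (At ''adj'' (Cell ''result'' (Var ''j'')) (Var ''v''))"
  let ?p = "Seq (Find ''f'' ''v'' ?e) (Cond (Bin Less (Var ''f'') (Var ''n'')) (Fill ''cand'' ''v'' ?e) Skip)"
  have "run W (For ''j'' ''i'' ?p) s1 (200 * (N + 1)\<^sup>2) (?R (length xs))"
    if R0: "?R 0 s1" and ag1: "agree {''cand'', ''v''} s s1" for s1
  proof -
    have "run W (For ''j'' ''i'' ?p) s1 (9 + (\<Sum>j<length xs. (120 * (N + 1)) + 12)) (?R (length xs))"
    proof (rule run_For[where I = ?R and N = "length xs"])
      show "s1 ''i'' 0 = length xs" using agreeD[OF ag1] i by simp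
      fix j s2 assume j: "j < length xs" and R: "?R j s2" and j2: "s2 ''j'' 0 = j"
        and ag2: "agree (insert ''j'' (writes ?p)) s1 s2"
      have ag: "agree {''j'', ''cand'', ''f'', ''v''} s s2" using ag1 ag2 by (auto simp: agree_def)
      have g2: "graph_in N E r s2" by (rule graph_in_agree[OF g ag]) auto
      then have n2: "s2 ''n'' 0 = N" by (simp add: graph_in_def)
      have xj: "s2 ''result'' j = xs ! j" "xs ! j < N"
        using agreeD[OF ag, of "''result''"] res[OF j] subsetD[OF xs nth_mem[OF j]] by auto
      have e: "holds W s' ?e (v \<in> refined E U xs j \<and> (xs ! j, v) \<in> E)"
        if v: "v < N" "s' ''v'' 0 = v" and a: "agree {''f'', ''v'', ''cand''} s2 s'"
          and c: "s' ''cand'' v = s2 ''cand'' v" for v s'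
      proof -
        have g': "graph_in N E r s'" by (rule graph_in_agree[OF g2 a]) auto
        have "s' ''result'' j = xs ! j" "s' ''j'' 0 = j" using agreeD[OF a] xj j2 by auto
        then show ?thesis
          using v c xj j i(2) R word_bounds[OF W] holds_adj[OF g', of W "Cell ''result'' (Var ''j'')" "Var ''v''"]
          by (intro holds_Mul holds_Cell) auto
      qed
      let ?Q = "\<lambda>v. v \<in> refined E U xs j \<and> (xs ! j, v) \<in> E"
      have "run W ?p s2 ((50 * (N + 1)) + (6 + 50 * (N + 1))) (?R (Suc j))"
      proof (rule run_Seq[where R = "\<lambda>s'. s' ''f'' 0 = first N ?Q"])
        show "run W (Find ''f'' ''v'' ?e) s2 (50 * (N + 1)) (\<lambda>s'. s' ''f'' 0 = first N ?Q)"
        proof (rule run_weaken[OF run_Find[where s = s2 and N = N, OF n2 word_bounds(2,3)[OF W]]])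
          fix v s' assume v: "v < N" "s' ''v'' 0 = v" and a: "agree {''f'', ''v''} s2 s'"
          have "holds W s' ?e (?Q v)"
            using agreeD[OF a, of "''cand''"] by (intro e v agree_mono[OF a]) auto
          then show "fits W s' ?e \<and> (val s' ?e \<noteq> 0 \<longleftrightarrow> ?Q v)" unfolding holds_def by auto
        qed (auto simp: algebra_simps)
        fix s3 assume f3: "s3 ''f'' 0 = first N ?Q" and "agree (writes (Find ''f'' ''v'' ?e)) s2 s3"
        then have ag3: "agree {''f'', ''v''} s2 s3" by simp
        have n3: "s3 ''n'' 0 = N" and c3: "s3 ''cand'' = s2 ''cand''" using agreeD[OF ag3] n2 by auto
        \<comment> \<open>This is the case distinction in \<open>refined\<close>: without a hit, the
          candidates stay as they are.\<close>
        have ex: "first N ?Q < N \<longleftrightarrow> (\<exists>v \<in> refined E U xs j. (xs ! j, v) \<in> E)"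
          unfolding first_less_iff using refined_subset[of E U xs j] U by blast
        have ft: "fits W s3 (Bin Less (Var ''f'') (Var ''n''))"
          using f3 n3 first_le[of N ?Q] word_bounds[OF W] by simp
        have "run W (Cond (Bin Less (Var ''f'') (Var ''n'')) (Fill ''cand'' ''v'' ?e) Skip) s3
          (1 + cost (Bin Less (Var ''f'') (Var ''n'')) + 50 * (N + 1)) (?R (Suc j))"
        proof (rule run_Cond[OF ft])
          assume "val s3 (Bin Less (Var ''f'') (Var ''n'')) \<noteq> 0"
          then have ex': "\<exists>v \<in> refined E U xs j. (xs ! j, v) \<in> E" using f3 n3 ex by (auto split: if_splits)
          show "run W (Fill ''cand'' ''v'' ?e) s3 (50 * (N + 1)) (?R (Suc j))"
          proof (rule run_weaken[OF run_Fill[where F = "\<lambda>v. of_bool (?Q v)" and s = s3 and N = N, OF n3 word_bounds(2,3)[OF W]]])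
            fix v s' assume v: "v < N" "s' ''v'' 0 = v" and a: "agree {''cand'', ''v''} s3 s'"
              and c: "s' ''cand'' v = s3 ''cand'' v"
            have "agree {''f'', ''v'', ''cand''} s2 s'" using a ag3 by (auto simp: agree_def)
            with e[OF v this] c c3 show "fits W s' ?e \<and> val s' ?e = of_bool (?Q v)"
              by (simp add: holds_def)
          next
            fix s' assume "\<forall>v<N. s' ''cand'' v = of_bool (?Q v)"
            with ex' show "?R (Suc j) s'" by simp
          qed (auto simp: algebra_simps)
        next
          assume "val s3 (Bin Less (Var ''f'') (Var ''n'')) = 0"
          then have "\<not> (\<exists>v \<in> refined E U xs j. (xs ! j, v) \<in> E)" using f3 n3 ex by auto
          then show "run W Skip s3 (50 * (N + 1)) (?R (Suc j))"
            using R c3 by (intro run_Skip) auto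
        qed
        then show "run W (Cond (Bin Less (Var ''f'') (Var ''n'')) (Fill ''cand'' ''v'' ?e) Skip) s3
          (6 + 50 * (N + 1)) (?R (Suc j))" by simp
      qed
      then show "run W ?p s2 (120 * (N + 1)) (?R (Suc j))" by (rule run_weaken) auto
    qed (use R0 i word_bounds[OF W] in auto)
    moreover have "9 + length xs * (120 * (N + 1) + 12) \<le> 200 * (N + 1)\<^sup>2"
    proof -
      have "length xs * (120 * (N + 1) + 12) \<le> N * (120 * (N + 1) + 12)"
        using i(2) by (intro mult_le_mono) auto
      moreover have "9 + N * (120 * (N + 1) + 12) \<le> 200 * (N + 1)\<^sup>2"
        by (simp add: power2_eq_square algebra_simps)
      ultimately show ?thesis by linarith
    qed
    ultimately show ?thesis by (elim run_weaken) auto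
  qed
  then have "run W Candidates s (60 * (N + 1) + 200 * (N + 1)\<^sup>2) (?R (length xs))"
    unfolding Candidates_def by (intro run_Seq[OF init]) auto
  then show ?thesis
  proof (rule run_weaken)
    show "60 * (N + 1) + 200 * (N + 1)\<^sup>2 \<le> 300 * (N + 1)\<^sup>2"
      by (simp add: power2_eq_square algebra_simps)
  qed (use lex_max_refined[of r "{..<N}" E xs] r in \<open>simp add: U_def\<close>)
qed

lemma run_Blocking:
  assumes g: "graph_in N E r s" and cs: "constraints_in N P C D s" and P: "P \<subseteq> {..<N} \<times> {..<N}"
    and xs: "set xs \<subseteq> {..<N}" and vis: "\<And>v. v < N \<Longrightarrow> s ''vis'' v = of_bool (v \<in> set xs)"
    and cand: "\<And>v. v < N \<Longrightarrow> s ''cand'' v = of_bool (B v)"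
  shows "run W Blocking s (50 * (N + 1)\<^sup>2 + card P * (300 * (N + 1)))
    (\<lambda>s'. \<forall>v<N. s' ''cand'' v = of_bool (B v \<and> \<not> blocked E P C D xs v))"
proof -
  let ?I = "\<lambda>S s'. \<forall>v<N. s' ''cand'' v = of_bool (B v \<and> \<not> blocked E (P \<inter> S) C D xs v)"
  let ?C = "At ''cx'' (Var ''x'') (Var ''y'')" and ?D = "At ''cy'' (Var ''x'') (Var ''y'')"
  let ?e1 = "Bin Mul (Cell ''vis'' (Var ''v''))
    (Bin Mul (At ''adj'' ?C (Var ''v'')) (Neg (At ''adj'' ?D (Var ''v''))))"
  let ?e2 = "Bin Mul (Cell ''cand'' (Var ''v'')) (Bin Mul
    (Neg (Bin Mul (Bin Equal (Var ''y'') (Var ''v'')) (Bin Mul (Neg (Bin Equal (Var ''x'') (Var ''v'')))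
      (Neg (Cell ''vis'' (Var ''x''))))))
    (Neg (Bin Mul (Bin Mul (At ''adj'' ?D (Var ''v'')) (Neg (At ''adj'' ?C (Var ''v''))))
      (Neg (Bin Less (Var ''f'') (Var ''n''))))))"
  let ?q = "Seq (Find ''f'' ''v'' ?e1) (Fill ''cand'' ''v'' ?e2)"
  let ?p = "Cond (At ''on'' (Var ''x'') (Var ''y'')) ?q Skip"
  have n: "s ''n'' 0 = N" using g by (simp add: graph_in_def)
  have "run W (Pairs ''x'' ''y'' ?p) s ((11 + 30) * (N + 1)\<^sup>2 + card P * (300 * (N + 1)))
    (?I ({..<N} \<times> {..<N}))"
  proof (rule run_Pairs[where I = ?I and s = s and N = N, OF n word_bounds(2,3)[OF W]])
    fix S a b s1
    assume ab: "a < N" "b < N" and I: "?I S s1" and xy: "s1 ''x'' 0 = a" "s1 ''y'' 0 = b"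
      and "agree ({''x'', ''y''} \<union> writes ?p) s s1"
    then have ag1: "agree {''x'', ''y'', ''f'', ''v'', ''cand''} s s1" by (simp add: insert_commute)
    have g1: "graph_in N E r s1" by (rule graph_in_agree[OF g ag1]) auto
    then have n1: "s1 ''n'' 0 = N" by (simp add: graph_in_def)
    have cs1: "constraints_in N P C D s1" by (rule constraints_in_agree[OF cs ag1]) auto
    have vis1: "s1 ''vis'' v = of_bool (v \<in> set xs)" if "v < N" for v
      using agreeD[OF ag1] vis[OF that] by simp
    have CD: "C a b < N" "D a b < N" using cs1 ab by (auto simp: constraints_in_def)
    have ft: "fits W s1 (At ''on'' (Var ''x'') (Var ''y''))"
      using cs1 ab xy n1 word_bounds[OF W] by (intro fits_At[where N = N]) (auto simp: constraints_in_def)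
    have on: "val s1 (At ''on'' (Var ''x'') (Var ''y'')) = of_bool ((a, b) \<in> P)"
      using cs1 ab xy n1 by (auto simp: constraints_in_def)
    have basic: "holds W s' (At ''adj'' ?C (Var ''v'')) ((C a b, v) \<in> E)"
      "holds W s' (At ''adj'' ?D (Var ''v'')) ((D a b, v) \<in> E)"
      "holds W s' (Cell ''vis'' (Var ''v'')) (v \<in> set xs)"
      "holds W s' (Cell ''vis'' (Var ''x'')) (a \<in> set xs)"
      "s' ''x'' 0 = a" "s' ''y'' 0 = b" "s' ''n'' 0 = N"
      if v: "v < N" "s' ''v'' 0 = v" and a: "agree {''f'', ''v'', ''cand''} s1 s'" for v s'
    proof -
      show xy': "s' ''x'' 0 = a" "s' ''y'' 0 = b" "s' ''n'' 0 = N" using agreeD[OF a] xy n1 by auto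
      have g': "graph_in N E r s'" by (rule graph_in_agree[OF g1 a]) auto
      have "constraints_in N P C D s'" by (rule constraints_in_agree[OF cs1 a]) auto
      then have c': "s' ''cx'' (a * N + b) = C a b" "s' ''cy'' (a * N + b) = D a b"
        using ab by (auto simp: constraints_in_def)
      have "fits W s' ?C" "fits W s' ?D"
        using ab xy' c' CD word_bounds[OF W] by (auto intro!: fits_At[where N = N])
      then show "holds W s' (At ''adj'' ?C (Var ''v'')) ((C a b, v) \<in> E)"
        "holds W s' (At ''adj'' ?D (Var ''v'')) ((D a b, v) \<in> E)"
        using holds_adj[OF g', of W ?C "Var ''v''"] holds_adj[OF g', of W ?D "Var ''v''"]
          v xy' c' CD word_bounds[OF W] by auto
      show "holds W s' (Cell ''vis'' (Var ''v'')) (v \<in> set xs)"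
        "holds W s' (Cell ''vis'' (Var ''x'')) (a \<in> set xs)"
        using v xy' vis1 ab agreeD[OF a, of "''vis''"] word_bounds[OF W] by (auto intro!: holds_Cell)
    qed
    let ?X = "\<exists>u \<in> set xs. (C a b, u) \<in> E \<and> (D a b, u) \<notin> E"
    let ?blk = "\<lambda>v. (b = v \<and> a \<noteq> v \<and> a \<notin> set xs) \<or> ((D a b, v) \<in> E \<and> (C a b, v) \<notin> E \<and> \<not> ?X)"
    \<comment> \<open>Blocking is a disjunction over the pairs, so each pair can be filtered out
      independently.\<close>
    have step: "blocked E (P \<inter> insert (a, b) S) C D xs v \<longleftrightarrow>
      blocked E (P \<inter> S) C D xs v \<or> ((a, b) \<in> P \<and> ?blk v)" for v
      unfolding blocked_def by blast
    show "run W ?p s1 (11 + (if (a, b) \<in> P then 300 * (N + 1) else 0)) (?I (insert (a, b) S))"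
    proof (cases "(a, b) \<in> P")
      case False
      have "run W ?p s1 (1 + cost (At ''on'' (Var ''x'') (Var ''y'')) + 1) (?I (insert (a, b) S))"
        by (rule run_Cond[OF ft]) (use on False I step in \<open>auto intro: run_Skip\<close>)
      then show ?thesis using False by simp
    next
      case True
      let ?Q = "\<lambda>v. v \<in> set xs \<and> (C a b, v) \<in> E \<and> (D a b, v) \<notin> E"
      have "run W ?q s1 (100 * (N + 1) + 180 * (N + 1)) (?I (insert (a, b) S))"
      proof (rule run_Seq[where R = "\<lambda>s'. s' ''f'' 0 = first N ?Q"])
        show "run W (Find ''f'' ''v'' ?e1) s1 (100 * (N + 1)) (\<lambda>s'. s' ''f'' 0 = first N ?Q)"
        proof (rule run_weaken[OF run_Find[where s = s1 and N = N, OF n1 word_bounds(2,3)[OF W]]])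
          fix v s' assume v: "v < N" "s' ''v'' 0 = v" and a: "agree {''f'', ''v''} s1 s'"
          have a': "agree {''f'', ''v'', ''cand''} s1 s'" by (rule agree_mono[OF a]) auto
          have "holds W s' ?e1 (?Q v)"
            by (intro holds_Mul holds_Neg basic[OF v a'] word_bounds(3)[OF W])
          then show "fits W s' ?e1 \<and> (val s' ?e1 \<noteq> 0 \<longleftrightarrow> ?Q v)" unfolding holds_def by auto
        qed (auto simp: algebra_simps)
        fix s2 assume f2: "s2 ''f'' 0 = first N ?Q" and "agree (writes (Find ''f'' ''v'' ?e1)) s1 s2"
        then have ag2: "agree {''f'', ''v''} s1 s2" by simp
        have n2: "s2 ''n'' 0 = N" and c2: "s2 ''cand'' = s1 ''cand''" using agreeD[OF ag2] n1 by auto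
        have X: "first N ?Q < N \<longleftrightarrow> ?X" unfolding first_less_iff using xs by blast
        let ?F = "\<lambda>v. (B v \<and> \<not> blocked E (P \<inter> S) C D xs v) \<and> \<not> (b = v \<and> \<not> a = v \<and> a \<notin> set xs) \<and>
          \<not> (((D a b, v) \<in> E \<and> (C a b, v) \<notin> E) \<and> \<not> first N ?Q < N)"
        show "run W (Fill ''cand'' ''v'' ?e2) s2 (180 * (N + 1)) (?I (insert (a, b) S))"
        proof (rule run_weaken[OF run_Fill[where F = "\<lambda>v. of_bool (?F v)" and s = s2 and N = N, OF n2 word_bounds(2,3)[OF W]]])
          fix v s' assume v: "v < N" "s' ''v'' 0 = v" and a: "agree {''cand'', ''v''} s2 s'"
            and c: "s' ''cand'' v = s2 ''cand'' v"
          have a': "agree {''f'', ''v'', ''cand''} s1 s'" using a ag2 by (auto simp: agree_def)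
          note bs = basic[OF v a']
          have f': "s' ''f'' 0 = first N ?Q" using agreeD[OF a] f2 by simp
          have "holds W s' (Cell ''cand'' (Var ''v'')) (B v \<and> \<not> blocked E (P \<inter> S) C D xs v)"
            using v c c2 I word_bounds[OF W] by (intro holds_Cell) auto
          moreover have "holds W s' (Bin Less (Var ''f'') (Var ''n'')) (first N ?Q < N)"
            using holds_Less[of W s' "Var ''f''" "Var ''n''"] f' bs(7) word_bounds[OF W] first_le[of N ?Q] by auto
          moreover have "holds W s' (Bin Equal (Var ''y'') (Var ''v'')) (b = v)"
            using holds_Equal[of W s' "Var ''y''" "Var ''v''"] bs(6) v ab word_bounds[OF W] by auto
          moreover have "holds W s' (Bin Equal (Var ''x'') (Var ''v'')) (a = v)"
            using holds_Equal[of W s' "Var ''x''" "Var ''v''"] bs(5) v ab word_bounds[OF W] by auto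
          ultimately have "holds W s' ?e2 (?F v)"
            by (intro holds_Mul holds_Neg bs word_bounds(3)[OF W])
          then show "fits W s' ?e2 \<and> val s' ?e2 = of_bool (?F v)" unfolding holds_def .
        next
          fix s' assume F: "\<forall>v<N. s' ''cand'' v = of_bool (?F v)"
          have "?F v \<longleftrightarrow> B v \<and> \<not> blocked E (P \<inter> insert (a, b) S) C D xs v" for v
            unfolding step X using True by blast
          with F show "?I (insert (a, b) S) s'" by simp
        qed (auto simp: algebra_simps)
      qed
      then have "run W ?q s1 (280 * (N + 1)) (?I (insert (a, b) S))" by simp
      then have "run W ?p s1 (1 + cost (At ''on'' (Var ''x'') (Var ''y'')) + 280 * (N + 1)) (?I (insert (a, b) S))"
        by (intro run_Cond[OF ft]) (use on True in auto)
      then show ?thesis by (rule run_weaken) (use True in auto)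
    qed
  qed (use cand P in \<open>auto simp: blocked_def\<close>)
  then show ?thesis unfolding Blocking_def
  proof (rule run_weaken)
    fix s' assume "?I ({..<N} \<times> {..<N}) s'"
    moreover have "P \<inter> {..<N} \<times> {..<N} = P" using P by blast
    ultimately show "\<forall>v<N. s' ''cand'' v = of_bool (B v \<and> \<not> blocked E P C D xs v)" by simp
  qed simp
qed

lemma run_Select:
  assumes n: "s ''n'' 0 = N" and i: "s ''i'' 0 < N" and cand: "\<And>v. v < N \<Longrightarrow> s ''cand'' v = of_bool (B v)"
    and fail: "s ''fail'' 0 = 0"
  shows "run W Select s (60 * (N + 1)) (\<lambda>s'.
    (s' ''fail'' 0 = 0 \<and> (\<exists>v<N. B v \<and> s' ''result'' = (s ''result'')(s ''i'' 0 := v) \<and>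
       s' ''vis'' = (s ''vis'')(v := 1))) \<or>
    (s' ''fail'' 0 = 1 \<and> (\<forall>v<N. \<not> B v)))" (is "run W Select s _ ?Q")
proof -
  have "run W Select s ((3 + 30) * (N + 1) + (6 + 20)) ?Q"
    unfolding Select_def
  proof (rule run_Seq[where R = "\<lambda>s'. s' ''f'' 0 = first N B"])
    show "run W (Find ''f'' ''v'' (Cell ''cand'' (Var ''v''))) s ((3 + 30) * (N + 1)) (\<lambda>s'. s' ''f'' 0 = first N B)"
    proof (rule run_weaken[OF run_Find[where s = s and N = N, OF n word_bounds(2,3)[OF W]]])
      fix v s' assume v: "v < N" "s' ''v'' 0 = v" and a: "agree {''f'', ''v''} s s'"
      have "s' ''cand'' v = of_bool (B v)" using agreeD[OF a] cand[OF v(1)] by simp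
      then show "fits W s' (Cell ''cand'' (Var ''v'')) \<and> (val s' (Cell ''cand'' (Var ''v'')) \<noteq> 0 \<longleftrightarrow> B v)"
        using v word_bounds[OF W] by auto
    qed auto
    fix s1 assume f: "s1 ''f'' 0 = first N B" and "agree (writes (Find ''f'' ''v'' (Cell ''cand'' (Var ''v'')))) s s1"
    then have ag: "agree {''f'', ''v''} s s1" by simp
    have n1: "s1 ''n'' 0 = N" "s1 ''i'' 0 = s ''i'' 0" "s1 ''fail'' 0 = 0"
      "s1 ''result'' = s ''result''" "s1 ''vis'' = s ''vis''"
      using agreeD[OF ag] n fail by auto
    let ?b = "Bin Less (Var ''f'') (Var ''n'')"
    let ?q = "Seq (Assign ''result'' (Var ''i'') (Var ''f'')) (Assign ''vis'' (Var ''f'') (Const 1))"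
    let ?z = "Assign ''fail'' (Const 0) (Const 1)"
    have "run W (Cond ?b ?q ?z) s1 (1 + cost ?b + (10 + 10)) ?Q"
    proof (rule run_Cond)
      show "fits W s1 ?b" using f n1 first_le[of N B] word_bounds[OF W] by simp
    next
      assume "val s1 ?b \<noteq> 0"
      then have less: "first N B < N" using f n1 by (auto split: if_splits)
      then have B: "B (first N B)" by (rule first_holds)
      show "run W ?q s1 (10 + 10) ?Q"
      proof (rule run_Seq[where R = "\<lambda>s'. s' = s1(''result'' := (s1 ''result'')(s ''i'' 0 := first N B))"])
        fix s2 assume s2: "s2 = s1(''result'' := (s1 ''result'')(s ''i'' 0 := first N B))"
        show "run W (Assign ''vis'' (Var ''f'') (Const 1)) s2 10 ?Q"
          by (rule run_Assign) (use s2 f n1 less B word_bounds[OF W] in auto)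
      qed (rule run_Assign, use f n1 less i word_bounds[OF W] in auto)
    next
      assume "val s1 ?b = 0"
      then have "\<not> (\<exists>v<N. B v)" using f n1 first_less_iff[of N B] by auto
      then show "run W ?z s1 (10 + 10) ?Q" by (intro run_Assign) (use word_bounds[OF W] in auto)
    qed
    then show "run W (Cond ?b ?q ?z) s1 (6 + 20) ?Q" by simp
  qed
  then show ?thesis by (rule run_weaken) auto
qed

lemma run_Search:
  assumes g: "graph_in N E r s" and cs: "constraints_in N P C D s" and P: "P \<subseteq> {..<N} \<times> {..<N}"
  shows "run W Search s (600 * (N + 1) ^ 3 + 300 * card P * (N + 1)\<^sup>2) (search_result N E r P C D)"
proof -
  let ?V = "{..<N}"
  let ?good = "\<lambda>i s'. s' ''fail'' 0 = 0 \<and> constrained_prefix E ?V r P C D (map (s' ''result'') [0..<i]) \<and>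
    (\<forall>v<N. s' ''vis'' v = of_bool (v \<in> s' ''result'' ` {..<i}))"
  \<comment> \<open>The witness \<open>xs\<close> does not refer to the memory, so failure persists
    through the remaining rounds, which are skipped.\<close>
  let ?bad = "\<lambda>s'. s' ''fail'' 0 = 1 \<and> (\<exists>xs. constrained_prefix E ?V r P C D xs \<and> length xs < N \<and>
        (\<forall>v. lex_max E ?V r xs v \<longrightarrow> blocked E P C D xs v))"
  let ?I = "\<lambda>i s'. ?good i s' \<or> ?bad s'"
  let ?t = "300 * (N + 1)\<^sup>2 + (50 * (N + 1)\<^sup>2 + card P * (300 * (N + 1)) + 60 * (N + 1))"
  let ?q = "Seq Candidates (Seq Blocking Select)"
  let ?p = "Cond (Var ''fail'') Skip ?q"
  have n: "s ''n'' 0 = N" using g by (simp add: graph_in_def)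
  have loop: "run W (For ''i'' ''n'' ?p) s0 (9 + (\<Sum>i<N. (?t + 3) + 12)) (?I N)"
    if a0: "agree {''fail'', ''vis'', ''v''} s s0" and f0: "s0 ''fail'' 0 = 0"
      and v0: "\<And>v. v < N \<Longrightarrow> s0 ''vis'' v = 0" for s0
  proof (rule run_For[where I = ?I and N = N])
    show "s0 ''n'' 0 = N" using agreeD[OF a0] n by simp
    show "?I 0 s0" using f0 v0 by simp
    fix i s1 assume i: "i < N" "s1 ''i'' 0 = i" and I: "?I i s1"
      and "agree (insert ''i'' (writes ?p)) s0 s1"
    then have a1: "agree {''fail'', ''vis'', ''v'', ''i'', ''cand'', ''j'', ''f'', ''x'', ''y'', ''result''} s s1"
      using a0 by (auto simp: agree_def)
    have g1: "graph_in N E r s1" by (rule graph_in_agree[OF g a1]) auto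
    have cs1: "constraints_in N P C D s1" by (rule constraints_in_agree[OF cs a1]) auto
    have f1: "s1 ''fail'' 0 \<le> 1" using I by auto
    have "run W ?p s1 (1 + cost (Var ''fail'') + ?t) (?I (Suc i))"
    proof (rule run_Cond)
      show "fits W s1 (Var ''fail'')" using f1 word_bounds[OF W] by simp
    next
      assume "val s1 (Var ''fail'') \<noteq> 0"
      with I have "?bad s1" by auto
      then show "run W Skip s1 ?t (?I (Suc i))" by (intro run_Skip) auto
    next
      assume "val s1 (Var ''fail'') = 0"
      with I have fail: "s1 ''fail'' 0 = 0" and
        cp: "constrained_prefix E ?V r P C D (map (s1 ''result'') [0..<i])" and
        vis: "\<And>v. v < N \<Longrightarrow> s1 ''vis'' v = of_bool (v \<in> s1 ''result'' ` {..<i})" by auto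
      define xs where "xs = map (s1 ''result'') [0..<i]"
      have len: "length xs = i" and set_xs: "set xs = s1 ''result'' ` {..<i}"
        by (auto simp: xs_def)
      have sub: "set xs \<subseteq> ?V"
        using search_prefix_distinct[of E ?V r xs] cp unfolding xs_def constrained_prefix_def by simp
      let ?B = "\<lambda>v. lex_max E ?V r xs v \<and> \<not> blocked E P C D xs v"
      show "run W ?q s1 ?t (?I (Suc i))"
      proof (rule run_Seq[OF run_Candidates[where xs = xs, OF g1]])
        show "s1 ''i'' 0 = length xs" "length xs < N" "set xs \<subseteq> ?V" using i len sub by auto
        show "s1 ''result'' j = xs ! j" if "j < length xs" for j using that by (simp add: xs_def)
        show "s1 ''vis'' v = of_bool (v \<in> set xs)" if "v < N" for v using vis[OF that] set_xs by simp
        fix s2 assume c2: "\<forall>v<N. s2 ''cand'' v = of_bool (lex_max E ?V r xs v)"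
          and "agree (writes Candidates) s1 s2"
        then have a2: "agree {''cand'', ''v'', ''j'', ''f''} s1 s2" by simp
        have g2: "graph_in N E r s2" by (rule graph_in_agree[OF g1 a2]) auto
        have cs2: "constraints_in N P C D s2" by (rule constraints_in_agree[OF cs1 a2]) auto
        show "run W (Seq Blocking Select) s2
          (50 * (N + 1)\<^sup>2 + card P * (300 * (N + 1)) + 60 * (N + 1)) (?I (Suc i))"
        proof (rule run_Seq[OF run_Blocking[where xs = xs and B = "lex_max E ?V r xs", OF g2 cs2 P sub]])
          show "s2 ''vis'' v = of_bool (v \<in> set xs)" if "v < N" for v
            using vis[OF that] set_xs agreeD[OF a2] by simp
          show "s2 ''cand'' v = of_bool (lex_max E ?V r xs v)" if "v < N" for v using c2 that by simp
          fix s3 assume c3: "\<forall>v<N. s3 ''cand'' v = of_bool (?B v)" and "agree (writes Blocking) s2 s3"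
          then have a3: "agree {''cand'', ''v'', ''j'', ''f'', ''x'', ''y''} s1 s3"
            using a2 by (auto simp: agree_def)
          have g3: "graph_in N E r s3" by (rule graph_in_agree[OF g1 a3]) auto
          show "run W Select s3 (60 * (N + 1)) (?I (Suc i))"
          proof (rule run_weaken[OF run_Select[where B = ?B]])
            show "s3 ''n'' 0 = N" using g3 by (simp add: graph_in_def)
            show "s3 ''i'' 0 < N" "s3 ''fail'' 0 = 0" using agreeD[OF a3] i fail by auto
            show "s3 ''cand'' v = of_bool (?B v)" if "v < N" for v using c3 that by blast
            fix s4 assume "(s4 ''fail'' 0 = 0 \<and> (\<exists>v<N. ?B v \<and> s4 ''result'' = (s3 ''result'')(s3 ''i'' 0 := v) \<and>
                s4 ''vis'' = (s3 ''vis'')(v := 1))) \<or> (s4 ''fail'' 0 = 1 \<and> (\<forall>v<N. \<not> ?B v))"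
            then show "?I (Suc i) s4"
            proof
              assume "s4 ''fail'' 0 = 0 \<and> (\<exists>v<N. ?B v \<and> s4 ''result'' = (s3 ''result'')(s3 ''i'' 0 := v) \<and>
                s4 ''vis'' = (s3 ''vis'')(v := 1))"
              then obtain v where v: "s4 ''fail'' 0 = 0" "v < N" "?B v"
                "s4 ''result'' = (s1 ''result'')(i := v)" "s4 ''vis'' = (s1 ''vis'')(v := 1)"
                using agreeD[OF a3] i by auto
              have map: "map (s4 ''result'') [0..<Suc i] = xs @ [v]"
                using v(4) by (auto simp: xs_def)
              have "constrained_prefix E ?V r P C D (map (s4 ''result'') [0..<Suc i])"
                unfolding map constrained_prefix_snoc using cp[folded xs_def] v(3) by simp
              moreover have "s4 ''vis'' u = of_bool (u \<in> s4 ''result'' ` {..<Suc i})" if "u < N" for u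
              proof -
                have "s4 ''result'' ` {..<Suc i} = insert v (s1 ''result'' ` {..<i})"
                  using v(4) by (auto simp: lessThan_Suc)
                then show ?thesis using vis[OF that] v(5) by simp
              qed
              ultimately show ?thesis using v(1) by blast
            next
              assume bad: "s4 ''fail'' 0 = 1 \<and> (\<forall>v<N. \<not> ?B v)"
              have "\<forall>v. lex_max E ?V r xs v \<longrightarrow> blocked E P C D xs v"
                using bad lex_max_def[of E ?V r xs] by blast
              then show ?thesis using bad cp len i unfolding xs_def[symmetric] by blast
            qed
          qed simp
        qed
      qed
    qed
    then show "run W ?p s1 (?t + 3) (?I (Suc i))" by (rule run_weaken) auto
  qed (use word_bounds[OF W] in auto)
  have "run W Search s (3 + (31 * (N + 1) + (9 + (\<Sum>i<N. (?t + 3) + 12)))) (?I N)"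
    unfolding Search_def
  proof (rule run_Seq[where R = "\<lambda>s'. s' = s(''fail'' := (s ''fail'')(0 := 0))"])
    show "run W (Assign ''fail'' (Const 0) (Const 0)) s 3 (\<lambda>s'. s' = s(''fail'' := (s ''fail'')(0 := 0)))"
      by (rule run_Assign) auto
    fix s1 assume s1: "s1 = s(''fail'' := (s ''fail'')(0 := 0))"
    then have n1: "s1 ''n'' 0 = N" using n by simp
    show "run W (Seq (Fill ''vis'' ''v'' (Const 0)) (For ''i'' ''n'' ?p)) s1
      (31 * (N + 1) + (9 + (\<Sum>i<N. (?t + 3) + 12))) (?I N)"
    proof (rule run_Seq[where R = "\<lambda>s'. \<forall>v<N. s' ''vis'' v = 0"])
      show "run W (Fill ''vis'' ''v'' (Const 0)) s1 (31 * (N + 1)) (\<lambda>s'. \<forall>v<N. s' ''vis'' v = 0)"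
        by (rule run_weaken[OF run_Fill[where F = "\<lambda>_. 0" and s = s1 and N = N, OF n1 word_bounds(2,3)[OF W]]]) auto
      fix s2 assume v2: "\<forall>v<N. s2 ''vis'' v = 0" and a2: "agree (writes (Fill ''vis'' ''v'' (Const 0))) s1 s2"
      show "run W (For ''i'' ''n'' ?p) s2 (9 + (\<Sum>i<N. (?t + 3) + 12)) (?I N)"
        by (rule loop) (use s1 v2 a2 in \<open>auto simp: agree_def\<close>)
    qed
  qed
  then show ?thesis
  proof (rule run_weaken)
    have "(\<Sum>i<N. (?t + 3) + 12) = N * (?t + 15)" by simp
    moreover have "3 + (31 * (N + 1) + (9 + N * (?t + 15))) \<le> 600 * (N + 1) ^ 3 + 300 * card P * (N + 1)\<^sup>2"
      by (simp add: power2_eq_square power3_eq_cube algebra_simps)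
    ultimately show "3 + (31 * (N + 1) + (9 + (\<Sum>i<N. (?t + 3) + 12))) \<le>
      600 * (N + 1) ^ 3 + 300 * card P * (N + 1)\<^sup>2" by linarith
  qed (auto simp: search_result_def)
qed

end


section \<open>Computing the replacement constraints\<close>

text \<open>\<open>v\<close> and \<open>a\<close> are positions in \<open>tau\<close>. By
  \<open>lower_index\<close>, a smaller position together with adjacency characterises
  \<open>lower\<close>, so depths are never computed.\<close>

definition Back :: "vname \<Rightarrow> expr" where
  "Back a = Bin Mul (Bin Less (Var ''v'') (Var a))
     (At ''adj'' (Cell ''tau'' (Var a)) (Cell ''tau'' (Var ''v'')))"

lemma cost_Back [simp]: "cost (Back a) = 17"
  by (simp add: Back_def)

text \<open>\<open>f\<close> and \<open>g\<close> are the positions of the first private lower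
  neighbours, and \<open>h\<close> that of a vertex separating their \<open>lower\<close> sets. The
  variables \<open>a\<close> and \<open>b\<close> hold positions, whereas \<open>cx\<close> and
  \<open>cy\<close> store vertices.\<close>

definition Step :: com where
  "Step = Seq (Find ''f'' ''v'' (Bin Mul (Back ''a'') (Neg (Back ''b''))))
    (Seq (Find ''g'' ''v'' (Bin Mul (Back ''b'') (Neg (Back ''a''))))
      (Cond (Bin Mul (Bin Less (Var ''f'') (Var ''n'')) (Bin Less (Var ''g'') (Var ''n'')))
        (Seq (Find ''h'' ''v'' (Neg (Bin Equal (Back ''f'') (Back ''g''))))
          (Cond (Bin Less (Var ''h'') (Var ''n''))
            (Seq (Assign ''a'' (Const 0) (Var ''f'')) (Assign ''b'' (Const 0) (Var ''g'')))
            (Seq (Assign ''cx'' (Bin Add (Bin Mul (Var ''x'') (Var ''n'')) (Var ''y'')) (Cell ''tau'' (Var ''a'')))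
              (Seq (Assign ''cy'' (Bin Add (Bin Mul (Var ''x'') (Var ''n'')) (Var ''y'')) (Cell ''tau'' (Var ''b'')))
                (Assign ''go'' (Const 0) (Const 0))))))
        (Assign ''go'' (Const 0) (Const 0))))"

lemma writes_Step [simp]:
  "writes Step = {''f'', ''g'', ''h'', ''v'', ''a'', ''b'', ''cx'', ''cy'', ''go''}"
  by (auto simp: Step_def)

definition Trace :: com where
  "Trace = Seq (Find ''a'' ''v'' (Bin Equal (Cell ''tau'' (Var ''v'')) (Var ''x'')))
    (Seq (Find ''b'' ''v'' (Bin Equal (Cell ''tau'' (Var ''v'')) (Var ''y'')))
      (Seq (Assign ''on'' (Bin Add (Bin Mul (Var ''x'') (Var ''n'')) (Var ''y'')) (Const 1))
        (Seq (Assign ''go'' (Const 0) (Const 1))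
          (For ''i'' ''n'' (Cond (Var ''go'') Step Skip)))))"

lemma writes_Trace [simp]:
  "writes Trace = {''f'', ''g'', ''h'', ''v'', ''a'', ''b'', ''cx'', ''cy'', ''go'', ''on'', ''i''}"
  by (auto simp: Trace_def)

definition Prepare :: com where
  "Prepare = Seq (Fill ''tau'' ''v'' (Cell ''result'' (Var ''v'')))
    (Pairs ''x'' ''y'' (Cond (At ''order'' (Var ''x'') (Var ''y'')) Trace Skip))"

lemma writes_Prepare [simp]: "writes Prepare =
    {''tau'', ''x'', ''y'', ''f'', ''g'', ''h'', ''v'', ''a'', ''b'', ''cx'', ''cy'', ''go'', ''on'', ''i''}"
  by (auto simp: Prepare_def)

definition tau_in :: "nat list \<Rightarrow> memory \<Rightarrow> bool" where
  "tau_in ts s \<longleftrightarrow> (\<forall>v < length ts. s ''tau'' v = ts ! v)"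

lemma tau_in_agree: "tau_in ts s \<Longrightarrow> agree X s s' \<Longrightarrow> ''tau'' \<notin> X \<Longrightarrow> tau_in ts s'"
  by (auto simp: tau_in_def agree_def)

section \<open>The replacements are computed in quadratic time per pair\<close>

context
  fixes N W :: nat and E :: "nat rel" and r :: nat and ts :: "nat list"
  assumes W: "N * N + N + 2 \<le> W" and rc: "rooted_chordal {..<N} E r"
    and ts: "search_prefix E {..<N} r ts" "length ts = N"
begin

interpretation rooted_chordal "{..<N}" E r by (rule rc)

lemma ts_order: "distinct ts" "set ts = {..<N}" "\<And>v. v < N \<Longrightarrow> ts ! v < N"
proof -
  have "distinct ts" "set ts \<subseteq> {..<N}" using search_prefix_distinct[OF ts(1)] by auto
  moreover have "card (set ts) = N" using calculation(1) ts(2) by (simp add: distinct_card)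
  ultimately show *: "distinct ts" "set ts = {..<N}" by (auto simp: card_subset_eq)
  show "ts ! v < N" if "v < N" for v using nth_mem[of v ts] that ts(2) * by auto
qed

text \<open>Adjacent vertices lie in different layers and the order \<open>ts\<close> respects the
  layers, so the earlier one is the lower neighbour.\<close>

lemma lower_index:
  assumes "a < N" "v < N"
  shows "ts ! v \<in> lower (ts ! a) \<longleftrightarrow> v < a \<and> (ts ! a, ts ! v) \<in> E"
proof
  assume "ts ! v \<in> lower (ts ! a)"
  then have l: "(ts ! v, ts ! a) \<in> E" "depth (ts ! v) < depth (ts ! a)" by (auto simp: lower_def)
  have "before ts (ts ! v) (ts ! a)"
    by (rule prefix_depth[OF ts(1) _ _ l(2)]) (use ts_order ts(2) assms in auto)
  then obtain i j where "i < j" "j < N" "ts ! i = ts ! v" "ts ! j = ts ! a"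
    using ts(2) by (auto simp: before_def)
  then have "v < a" using nth_eq_iff_index_eq[OF ts_order(1)] assms ts(2) by auto
  with l E_sym show "v < a \<and> (ts ! a, ts ! v) \<in> E" by blast
next
  assume *: "v < a \<and> (ts ! a, ts ! v) \<in> E"
  then have "before ts (ts ! v) (ts ! a)" unfolding before_def using assms ts(2) by blast
  from before_depth[OF ts(1) this] depth_edge_neq[of "ts ! a" "ts ! v"] * E_sym
  show "ts ! v \<in> lower (ts ! a)" by (auto simp: lower_def)
qed

lemma lower_subset_iff:
  "lower x \<subseteq> lower y \<longleftrightarrow> (\<forall>v<N. ts ! v \<in> lower x \<longrightarrow> ts ! v \<in> lower y)"
proof
  assume *: "\<forall>v<N. ts ! v \<in> lower x \<longrightarrow> ts ! v \<in> lower y"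
  show "lower x \<subseteq> lower y"
  proof
    fix u assume u: "u \<in> lower x"
    then have "u \<in> set ts" using lowerD ts_order(2) by blast
    with * u ts(2) show "u \<in> lower y" by (auto simp: in_set_conv_nth)
  qed
qed auto

lemma first_is_first:
  assumes "first N (\<lambda>v. ts ! v \<in> A) < N"
  shows "is_first ts A (ts ! first N (\<lambda>v. ts ! v \<in> A))"
proof -
  let ?f = "first N (\<lambda>v. ts ! v \<in> A)"
  have "\<not> before ts b (ts ! ?f)" if "b \<in> A" for b
  proof
    assume "before ts b (ts ! ?f)"
    then obtain i j where "i < j" "j < N" "ts ! i = b" "ts ! j = ts ! ?f"
      using ts(2) by (auto simp: before_def)
    then have "i < ?f" using nth_eq_iff_index_eq[OF ts_order(1)] assms ts(2) by auto
    with first_least[OF this] \<open>ts ! i = b\<close> that show False by simp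
  qed
  with first_holds[OF assms] assms ts(2) show ?thesis by (simp add: is_first_def)
qed

lemma holds_Back:
  assumes "graph_in N E r s" "tau_in ts s" "s a 0 < N" "s ''v'' 0 < N"
  shows "holds W s (Back a) (ts ! s ''v'' 0 \<in> lower (ts ! s a 0))"
proof -
  have t: "s ''tau'' (s a 0) = ts ! s a 0" "s ''tau'' (s ''v'' 0) = ts ! s ''v'' 0"
    using assms by (auto simp: tau_in_def ts(2))
  have "holds W s (At ''adj'' (Cell ''tau'' (Var a)) (Cell ''tau'' (Var ''v'')))
    ((ts ! s a 0, ts ! s ''v'' 0) \<in> E)"
    using holds_adj[OF assms(1), of W "Cell ''tau'' (Var a)" "Cell ''tau'' (Var ''v'')"]
      t assms ts_order(3) word_bounds[OF W] by auto
  moreover have "holds W s (Bin Less (Var ''v'') (Var a)) (s ''v'' 0 < s a 0)"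
    using holds_Less[of W s "Var ''v''" "Var a"] assms word_bounds[OF W] by auto
  ultimately show ?thesis
    unfolding Back_def lower_index[OF assms(3,4)] by (intro holds_Mul)
qed

lemma run_Step:
  assumes g: "graph_in N E r s" and tau: "tau_in ts s"
    and ab: "s ''a'' 0 = a" "a < N" "s ''b'' 0 = b" "b < N"
    and xy: "s ''x'' 0 = x" "x < N" "s ''y'' 0 = y" "y < N"
    and zero: "s ''cx'' (x * N + y) = 0" "s ''cy'' (x * N + y) = 0"
  shows "run W Step s (400 * (N + 1)) (\<lambda>s'.
    (s' ''go'' = s ''go'' \<and> s' ''cx'' = s ''cx'' \<and> s' ''cy'' = s ''cy'' \<and> s' ''a'' 0 < a \<and> s' ''b'' 0 < N \<and>
      (\<forall>c d. chain ts (ts ! s' ''a'' 0) (ts ! s' ''b'' 0) c d \<longrightarrow> chain ts (ts ! a) (ts ! b) c d)) \<or>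
    (s' ''go'' 0 = 0 \<and> (\<exists>c<N. \<exists>d<N. chain ts (ts ! a) (ts ! b) c d \<and>
      s' ''cx'' = (s ''cx'')(x * N + y := c) \<and> s' ''cy'' = (s ''cy'')(x * N + y := d))))"
    (is "run W Step s _ ?R")
proof -
  let ?A = "lower (ts ! a) - lower (ts ! b)" and ?B = "lower (ts ! b) - lower (ts ! a)"
  let ?f = "first N (\<lambda>v. ts ! v \<in> ?A)" and ?g = "first N (\<lambda>v. ts ! v \<in> ?B)"
  let ?ef = "Bin Mul (Back ''a'') (Neg (Back ''b''))" and ?eg = "Bin Mul (Back ''b'') (Neg (Back ''a''))"
  let ?eh = "Neg (Bin Equal (Back ''f'') (Back ''g''))"
  let ?idx = "Bin Add (Bin Mul (Var ''x'') (Var ''n'')) (Var ''y'')"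
  let ?both = "Bin Mul (Bin Less (Var ''f'') (Var ''n'')) (Bin Less (Var ''g'') (Var ''n''))"
  let ?down = "Seq (Assign ''a'' (Const 0) (Var ''f'')) (Assign ''b'' (Const 0) (Var ''g''))"
  let ?stop = "Assign ''go'' (Const 0) (Const 0)"
  let ?store = "Seq (Assign ''cx'' ?idx (Cell ''tau'' (Var ''a''))) (Seq (Assign ''cy'' ?idx (Cell ''tau'' (Var ''b''))) ?stop)"
  let ?inner = "Seq (Find ''h'' ''v'' ?eh) (Cond (Bin Less (Var ''h'') (Var ''n'')) ?down ?store)"
  have n: "s ''n'' 0 = N" using g by (simp add: graph_in_def)
  have idx: "x * N + y < N * N" by (rule pair_index_less[OF xy(2,4)])
  have xN: "x * N \<le> W" "x * N + y \<le> W" using idx word_bounds[OF W] by auto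
  have xa: "ts ! a < N" "ts ! b < N" using ts_order(3) ab by auto
  have bck: "holds W s' (Back ''a'') (ts ! v \<in> lower (ts ! a))" "holds W s' (Back ''b'') (ts ! v \<in> lower (ts ! b))"
    if v: "v < N" "s' ''v'' 0 = v" and ag: "agree {''f'', ''g'', ''v''} s s'" for v s'
  proof -
    have "graph_in N E r s'" "tau_in ts s'" by (rule graph_in_agree[OF g ag] tau_in_agree[OF tau ag]; simp)+
    moreover have "s' ''a'' 0 = a" "s' ''b'' 0 = b" using agreeD[OF ag] ab by auto
    ultimately show "holds W s' (Back ''a'') (ts ! v \<in> lower (ts ! a))"
      "holds W s' (Back ''b'') (ts ! v \<in> lower (ts ! b))"
      using holds_Back[of s' "''a''"] holds_Back[of s' "''b''"] v ab by auto
  qed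
  have "run W Step s (70 * (N + 1) + (70 * (N + 1) + (14 + (80 * (N + 1) + (6 + 50))))) ?R"
    unfolding Step_def
  proof (rule run_Seq[where R = "\<lambda>s'. s' ''f'' 0 = ?f"])
    show "run W (Find ''f'' ''v'' ?ef) s (70 * (N + 1)) (\<lambda>s'. s' ''f'' 0 = ?f)"
    proof (rule run_weaken[OF run_Find[where s = s and N = N, OF n word_bounds(2,3)[OF W]]])
      fix v s' assume v: "v < N" "s' ''v'' 0 = v" and a: "agree {''f'', ''v''} s s'"
      have a': "agree {''f'', ''g'', ''v''} s s'" by (rule agree_mono[OF a]) auto
      have "holds W s' ?ef (ts ! v \<in> lower (ts ! a) \<and> ts ! v \<notin> lower (ts ! b))"
        by (intro holds_Mul holds_Neg bck[OF v a'] word_bounds(3)[OF W])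
      then show "fits W s' ?ef \<and> (val s' ?ef \<noteq> 0 \<longleftrightarrow> ts ! v \<in> ?A)" unfolding holds_def by auto
    qed (auto simp: algebra_simps)
    fix s1 assume f1: "s1 ''f'' 0 = ?f" and "agree (writes (Find ''f'' ''v'' ?ef)) s s1"
    then have a1: "agree {''f'', ''v''} s s1" by simp
    have n1: "s1 ''n'' 0 = N" using agreeD[OF a1] n by simp
    show "run W (Seq (Find ''g'' ''v'' ?eg) (Cond ?both ?inner ?stop)) s1
      (70 * (N + 1) + (14 + (80 * (N + 1) + (6 + 50)))) ?R"
    proof (rule run_Seq[where R = "\<lambda>s'. s' ''g'' 0 = ?g"])
      show "run W (Find ''g'' ''v'' ?eg) s1 (70 * (N + 1)) (\<lambda>s'. s' ''g'' 0 = ?g)"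
      proof (rule run_weaken[OF run_Find[where s = s1 and N = N, OF n1 word_bounds(2,3)[OF W]]])
        fix v s' assume v: "v < N" "s' ''v'' 0 = v" and a: "agree {''g'', ''v''} s1 s'"
        have a': "agree {''f'', ''g'', ''v''} s s'" using a a1 by (auto simp: agree_def)
        have "holds W s' ?eg (ts ! v \<in> lower (ts ! b) \<and> ts ! v \<notin> lower (ts ! a))"
          by (intro holds_Mul holds_Neg bck[OF v a'] word_bounds(3)[OF W])
        then show "fits W s' ?eg \<and> (val s' ?eg \<noteq> 0 \<longleftrightarrow> ts ! v \<in> ?B)" unfolding holds_def by auto
      qed (auto simp: algebra_simps)
      fix s2 assume g2: "s2 ''g'' 0 = ?g" and "agree (writes (Find ''g'' ''v'' ?eg)) s1 s2"
      then have a12: "agree {''g'', ''v''} s1 s2" by simp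
      have a2: "agree {''f'', ''g'', ''v''} s s2" using a1 a12 by (auto simp: agree_def)
      have f2: "s2 ''f'' 0 = ?f" using agreeD[OF a12] f1 by simp
      have n2: "s2 ''n'' 0 = N" using agreeD[OF a2] n by simp
      have keep2: "s2 ''cx'' = s ''cx''" "s2 ''cy'' = s ''cy''" "s2 ''go'' = s ''go''"
        using agreeD[OF a2] by auto
      have "run W (Cond ?both ?inner ?stop) s2 (1 + cost ?both + (80 * (N + 1) + (6 + 50))) ?R"
      proof (rule run_Cond)
        have "s2 ''f'' 0 \<le> N" "s2 ''g'' 0 \<le> N" unfolding f2 g2 by (rule first_le)+
        then show "fits W s2 ?both" using n2 word_bounds[OF W] by auto
      next
        assume "val s2 ?both = 0"
        then have "\<not> (?f < N \<and> ?g < N)" using f2 g2 n2 by auto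
        then have "lower (ts ! a) \<subseteq> lower (ts ! b) \<or> lower (ts ! b) \<subseteq> lower (ts ! a)"
          unfolding lower_subset_iff first_less_iff by blast
        \<comment> \<open>Any equal pair encodes the absence of a condition; \<open>0\<close>,
          \<open>0\<close> is what the untouched cells already contain.\<close>
        then have "chain ts (ts ! a) (ts ! b) 0 0" by (rule chain.stop)
        moreover have "s ''cx'' = (s ''cx'')(x * N + y := 0)" "s ''cy'' = (s ''cy'')(x * N + y := 0)"
          using zero by (auto simp: fun_eq_iff)
        ultimately show "run W ?stop s2 (80 * (N + 1) + (6 + 50)) ?R"
          using keep2 ab(2) by (intro run_Assign) auto
      next
        assume "val s2 ?both \<noteq> 0"
        then have less: "?f < N" "?g < N" using f2 g2 n2 by (auto split: if_splits)
        let ?u = "ts ! ?f" and ?w = "ts ! ?g"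
        have fst: "is_first ts ?A ?u" "is_first ts ?B ?w" by (rule first_is_first[OF less(1)], rule first_is_first[OF less(2)])
        \<comment> \<open>The position of the first component drops with every replacement; this is
          the termination measure of \<open>Trace\<close>.\<close>
        have fa: "?f < a"
          using first_holds[OF less(1)] lower_index[OF ab(2) less(1)] by simp
        let ?Q = "\<lambda>v. \<not> ((ts ! v \<in> lower ?u) = (ts ! v \<in> lower ?w))"
        show "run W ?inner s2 (80 * (N + 1) + (6 + 50)) ?R"
        proof (rule run_Seq[where R = "\<lambda>s'. s' ''h'' 0 = first N ?Q"])
          show "run W (Find ''h'' ''v'' ?eh) s2 (80 * (N + 1)) (\<lambda>s'. s' ''h'' 0 = first N ?Q)"
          proof (rule run_weaken[OF run_Find[where s = s2 and N = N, OF n2 word_bounds(2,3)[OF W]]])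
            fix v s' assume v: "v < N" "s' ''v'' 0 = v" and a: "agree {''h'', ''v''} s2 s'"
            have a': "agree {''f'', ''g'', ''h'', ''v''} s s'" using a a2 by (auto simp: agree_def)
            have "graph_in N E r s'" "tau_in ts s'"
              by (rule graph_in_agree[OF g a'] tau_in_agree[OF tau a']; simp)+
            then have "holds W s' (Back ''f'') (ts ! v \<in> lower ?u)" "holds W s' (Back ''g'') (ts ! v \<in> lower ?w)"
              using holds_Back[of s' "''f''"] holds_Back[of s' "''g''"] v less f2 g2 agreeD[OF a] by auto
            then show "fits W s' ?eh \<and> (val s' ?eh \<noteq> 0 \<longleftrightarrow> ?Q v)"
              unfolding holds_def using word_bounds[OF W] by auto
          qed (auto simp: algebra_simps)
          fix s3 assume h3: "s3 ''h'' 0 = first N ?Q" and "agree (writes (Find ''h'' ''v'' ?eh)) s2 s3"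
          then have a3: "agree {''h'', ''v''} s2 s3" by simp
          have st3: "s3 ''f'' 0 = ?f" "s3 ''g'' 0 = ?g" "s3 ''n'' 0 = N" "s3 ''cx'' = s ''cx''"
            "s3 ''cy'' = s ''cy''" "s3 ''go'' = s ''go''" "s3 ''x'' 0 = x" "s3 ''y'' 0 = y"
            "s3 ''a'' 0 = a" "s3 ''b'' 0 = b" "s3 ''tau'' a = ts ! a" "s3 ''tau'' b = ts ! b"
            using agreeD[OF a3] agreeD[OF a2] keep2 f2 g2 n xy ab tau by (auto simp: tau_in_def ts(2))
          have "run W (Cond (Bin Less (Var ''h'') (Var ''n'')) ?down ?store) s3
            (1 + cost (Bin Less (Var ''h'') (Var ''n'')) + 50) ?R"
          proof (rule run_Cond)
            have "s3 ''h'' 0 \<le> N" unfolding h3 by (rule first_le)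
            then show "fits W s3 (Bin Less (Var ''h'') (Var ''n''))" using st3(3) word_bounds[OF W] by auto
          next
            assume "val s3 (Bin Less (Var ''h'') (Var ''n'')) \<noteq> 0"
            then have "\<exists>v<N. ?Q v" using h3 st3 first_less_iff[of N ?Q] by (auto split: if_splits)
            then have ne: "lower ?u \<noteq> lower ?w" by auto
            have "chain ts (ts ! a) (ts ! b) c d" if "chain ts ?u ?w c d" for c d
              by (rule chain.down[OF fst ne that])
            then have "run W ?down s3 (25 + 25) ?R"
              by (intro run_Seq[where R = "\<lambda>s'. s' = s3(''a'' := (s3 ''a'')(0 := ?f))"] run_Assign)
                (use st3 less fa word_bounds[OF W] in auto)
            then show "run W ?down s3 50 ?R" by simp
          next
            assume "val s3 (Bin Less (Var ''h'') (Var ''n'')) = 0"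
            then have "\<not> (\<exists>v<N. ?Q v)" using h3 st3 first_less_iff[of N ?Q] by auto
            then have "lower ?u = lower ?w" by (intro subset_antisym) (auto simp: lower_subset_iff)
            then have ch: "chain ts (ts ! a) (ts ! b) (ts ! a) (ts ! b)"
              by (rule chain.terminal[OF fst])
            have "run W ?store s3 (20 + (20 + 10)) ?R"
            proof (rule run_Seq[where R = "\<lambda>s'. s' = s3(''cx'' := (s3 ''cx'')(x * N + y := ts ! a))"])
              show "run W (Assign ''cx'' ?idx (Cell ''tau'' (Var ''a''))) s3 20
                (\<lambda>s'. s' = s3(''cx'' := (s3 ''cx'')(x * N + y := ts ! a)))"
                by (rule run_Assign) (use st3 xa ab xy xN word_bounds[OF W] in auto)
              fix s4 assume s4: "s4 = s3(''cx'' := (s3 ''cx'')(x * N + y := ts ! a))"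
              show "run W (Seq (Assign ''cy'' ?idx (Cell ''tau'' (Var ''b''))) ?stop) s4 (20 + 10) ?R"
              proof (rule run_Seq[where R = "\<lambda>s'. s' = s4(''cy'' := (s4 ''cy'')(x * N + y := ts ! b))"])
                show "run W (Assign ''cy'' ?idx (Cell ''tau'' (Var ''b''))) s4 20
                  (\<lambda>s'. s' = s4(''cy'' := (s4 ''cy'')(x * N + y := ts ! b)))"
                  by (rule run_Assign) (use s4 st3 xa ab xy xN word_bounds[OF W] in auto)
                fix s5 assume s5: "s5 = s4(''cy'' := (s4 ''cy'')(x * N + y := ts ! b))"
                show "run W ?stop s5 10 ?R"
                  by (rule run_Assign) (use s5 s4 st3 xa ch in auto)
              qed
            qed
            then show "run W ?store s3 50 ?R" by simp
          qed
          then show "run W (Cond (Bin Less (Var ''h'') (Var ''n'')) ?down ?store) s3 (6 + 50) ?R" by simp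
        qed
      qed
      then show "run W (Cond ?both ?inner ?stop) s2 (14 + (80 * (N + 1) + (6 + 50))) ?R"
        by (rule run_weaken) auto
    qed
  qed
  then show ?thesis by (rule run_weaken) auto
qed

lemma run_Trace:
  assumes g: "graph_in N E r s" and tau: "tau_in ts s"
    and xy: "s ''x'' 0 = x" "x < N" "s ''y'' 0 = y" "y < N"
    and zero: "s ''cx'' (x * N + y) = 0" "s ''cy'' (x * N + y) = 0"
  shows "run W Trace s (600 * (N + 1)\<^sup>2) (\<lambda>s'. s' ''on'' = (s ''on'')(x * N + y := 1) \<and>
    (\<exists>c<N. \<exists>d<N. chain ts x y c d \<and>
      s' ''cx'' = (s ''cx'')(x * N + y := c) \<and> s' ''cy'' = (s ''cy'')(x * N + y := d)))"
    (is "run W Trace s _ ?R")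
proof -
  let ?idx = "Bin Add (Bin Mul (Var ''x'') (Var ''n'')) (Var ''y'')"
  have n: "s ''n'' 0 = N" using g by (simp add: graph_in_def)
  have idx: "x * N + y < N * N" by (rule pair_index_less[OF xy(2,4)])
  have xN: "x * N \<le> W" "x * N + y \<le> W" using idx word_bounds[OF W] by auto
  have locate: "run W (Find p ''v'' (Bin Equal (Cell ''tau'' (Var ''v'')) (Var q))) s' (50 * (N + 1))
      (\<lambda>s''. s'' p 0 < N \<and> ts ! s'' p 0 = z)"
    if "tau_in ts s'" "s' ''n'' 0 = N" "s' q 0 = z" "z < N" "p \<noteq> ''v''" "p \<noteq> ''n''" "p \<noteq> ''tau''" "q \<noteq> ''v''" "p \<noteq> q"
    for s' p q z
  proof (rule run_weaken[OF run_Find[where s = s' and N = N and Q = "\<lambda>v. ts ! v = z", OF that(2) word_bounds(2,3)[OF W]]])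
    fix v s'' assume v: "v < N" "s'' ''v'' 0 = v" and a: "agree {p, ''v''} s' s''"
    have "s'' ''tau'' v = ts ! v" "s'' q 0 = z" using agreeD[OF a] that v by (auto simp: tau_in_def ts(2))
    then show "fits W s'' (Bin Equal (Cell ''tau'' (Var ''v'')) (Var q)) \<and>
      (val s'' (Bin Equal (Cell ''tau'' (Var ''v'')) (Var q)) \<noteq> 0 \<longleftrightarrow> ts ! v = z)"
      using v that(4) ts_order(3)[of v] word_bounds[OF W] by auto
  next
    fix s'' assume "s'' p 0 = first N (\<lambda>v. ts ! v = z)"
    moreover have "z \<in> set ts" using ts_order(2) that(4) by simp
    then have less: "first N (\<lambda>v. ts ! v = z) < N"
      unfolding first_less_iff using ts(2) by (auto simp: in_set_conv_nth)
    ultimately show "s'' p 0 < N \<and> ts ! s'' p 0 = z" using first_holds[OF less] by simp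
  qed (use that in auto)
  let ?loop = "For ''i'' ''n'' (Cond (Var ''go'') Step Skip)"
  \<comment> \<open>While \<open>go\<close> is 1, each of the \<open>j\<close> rounds has lowered
    the position in \<open>a\<close>. After \<open>N\<close> rounds \<open>a + N < N\<close> is
    impossible, so the chain has ended.\<close>
  let ?I = "\<lambda>j s'. s' ''on'' = (s ''on'')(x * N + y := 1) \<and>
    ((s' ''go'' 0 = 1 \<and> s' ''cx'' = s ''cx'' \<and> s' ''cy'' = s ''cy'' \<and> s' ''a'' 0 + j < N \<and> s' ''b'' 0 < N \<and>
      (\<forall>c d. chain ts (ts ! s' ''a'' 0) (ts ! s' ''b'' 0) c d \<longrightarrow> chain ts x y c d)) \<or>
     (s' ''go'' 0 = 0 \<and> (\<exists>c<N. \<exists>d<N. chain ts x y c d \<and>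
      s' ''cx'' = (s ''cx'')(x * N + y := c) \<and> s' ''cy'' = (s ''cy'')(x * N + y := d))))"
  have loop: "run W ?loop s1 (9 + (\<Sum>j<N. (3 + 400 * (N + 1)) + 12)) (?I N)"
    if I: "?I 0 s1" and a1: "agree {''a'', ''b'', ''v'', ''on'', ''go''} s s1" for s1
  proof (rule run_For[where I = ?I and N = N])
    show "s1 ''n'' 0 = N" using agreeD[OF a1] n by simp
    fix j s2 assume j: "j < N" and I: "?I j s2" and "agree (insert ''i'' (writes (Cond (Var ''go'') Step Skip))) s1 s2"
    then have a2: "agree {''f'', ''g'', ''h'', ''v'', ''a'', ''b'', ''cx'', ''cy'', ''go'', ''on'', ''i''} s s2"
      using a1 by (auto simp: agree_def)
    have "run W (Cond (Var ''go'') Step Skip) s2 (1 + cost (Var ''go'') + 400 * (N + 1)) (?I (Suc j))"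
    proof (rule run_Cond)
      show "fits W s2 (Var ''go'')" using I word_bounds[OF W] by auto
    next
      assume "val s2 (Var ''go'') = 0"
      with I show "run W Skip s2 (400 * (N + 1)) (?I (Suc j))" by (intro run_Skip) auto
    next
      assume "val s2 (Var ''go'') \<noteq> 0"
      with I have on: "s2 ''on'' = (s ''on'')(x * N + y := 1)" and go: "s2 ''go'' 0 = 1"
        and cxy: "s2 ''cx'' = s ''cx''" "s2 ''cy'' = s ''cy''"
        and aj: "s2 ''a'' 0 + j < N" and b: "s2 ''b'' 0 < N"
        and ch: "\<And>c d. chain ts (ts ! s2 ''a'' 0) (ts ! s2 ''b'' 0) c d \<Longrightarrow> chain ts x y c d"
        by auto
      have g2: "graph_in N E r s2" by (rule graph_in_agree[OF g a2]) auto
      have tau2: "tau_in ts s2" by (rule tau_in_agree[OF tau a2]) auto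
      show "run W Step s2 (400 * (N + 1)) (?I (Suc j))"
      proof (rule run_weaken[OF run_Step[OF g2 tau2 refl _ refl b]])
        show "s2 ''a'' 0 < N" using aj by simp
        show "s2 ''x'' 0 = x" "s2 ''y'' 0 = y" using agreeD[OF a2] xy by auto
        show "x < N" "y < N" by (rule xy)+
        show "s2 ''cx'' (x * N + y) = 0" "s2 ''cy'' (x * N + y) = 0" using cxy zero by auto
        fix s3 assume "agree (writes Step) s2 s3"
        then have "s3 ''on'' = s2 ''on''" by (rule agreeD) simp
        then have on3: "s3 ''on'' = (s ''on'')(x * N + y := 1)" using on by simp
        assume "(s3 ''go'' = s2 ''go'' \<and> s3 ''cx'' = s2 ''cx'' \<and> s3 ''cy'' = s2 ''cy'' \<and> s3 ''a'' 0 < s2 ''a'' 0 \<and> s3 ''b'' 0 < N \<and>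
          (\<forall>c d. chain ts (ts ! s3 ''a'' 0) (ts ! s3 ''b'' 0) c d \<longrightarrow> chain ts (ts ! s2 ''a'' 0) (ts ! s2 ''b'' 0) c d)) \<or>
          (s3 ''go'' 0 = 0 \<and> (\<exists>c<N. \<exists>d<N. chain ts (ts ! s2 ''a'' 0) (ts ! s2 ''b'' 0) c d \<and>
            s3 ''cx'' = (s2 ''cx'')(x * N + y := c) \<and> s3 ''cy'' = (s2 ''cy'')(x * N + y := d)))"
        then show "?I (Suc j) s3"
        proof
          assume "s3 ''go'' = s2 ''go'' \<and> s3 ''cx'' = s2 ''cx'' \<and> s3 ''cy'' = s2 ''cy'' \<and> s3 ''a'' 0 < s2 ''a'' 0 \<and> s3 ''b'' 0 < N \<and>
            (\<forall>c d. chain ts (ts ! s3 ''a'' 0) (ts ! s3 ''b'' 0) c d \<longrightarrow> chain ts (ts ! s2 ''a'' 0) (ts ! s2 ''b'' 0) c d)"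
          with on3 go cxy aj ch show ?thesis by simp
        next
          assume "s3 ''go'' 0 = 0 \<and> (\<exists>c<N. \<exists>d<N. chain ts (ts ! s2 ''a'' 0) (ts ! s2 ''b'' 0) c d \<and>
            s3 ''cx'' = (s2 ''cx'')(x * N + y := c) \<and> s3 ''cy'' = (s2 ''cy'')(x * N + y := d))"
          with on3 cxy ch show ?thesis by metis
        qed
      qed simp
    qed
    then show "run W (Cond (Var ''go'') Step Skip) s2 (3 + 400 * (N + 1)) (?I (Suc j))"
      by (rule run_weaken) auto
  qed (use I word_bounds[OF W] in auto)
  let ?T = "9 + (\<Sum>j<N. (3 + 400 * (N + 1)) + 12)"
  have "run W Trace s (50 * (N + 1) + (50 * (N + 1) + (20 + (5 + ?T)))) (?I N)"
    unfolding Trace_def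
  proof (rule run_Seq[OF locate])
    show "tau_in ts s" "s ''n'' 0 = N" "s ''x'' 0 = x" "x < N" by (rule tau n xy)+
    fix s1 assume A: "s1 ''a'' 0 < N \<and> ts ! s1 ''a'' 0 = x"
      and "agree (writes (Find ''a'' ''v'' (Bin Equal (Cell ''tau'' (Var ''v'')) (Var ''x'')))) s s1"
    then have a1: "agree {''a'', ''v''} s s1" by simp
    show "run W (Seq (Find ''b'' ''v'' (Bin Equal (Cell ''tau'' (Var ''v'')) (Var ''y'')))
        (Seq (Assign ''on'' ?idx (Const 1)) (Seq (Assign ''go'' (Const 0) (Const 1)) ?loop))) s1
      (50 * (N + 1) + (20 + (5 + ?T))) (?I N)"
    proof (rule run_Seq[OF locate])
      show "tau_in ts s1" by (rule tau_in_agree[OF tau a1]) simp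
      show "s1 ''n'' 0 = N" "s1 ''y'' 0 = y" using agreeD[OF a1] n xy by auto
      show "y < N" by (rule xy)
      fix s2 assume B: "s2 ''b'' 0 < N \<and> ts ! s2 ''b'' 0 = y"
        and "agree (writes (Find ''b'' ''v'' (Bin Equal (Cell ''tau'' (Var ''v'')) (Var ''y'')))) s1 s2"
      then have a12: "agree {''b'', ''v''} s1 s2" by simp
      then have a2: "agree {''a'', ''b'', ''v''} s s2" using a1 by (auto simp: agree_def)
      have A2: "s2 ''a'' 0 < N \<and> ts ! s2 ''a'' 0 = x" using A agreeD[OF a12] by simp
      have st2: "s2 ''n'' 0 = N" "s2 ''x'' 0 = x" "s2 ''y'' 0 = y" "s2 ''on'' = s ''on''"
        "s2 ''cx'' = s ''cx''" "s2 ''cy'' = s ''cy''"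
        using agreeD[OF a2] n xy by auto
      let ?s3 = "s2(''on'' := (s ''on'')(x * N + y := 1))"
      show "run W (Seq (Assign ''on'' ?idx (Const 1)) (Seq (Assign ''go'' (Const 0) (Const 1)) ?loop)) s2
        (20 + (5 + ?T)) (?I N)"
      proof (rule run_Seq[where R = "\<lambda>s'. s' = ?s3"])
        show "run W (Assign ''on'' ?idx (Const 1)) s2 20 (\<lambda>s'. s' = ?s3)"
          by (rule run_Assign) (use st2 xy xN word_bounds[OF W] in auto)
        fix s3 assume s3: "s3 = ?s3"
        show "run W (Seq (Assign ''go'' (Const 0) (Const 1)) ?loop) s3 (5 + ?T) (?I N)"
        proof (rule run_Seq[where R = "\<lambda>s'. s' = s3(''go'' := (s3 ''go'')(0 := 1))"])
          show "run W (Assign ''go'' (Const 0) (Const 1)) s3 5 (\<lambda>s'. s' = s3(''go'' := (s3 ''go'')(0 := 1)))"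
            by (rule run_Assign) (use word_bounds[OF W] in auto)
          fix s4 assume s4: "s4 = s3(''go'' := (s3 ''go'')(0 := 1))"
          show "run W ?loop s4 ?T (?I N)"
          proof (rule loop)
            show "?I 0 s4" using s4 s3 st2 A2 B by auto
            show "agree {''a'', ''b'', ''v'', ''on'', ''go''} s s4"
              using s4 s3 a2 by (auto simp: agree_def)
          qed
        qed
      qed
    qed auto
  qed auto
  then show ?thesis
  proof (rule run_weaken)
    have "50 * (N + 1) + (50 * (N + 1) + (20 + (5 + (9 + N * (3 + 400 * (N + 1) + 12))))) \<le> 600 * (N + 1)\<^sup>2"
      by (simp add: power2_eq_square algebra_simps)
    then show "50 * (N + 1) + (50 * (N + 1) + (20 + (5 + ?T))) \<le> 600 * (N + 1)\<^sup>2" by simp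
  qed auto
qed

lemma run_Prepare:
  assumes g: "graph_in N E r s" and P: "P \<subseteq> {..<N} \<times> {..<N}"
    and order: "\<And>x y. x < N \<Longrightarrow> y < N \<Longrightarrow> s ''order'' (x * N + y) = of_bool ((x, y) \<in> P)"
    and zero: "\<And>p. s ''on'' p = 0" "\<And>p. s ''cx'' p = 0" "\<And>p. s ''cy'' p = 0"
    and res: "\<And>v. v < N \<Longrightarrow> s ''result'' v = ts ! v"
  shows "run W Prepare s (100 * (N + 1)\<^sup>2 + card P * (600 * (N + 1)\<^sup>2))
    (\<lambda>s'. \<exists>C D. constraints_in N P C D s' \<and> (\<forall>(x, y) \<in> P. chain ts x y (C x y) (D x y)))"
proof -
  have N: "0 < N" using root_V by auto
  have n: "s ''n'' 0 = N" using g by (simp add: graph_in_def)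
  \<comment> \<open>Cells of untreated pairs are still 0, which is a vertex because of
    \<open>0 < N\<close>; \<open>Trace\<close> relies on finding them so.\<close>
  let ?I = "\<lambda>S s'. \<forall>x<N. \<forall>y<N. s' ''on'' (x * N + y) = of_bool ((x, y) \<in> P \<inter> S) \<and>
    s' ''cx'' (x * N + y) < N \<and> s' ''cy'' (x * N + y) < N \<and>
    ((x, y) \<in> P \<inter> S \<longrightarrow> chain ts x y (s' ''cx'' (x * N + y)) (s' ''cy'' (x * N + y))) \<and>
    ((x, y) \<notin> S \<longrightarrow> s' ''cx'' (x * N + y) = 0 \<and> s' ''cy'' (x * N + y) = 0)"
  let ?p = "Cond (At ''order'' (Var ''x'') (Var ''y'')) Trace Skip"
  have "run W Prepare s (33 * (N + 1) + ((11 + 30) * (N + 1)\<^sup>2 + card P * (600 * (N + 1)\<^sup>2)))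
    (?I ({..<N} \<times> {..<N}))"
    unfolding Prepare_def
  proof (rule run_Seq[where R = "tau_in ts"])
    show "run W (Fill ''tau'' ''v'' (Cell ''result'' (Var ''v''))) s (33 * (N + 1)) (tau_in ts)"
    proof (rule run_weaken[OF run_Fill[where F = "\<lambda>v. ts ! v" and s = s and N = N, OF n word_bounds(2,3)[OF W]]])
      fix v s' assume "v < N" "s' ''v'' 0 = v" "agree {''tau'', ''v''} s s'"
      then show "fits W s' (Cell ''result'' (Var ''v'')) \<and> val s' (Cell ''result'' (Var ''v'')) = ts ! v"
        using res ts_order(3)[of v] word_bounds[OF W] agreeD[of _ s s' "''result''"] by auto
    qed (auto simp: tau_in_def ts(2))
    fix s1 assume tau1: "tau_in ts s1" and "agree (writes (Fill ''tau'' ''v'' (Cell ''result'' (Var ''v'')))) s s1"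
    then have a1: "agree {''tau'', ''v''} s s1" by simp
    have n1: "s1 ''n'' 0 = N" using agreeD[OF a1] n by simp
    show "run W (Pairs ''x'' ''y'' ?p) s1 ((11 + 30) * (N + 1)\<^sup>2 + card P * (600 * (N + 1)\<^sup>2))
      (?I ({..<N} \<times> {..<N}))"
    proof (rule run_Pairs[where I = ?I and s = s1 and N = N, OF n1 word_bounds(2,3)[OF W]])
      show "?I {} s1" using agreeD[OF a1] zero N by simp
      fix S a b s2
      assume ab: "a < N" "b < N" "(a, b) \<notin> S" and I: "?I S s2" and xy: "s2 ''x'' 0 = a" "s2 ''y'' 0 = b"
        and "agree ({''x'', ''y''} \<union> writes ?p) s1 s2"
      then have a12: "agree {''x'', ''y'', ''f'', ''g'', ''h'', ''v'', ''a'', ''b'', ''cx'', ''cy'', ''go'', ''on'', ''i''} s1 s2"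
        by (simp add: insert_commute)
      then have a2: "agree {''tau'', ''x'', ''y'', ''f'', ''g'', ''h'', ''v'', ''a'', ''b'', ''cx'', ''cy'', ''go'', ''on'', ''i''} s s2"
        using a1 by (auto simp: agree_def)
      have g2: "graph_in N E r s2" by (rule graph_in_agree[OF g a2]) auto
      have tau2: "tau_in ts s2" by (rule tau_in_agree[OF tau1 a12]) auto
      have n2: "s2 ''n'' 0 = N" using g2 by (simp add: graph_in_def)
      have ord: "s2 ''order'' (a * N + b) = of_bool ((a, b) \<in> P)" using agreeD[OF a2] order ab by simp
      have ft: "fits W s2 (At ''order'' (Var ''x'') (Var ''y''))"
        using ab xy n2 ord word_bounds[OF W] by (intro fits_At[where N = N]) auto
      have other: "(x, y) \<in> insert (a, b) S \<longleftrightarrow> (x, y) = (a, b) \<or> (x, y) \<in> S" for x y by blast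
      show "run W ?p s2 (11 + (if (a, b) \<in> P then 600 * (N + 1)\<^sup>2 else 0)) (?I (insert (a, b) S))"
      proof (cases "(a, b) \<in> P")
        case False
        have "run W ?p s2 (1 + cost (At ''order'' (Var ''x'') (Var ''y'')) + 1) (?I (insert (a, b) S))"
          by (rule run_Cond[OF ft]) (use ord xy n2 False I in \<open>auto intro: run_Skip\<close>)
        then show ?thesis using False by simp
      next
        case True
        have "run W Trace s2 (600 * (N + 1)\<^sup>2) (?I (insert (a, b) S))"
        proof (rule run_weaken[OF run_Trace[OF g2 tau2 xy(1) ab(1) xy(2) ab(2)]])
          show "s2 ''cx'' (a * N + b) = 0" "s2 ''cy'' (a * N + b) = 0" using I ab by auto
          fix s3 assume "s3 ''on'' = (s2 ''on'')(a * N + b := 1) \<and> (\<exists>c<N. \<exists>d<N. chain ts a b c d \<and>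
            s3 ''cx'' = (s2 ''cx'')(a * N + b := c) \<and> s3 ''cy'' = (s2 ''cy'')(a * N + b := d))"
          then obtain c d where cd: "c < N" "d < N" "chain ts a b c d"
            "s3 ''on'' = (s2 ''on'')(a * N + b := 1)"
            "s3 ''cx'' = (s2 ''cx'')(a * N + b := c)" "s3 ''cy'' = (s2 ''cy'')(a * N + b := d)" by blast
          show "?I (insert (a, b) S) s3"
          proof (intro allI impI)
            fix x y assume xyN: "x < N" "y < N"
            note inj = pair_index_inject[OF xyN ab(1,2)]
            show "s3 ''on'' (x * N + y) = of_bool ((x, y) \<in> P \<inter> insert (a, b) S) \<and>
              s3 ''cx'' (x * N + y) < N \<and> s3 ''cy'' (x * N + y) < N \<and>
              ((x, y) \<in> P \<inter> insert (a, b) S \<longrightarrow> chain ts x y (s3 ''cx'' (x * N + y)) (s3 ''cy'' (x * N + y))) \<and>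
              ((x, y) \<notin> insert (a, b) S \<longrightarrow> s3 ''cx'' (x * N + y) = 0 \<and> s3 ''cy'' (x * N + y) = 0)"
            proof (cases "x = a \<and> y = b")
              case eq: True
              then show ?thesis using cd True by simp
            next
              case neq: False
              then have "x * N + y \<noteq> a * N + b" using inj by blast
              then show ?thesis using cd(4-6) I xyN neq by auto
            qed
          qed
        qed simp
        then have "run W ?p s2 (1 + cost (At ''order'' (Var ''x'') (Var ''y'')) + 600 * (N + 1)\<^sup>2) (?I (insert (a, b) S))"
          by (intro run_Cond[OF ft]) (use ord xy n2 True in auto)
        then show ?thesis by (rule run_weaken) (use True in auto)
      qed
    qed (use P in auto)
  qed
  then show ?thesis
  proof (rule run_weaken)
    show "33 * (N + 1) + ((11 + 30) * (N + 1)\<^sup>2 + card P * (600 * (N + 1)\<^sup>2)) \<le>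
      100 * (N + 1)\<^sup>2 + card P * (600 * (N + 1)\<^sup>2)"
      by (simp add: power2_eq_square algebra_simps)
    fix s' assume I: "?I ({..<N} \<times> {..<N}) s'"
    let ?C = "\<lambda>x y. s' ''cx'' (x * N + y)" and ?D = "\<lambda>x y. s' ''cy'' (x * N + y)"
    have "constraints_in N P ?C ?D s'" using I P by (auto simp: constraints_in_def)
    moreover have "\<forall>(x, y) \<in> P. chain ts x y (?C x y) (?D x y)" using I P by fastforce
    ultimately show "\<exists>C D. constraints_in N P C D s' \<and> (\<forall>(x, y) \<in> P. chain ts x y (C x y) (D x y))" by blast
  qed
qed

end


section \<open>The algorithm\<close>

definition algorithm :: com where
  "algorithm = Seq Search (Seq Prepare (Seq Search (Assign ''found'' (Const 0) (Neg (Var ''fail'')))))"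

lemma graph_rooted_chordal:
  assumes G: "pair_graph G" and con: "Digraph_Component.connected (with_proj G)"
    and cb: "chordal_bipartite G" and r: "r \<in> pverts G"
  shows "rooted_chordal (pverts G) (parcs G) r"
proof -
  interpret pair_graph G by (rule G)
  have rb: "rooted_bipartite (pverts G) (parcs G) r"
  proof
    show "parcs G \<subseteq> pverts G \<times> pverts G" using arc_fst_in_verts arc_snd_in_verts by fastforce
    show "sym (parcs G)" using pair_sym_arcs by (simp add: symmetric_def)
    show "r \<in> pverts G" by (rule r)
    show "(r, v) \<in> (parcs G)\<^sup>*" if "v \<in> pverts G" for v
    proof -
      have "r \<rightarrow>\<^sup>*\<^bsub>with_proj G\<^esub> v"
        using symmetric_connected_imp_strongly_connected[OF _ con] pair_sym_arcs that r
        by (auto simp: strongly_connected_def)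
      from reachable_rtranclI[OF this] show ?thesis by simp
    qed
    obtain A B where "A \<inter> B = {}" "parcs G \<subseteq> A \<times> B \<union> B \<times> A"
      using cb unfolding chordal_bipartite_def bipartite_def by blast
    then show "\<exists>S. \<forall>(u, v) \<in> parcs G. u \<in> S \<longleftrightarrow> v \<notin> S" by (intro exI[of _ A]) fast
  qed
  show ?thesis
    using rb chordal_bipartite_lower_chain[OF rb cb]
    by (simp add: rooted_chordal_def rooted_chordal_axioms_def)
qed

lemma run_algorithm:
  assumes G: "pair_graph G" "pverts G = {..<N}" "Digraph_Component.connected (with_proj G)"
    "chordal_bipartite G" and P: "partial_order_on (pverts G) P" and r: "r \<in> pverts G"
    and W: "N * N + N + 2 \<le> W"
  shows "run W algorithm (input_memory G P r) (20000 * (card P * N\<^sup>2)) (\<lambda>s.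
    if \<exists>xs. rooted_lbfs_extension G P r xs
    then s ''found'' 0 = 1 \<and> rooted_lbfs_extension G P r (map (s ''result'') [0..<N])
    else s ''found'' 0 = 0)"
    (is "run W _ ?s _ ?goal")
proof -
  let ?E = "parcs G" and ?V = "{..<N}"
  have rc: "rooted_chordal ?V ?E r" using graph_rooted_chordal[OF G(1,3,4) r] G(2) by simp
  interpret rooted_chordal ?V ?E r by (rule rc)
  have rN: "r < N" using root_V by simp
  have PV: "P \<subseteq> ?V \<times> ?V" "\<And>v. v < N \<Longrightarrow> (v, v) \<in> P"
    using P G(2) by (auto simp: partial_order_on_def preorder_on_def refl_on_def)
  have cardV: "card (pverts G) = N" using G(2) by simp
  have s: "graph_in N ?E r ?s" "\<And>x y. x < N \<Longrightarrow> y < N \<Longrightarrow> ?s ''order'' (x * N + y) = of_bool ((x, y) \<in> P)"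
    "\<And>p. ?s ''on'' p = 0" "\<And>p. ?s ''cx'' p = 0" "\<And>p. ?s ''cy'' p = 0"
    using pair_index_less[of _ N] by (auto simp: input_memory_def cardV graph_in_def Let_def)
  have ext: "rooted_lbfs_extension G P r xs \<longleftrightarrow>
      prefix xs \<and> set xs = ?V \<and> (\<forall>(x, y) \<in> P. x \<noteq> y \<longrightarrow> before xs x y)" for xs
  proof -
    have "finite (pverts G)" "pverts G \<noteq> {}" "P \<subseteq> pverts G \<times> pverts G"
      using G(2) PV(1) rN by auto
    from rooted_lbfs_extension_iff[OF this, of r xs] show ?thesis using G(2) by simp
  qed
  have full: "set xs = ?V" if "prefix xs" "length xs = N" for xs
    using search_prefix_distinct[OF that(1)] that(2) by (simp add: card_subset_eq distinct_card)
  let ?last = "Assign ''found'' (Const 0) (Neg (Var ''fail''))"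
  let ?T1 = "600 * (N + 1) ^ 3 + 300 * card ({} :: nat rel) * (N + 1)\<^sup>2"
  let ?T2 = "100 * (N + 1)\<^sup>2 + card P * (600 * (N + 1)\<^sup>2)"
  let ?T3 = "600 * (N + 1) ^ 3 + 300 * card P * (N + 1)\<^sup>2"
  have "run W algorithm ?s (?T1 + (?T2 + (?T3 + 10))) ?goal"
    unfolding algorithm_def
  proof (rule run_Seq[OF run_Search[where P = "{}" and C = "\<lambda>_ _. 0" and D = "\<lambda>_ _. 0", OF W rN s(1)]])
    show "constraints_in N {} (\<lambda>_ _. 0) (\<lambda>_ _. 0) ?s"
      using s(3-5) rN by (auto simp: constraints_in_def)
    show "{} \<subseteq> ?V \<times> ?V" by simp
    fix s1 assume res1: "search_result N ?E r {} (\<lambda>_ _. 0) (\<lambda>_ _. 0) s1" and a1: "agree (writes Search) ?s s1"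
    have unblocked: "\<not> blocked ?E {} C D xs v" for C D xs v by (simp add: blocked_def)
    define ts where "ts = map (s1 ''result'') [0..<N]"
    \<comment> \<open>With no pairs nothing is blocked, and a maximal label exists as long as a
      vertex is unnumbered; so the first search cannot fail.\<close>
    have "prefix ts"
    proof (rule ccontr)
      assume "\<not> prefix ts"
      then obtain xs where xs: "length xs < N" "\<And>v. \<not> lex_max ?E ?V r xs v"
        using res1 unblocked unfolding search_result_def ts_def constrained_prefix_def by blast
      have "card (set xs) < card ?V" using card_length[of xs] xs(1) by simp
      then have "?V - set xs \<noteq> {}" using card_mono[of "set xs" ?V] by (metis Diff_eq_empty_iff List.finite_set leD)
      with ex_lex_max[OF root_V] xs(2) show False by blast
    qed
    then have ts: "prefix ts" "length ts = N" by (auto simp: ts_def)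
    have g1: "graph_in N ?E r s1" by (rule graph_in_agree[OF s(1) a1]) auto
    show "run W (Seq Prepare (Seq Search ?last)) s1 (?T2 + (?T3 + 10)) ?goal"
    proof (rule run_Seq[OF run_Prepare[OF W rc ts g1 PV(1)]])
      show "s1 ''order'' (x * N + y) = of_bool ((x, y) \<in> P)" if "x < N" "y < N" for x y
        using agreeD[OF a1] s(2)[OF that] by simp
      show "s1 ''on'' p = 0" "s1 ''cx'' p = 0" "s1 ''cy'' p = 0" for p using agreeD[OF a1] s(3-5) by auto
      show "s1 ''result'' v = ts ! v" if "v < N" for v using that by (simp add: ts_def)
      fix s2 assume "\<exists>C D. constraints_in N P C D s2 \<and> (\<forall>(x, y) \<in> P. chain ts x y (C x y) (D x y))"
        and a2: "agree (writes Prepare) s1 s2"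
      then obtain C D where cs: "constraints_in N P C D s2"
        and ch: "\<And>x y. (x, y) \<in> P \<Longrightarrow> chain ts x y (C x y) (D x y)" by blast
      have g2: "graph_in N ?E r s2" by (rule graph_in_agree[OF g1 a2]) auto
      show "run W (Seq Search ?last) s2 (?T3 + 10) ?goal"
      proof (rule run_Seq[OF run_Search[OF W rN g2 cs PV(1)]])
        fix s3 assume res3: "search_result N ?E r P C D s3"
        let ?xs = "map (s3 ''result'') [0..<N]"
        have fits: "fits W s3 (Neg (Var ''fail''))" using res3 W by (auto simp: search_result_def)
        show "run W ?last s3 10 ?goal"
          using res3 unfolding search_result_def
        proof (elim disjE conjE exE)
          assume found: "s3 ''fail'' 0 = 0" "constrained_prefix ?E ?V r P C D ?xs"
          have px: "prefix ?xs" using found(2) by (simp add: constrained_prefix_def)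
          then have set_xs: "set ?xs = ?V" by (rule full) simp
          have "before ?xs x y" if "(x, y) \<in> P" "x \<noteq> y" for x y
            by (rule constrained_prefix_before[OF found(2) that]) (use set_xs PV(1) that in blast)
          then have "rooted_lbfs_extension G P r ?xs" unfolding ext using px set_xs by blast
          moreover have "\<exists>xs. rooted_lbfs_extension G P r xs" using calculation by blast
          ultimately show ?thesis using found(1) fits by (intro run_Assign) auto
        next
          fix xs
          assume stuck: "s3 ''fail'' 0 = 1" "constrained_prefix ?E ?V r P C D xs" "length xs < N"
            "\<forall>v. lex_max ?E ?V r xs v \<longrightarrow> blocked ?E P C D xs v"
          have "\<not> (\<exists>xs. rooted_lbfs_extension G P r xs)"
          proof
            assume "\<exists>xs. rooted_lbfs_extension G P r xs"
            then obtain ss where "rooted_lbfs_extension G P r ss" by blast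
            then have ss: "prefix ss" "set ss = ?V" "\<And>x y. (x, y) \<in> P \<Longrightarrow> x \<noteq> y \<Longrightarrow> before ss x y"
              using ext[of ss] by auto
            have "card (set xs) < card ?V" using card_length[of xs] stuck(3) by simp
            then have "?V - set xs \<noteq> {}" using card_mono[of "set xs" ?V] by (metis Diff_eq_empty_iff List.finite_set leD)
            then obtain z where "lex_max ?E ?V r xs z" using ex_lex_max[OF root_V] by blast
            from constrained_prefix_extend[OF ts(1) stuck(2) this ch ss] stuck(4) show False by blast
          qed
          then show ?thesis using stuck(1) fits by (intro run_Assign) auto
        qed
      qed
    qed
  qed
  then show ?thesis
  proof (rule run_weaken)
    have "N \<le> card P"
    proof -
      have "(\<lambda>v. (v, v)) ` ?V \<subseteq> P" using PV(2) by auto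
      then have "card ((\<lambda>v. (v, v)) ` ?V) \<le> card P"
        using PV(1) by (intro card_mono) (auto intro: finite_subset)
      then show ?thesis by (simp add: card_image inj_on_def)
    qed
    then have N3: "N ^ 3 \<le> card P * N\<^sup>2" by (simp add: power3_eq_cube power2_eq_square)
    have sq: "(N + 1)\<^sup>2 \<le> 4 * N\<^sup>2" "(N + 1) ^ 3 \<le> 8 * N ^ 3"
      using power_mono[of "N + 1" "2 * N" 2] power_mono[of "N + 1" "2 * N" 3] rN
      by (simp_all add: power_mult_distrib)
    have "1 \<le> card P" using \<open>N \<le> card P\<close> rN by linarith
    then have N2: "N\<^sup>2 \<le> card P * N\<^sup>2" by simp
    have N0: "1 \<le> N\<^sup>2" using rN by simp
    have cP: "card P * (N + 1)\<^sup>2 \<le> card P * (4 * N\<^sup>2)" by (intro mult_left_mono sq) simp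
    \<comment> \<open>Here \<open>m\<close> stands for \<open>card P * N\<^sup>2\<close>. The two
      searches contribute 9600 by their cubic terms, the loop over all pairs 400, the work per
      constraint 3600, and 10 remains: 13610 in total.\<close>
    have bound: "600 * a + 300 * card ({} :: nat rel) * b + ((100 * b + p * (600 * b)) + ((600 * a + 300 * p * b) + 10)) \<le> 20000 * m"
      if "a \<le> 8 * m" "b \<le> 4 * m" "p * b \<le> 4 * m" "1 \<le> m" for a b p m :: nat
      using that by (simp add: algebra_simps)
    show "?T1 + (?T2 + (?T3 + 10)) \<le> 20000 * (card P * N\<^sup>2)"
    proof (rule bound)
      show "(N + 1) ^ 3 \<le> 8 * (card P * N\<^sup>2)" using sq(2) N3 by linarith
      show "(N + 1)\<^sup>2 \<le> 4 * (card P * N\<^sup>2)" using sq(1) N2 by linarith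
      show "card P * (N + 1)\<^sup>2 \<le> 4 * (card P * N\<^sup>2)" using cP by simp
      show "1 \<le> card P * N\<^sup>2" using N2 N0 by linarith
    qed
  qed
qed

theorem theorem3:
  shows "\<exists>(prog :: com) (c :: nat) (k :: nat).
    \<forall>(n :: nat) (G :: nat pair_pre_digraph) (P :: nat rel) (r :: nat).
      pair_graph G \<and> pverts G = {..<n} \<and> Digraph_Component.connected (with_proj G) \<and>
      chordal_bipartite G \<and> partial_order_on (pverts G) P \<and> r \<in> pverts G \<longrightarrow>
      (\<exists>t s. exec (k * n ^ k) prog (input_memory G P r) t s \<and>
             t \<le> c * (card P * n\<^sup>2) \<and>
             (if \<exists>xs. rooted_lbfs_extension G P r xs
              then s ''found'' 0 = 1 \<and>
                   rooted_lbfs_extension G P r (map (s ''result'') [0..<n])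
              else s ''found'' 0 = 0))"
proof (rule exI[of _ algorithm], rule exI[of _ 20000], rule exI[of _ 4], intro allI impI, elim conjE)
  fix n :: nat and G :: "nat pair_pre_digraph" and P :: "nat rel" and r :: nat
  assume A: "pair_graph G" "pverts G = {..<n}" "Digraph_Component.connected (with_proj G)"
    "chordal_bipartite G" "partial_order_on (pverts G) P" "r \<in> pverts G"
  then have "1 \<le> n" by auto
  then have "n\<^sup>2 \<le> n ^ 4" "n \<le> n ^ 4" "1 \<le> n ^ 4"
    by (auto intro: power_increasing self_le_power)
  \<comment> \<open>Equality holds for \<open>n = 1\<close>; hence the choice of 4 for both factor
    and exponent. A bound polynomial in \<open>n\<close> means words of logarithmic length.\<close>
  then have "n * n + n + 2 \<le> 4 * n ^ 4" unfolding power2_eq_square by linarith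
  from run_algorithm[OF A this]
  show "\<exists>t s. exec (4 * n ^ 4) algorithm (input_memory G P r) t s \<and> t \<le> 20000 * (card P * n\<^sup>2) \<and>
      (if \<exists>xs. rooted_lbfs_extension G P r xs
       then s ''found'' 0 = 1 \<and> rooted_lbfs_extension G P r (map (s ''result'') [0..<n])
       else s ''found'' 0 = 0)"
    unfolding run_def by blast
qed

end
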